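(* Let $k$ be a positive integer and $N=2k$. Let $Q_1,Q_2\in L^2(\mathbb{H}^N)$ be real-valued. Then the equation $$P_k(u)+Q_1=Q_2\,e^{2u}\quad\text{on }\mathbb{H}^N$$ has a solution $u\in H^k(\mathbb{H}^N)+\mathbb{R}$, i.e. a solution of the form $u=w+c$ with $w\in H^k(\mathbb{H}^N)$ and $c\in\mathbb{R}$ a constant.
   Context: Functions are real-valued. $\mathbb{H}^N$ is the ball model of hyperbolic space: the open unit ball $\mathbb{B}^N\subset\mathbb{R}^N$ with the metric $g=\left(\frac{2}{1-|x|^2}\right)^2\sum_{i=1}^N dx_i^2$, volume element $dv_g=\left(\frac{2}{1-|x|^2}\right)^N dx$, gradient $\nabla_g=\left(\frac{1-|x|^2}{2}\right)^2\nabla$ and Laplace–Beltrami operator $\Delta_g$. $L^2(\mathbb{H}^N)$ is taken with respect to $dv_g$. For a nonnegative integer $m$, $\nabla_g^m:=\Delta_g^{m/2}$ if $m$ is even and $\nabla_g^m:=\nabla_g\Delta_g^{(m-1)/2}$ if $m$ is odd; $|\nabla_g^m u|_g$ is the absolute value if $m$ is even and the $g$-length of the vector if $m$ is odd. $H^k(\mathbb{H}^N)$ is the completion of $C_c^\infty(\mathbb{H}^N)$ with respect to the norm $\|u\|_{H^k(\mathbb{H}^N)}=\left[\sum_{m=0}^k\int_{\mathbb{H}^N}|\nabla_g^mu|_g^2\,dv_g\right]^{1/2}$. GJMS operators on $\mathbb{H}^N$: $P_1=-\Delta_g-\frac{N(N-2)}{4}$ and $P_k=P_1(P_1+2)(P_1+6)\cdots(P_1+k(k-1))=\prod_{j=1}^k\bigl(P_1+j(j-1)\bigr)$.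 A solution is understood in the weak (distributional) sense: $\int_{\mathbb{H}^N}u\,P_kv\,dv_g+\int_{\mathbb{H}^N}Q_1v\,dv_g=\int_{\mathbb{H}^N}Q_2e^{2u}v\,dv_g$ for all $v\in C_c^\infty(\mathbb{H}^N)$ (with $Q_2e^{2u}$ locally integrable). *)

theory Defs
  imports "HOL-Analysis.Analysis"
begin

section \<open>Test functions on the ball\<close>

definition partial_deriv :: "'n::finite \<Rightarrow> (real^'n \<Rightarrow> real) \<Rightarrow> real^'n \<Rightarrow> real" where
  "partial_deriv i f x = frechet_derivative f (at x) (axis i 1)"

fun Ck :: "nat \<Rightarrow> (real^'n::finite \<Rightarrow> real) \<Rightarrow> bool" where
  "Ck 0 f \<longleftrightarrow> continuous_on UNIV f"
| "Ck (Suc m) f \<longleftrightarrow> (\<forall>x. f differentiable (at x)) \<and> (\<forall>i. Ck m (partial_deriv i f))"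

text \<open>Functions on the open unit ball are represented by functions on all of \<open>real^'n\<close>. A compactly
  supported smooth function on the ball is identified with its extension by zero; since the
  closed support lies in the open ball, that extension is smooth on the whole space.\<close>

definition test_functions :: "(real^'n::finite \<Rightarrow> real) set" where
  "test_functions = {f. (\<forall>m. Ck m f) \<and> closure {x. f x \<noteq> 0} \<subseteq> ball 0 1}"

section \<open>The ball model of hyperbolic space\<close>

text \<open>The metric is \<open>g = (conf x)\<^sup>2 \<Sum>\<^sub>i dx\<^sub>i\<^sup>2\<close>. The formulas below are meaningful on
  the open unit ball only.\<close>

definition conf :: "real^'n::finite \<Rightarrow> real" where
  "conf x = 2 / (1 - (norm x)\<^sup>2)"

text \<open>The measure space has the open unit ball as its underlying set, so that measurability,
  integrals and integrability never depend on values outside the ball.\<close>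

definition hyp_vol :: "(real^'n::finite) measure" where
  "hyp_vol = density (lebesgue_on (ball 0 1)) (\<lambda>x. ennreal (conf x ^ CARD('n)))"

definition hyp_grad :: "(real^'n::finite \<Rightarrow> real) \<Rightarrow> real^'n \<Rightarrow> real^'n" where
  "hyp_grad f x = ((1 - (norm x)\<^sup>2) / 2)\<^sup>2 *\<^sub>R (\<chi> i. partial_deriv i f x)"

definition hyp_length :: "real^'n::finite \<Rightarrow> real^'n \<Rightarrow> real" where
  "hyp_length x v = conf x * norm v"

text \<open>Riemannian divergence \<open>(1/\<surd>det g) \<Sum>\<^sub>i \<partial>\<^sub>i (\<surd>det g X\<^sub>i)\<close>, with
  \<open>\<surd>det g = (conf x)\<^sup>N\<close>.\<close>

definition hyp_div :: "(real^'n::finite \<Rightarrow> real^'n) \<Rightarrow> real^'n \<Rightarrow> real" where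
  "hyp_div X x =
     (\<Sum>i\<in>UNIV. partial_deriv i (\<lambda>y. conf y ^ CARD('n) * X y $ i) x) / conf x ^ CARD('n)"

definition laplace_beltrami :: "(real^'n::finite \<Rightarrow> real) \<Rightarrow> real^'n \<Rightarrow> real" where
  "laplace_beltrami f = hyp_div (hyp_grad f)"

text \<open>The pointwise length \<open>|\<nabla>\<^sub>g\<^sup>m f|\<^sub>g\<close>.\<close>

definition nabla_length :: "nat \<Rightarrow> (real^'n::finite \<Rightarrow> real) \<Rightarrow> real^'n \<Rightarrow> real" where
  "nabla_length m f x =
     (if even m then \<bar>(laplace_beltrami ^^ (m div 2)) f x\<bar>
      else hyp_length x (hyp_grad ((laplace_beltrami ^^ ((m - 1) div 2)) f) x))"

section \<open>Function spaces\<close>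

definition L2 :: "'a measure \<Rightarrow> ('a \<Rightarrow> real) set" where
  "L2 M = {f \<in> borel_measurable M. integrable M (\<lambda>x. (f x)\<^sup>2)}"

definition hyp_locally_integrable :: "(real^'n::finite \<Rightarrow> real) \<Rightarrow> bool" where
  "hyp_locally_integrable f \<longleftrightarrow>
     (\<forall>K. compact K \<and> K \<subseteq> ball 0 1 \<longrightarrow> set_integrable hyp_vol K f)"

definition sobolev_norm :: "nat \<Rightarrow> (real^'n::finite \<Rightarrow> real) \<Rightarrow> real" where
  "sobolev_norm k f = sqrt (\<Sum>m\<le>k. \<integral>x. (nabla_length m f x)\<^sup>2 \<partial>hyp_vol)"

text \<open>The completion of the test functions under \<open>sobolev_norm k\<close>, realised as a space of
  functions. The norm dominates the \<open>L2\<close> norm (its summand for \<open>m = 0\<close>), so every Cauchy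
  sequence of test functions has an \<open>L2\<close> limit, which represents the corresponding element of
  the completion. As usual, members are determined up to almost everywhere equality.\<close>

definition sobolev_space :: "nat \<Rightarrow> (real^'n::finite \<Rightarrow> real) set" where
  "sobolev_space k =
     {w \<in> L2 hyp_vol. \<exists>\<phi> :: nat \<Rightarrow> real^'n \<Rightarrow> real.
        (\<forall>n. \<phi> n \<in> test_functions) \<and>
        (\<forall>e>0. \<exists>n0. \<forall>m\<ge>n0. \<forall>n\<ge>n0. sobolev_norm k (\<lambda>x. \<phi> m x - \<phi> n x) < e) \<and>
        (\<lambda>n. \<integral>x. (\<phi> n x - w x)\<^sup>2 \<partial>hyp_vol) \<longlonglongrightarrow> 0}"

section \<open>GJMS operators and weak solutions\<close>

definition P1 :: "(real^'n::finite \<Rightarrow> real) \<Rightarrow> real^'n \<Rightarrow> real" where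
  "P1 f x = - laplace_beltrami f x - real CARD('n) * (real CARD('n) - 2) / 4 * f x"

text \<open>\<open>gjms k\<close> is the composition of the factors \<open>P1 + j (j - 1)\<close> for
  \<open>j = 1, \<dots>, k\<close>, the factor with \<open>j = k\<close> being applied first.\<close>

fun gjms :: "nat \<Rightarrow> (real^'n::finite \<Rightarrow> real) \<Rightarrow> real^'n \<Rightarrow> real" where
  "gjms 0 f = f"
| "gjms (Suc j) f = gjms j (\<lambda>x. P1 f x + real (Suc j) * real j * f x)"

definition weak_solution ::
  "nat \<Rightarrow> (real^'n::finite \<Rightarrow> real) \<Rightarrow> (real^'n \<Rightarrow> real) \<Rightarrow> (real^'n \<Rightarrow> real) \<Rightarrow> bool" where
  "weak_solution k Q\<^sub>1 Q\<^sub>2 u \<longleftrightarrow>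
     hyp_locally_integrable u \<and>
     hyp_locally_integrable Q\<^sub>1 \<and>
     hyp_locally_integrable (\<lambda>x. Q\<^sub>2 x * exp (2 * u x)) \<and>
     (\<forall>v \<in> test_functions.
        (\<integral>x. u x * gjms k v x \<partial>hyp_vol) + (\<integral>x. Q\<^sub>1 x * v x \<partial>hyp_vol)
          = (\<integral>x. Q\<^sub>2 x * exp (2 * u x) * v x \<partial>hyp_vol))"

end

theory Submission
  imports Defs "HOL-Computational_Algebra.Polynomial"
begin

text \<open>Put \<open>w = u - c\<close> and \<open>\<epsilon> = e\<^bsup>2c\<^esup>\<close>. The equation becomes \<open>P\<^sub>k w = f\<close> with
  \<open>f = \<epsilon> Q\<^sub>2 e\<^bsup>2w\<^esup> - Q\<^sub>1\<close>, because constants are annihilated by \<open>P\<^sub>k\<close> in dimension \<open>2k\<close>. If the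
  linear solution operator maps \<open>L\<^sup>2\<close> boundedly to \<open>H\<^sup>k \<inter> L\<^sup>\<infinity>\<close>, then for small \<open>\<epsilon>\<close>, that is for very negative
  \<open>c\<close>, the map \<open>f \<mapsto> \<epsilon> Q\<^sub>2 e\<^bsup>2w\<^esup> - Q\<^sub>1\<close> is a contraction on a ball of \<open>L\<^sup>2\<close>.

  The bound in \<open>H\<^sup>k\<close> is a spectral one: \<open>P\<^sub>k\<close> is the product of the factors \<open>B + (j - 1/2)\<^sup>2\<close> for
  \<open>B = - \<Delta>\<^sub>g - (N - 1)\<^sup>2/4 \<ge> 0\<close>, hence a polynomial in \<open>B\<close> with positive coefficients, and minimizing
  the energy yields solutions in \<open>H\<^sup>k\<close>. For the bound in \<open>L\<^sup>\<infinity>\<close>, conformal covariance turns \<open>P\<^sub>k\<close> into the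
  Euclidean operator \<open>(- \<Delta>)\<^sup>k\<close>; the equation is tested with truncations of \<open>ln (|x - y|\<^sup>2/\<delta>\<^sup>2 + e)\<close> at the
  scale \<open>\<delta>\<close> of the distance from \<open>y\<close> to the boundary, and \<open>\<Delta>\<^sup>k ln (|z|\<^sup>2 + e)\<close> is an explicit multiple of the
  approximate identity \<open>e\<^sup>k (|z|\<^sup>2 + e)\<^bsup>-2k\<^esup>\<close>.\<close>

section \<open>Smooth functions\<close>

text \<open>In dimension \<open>2 k\<close> the space \<open>H^k\<close> does not embed into the
  bounded functions, so membership of \<open>w\<close> in \<open>H^k\<close> cannot control
  \<open>exp (2 * w)\<close>; boundedness has to be extracted from the equation with its square
  integrable right hand side. The delicate point is uniformity up to the boundary, where
  \<open>conf\<close> blows up. A Euclidean ball around \<open>y\<close> whose radius is a fixed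
  fraction of the boundary distance has bounded hyperbolic size: on it \<open>conf\<close> is
  comparable to the inverse distance. Since the dimension is \<open>2 k\<close>, applying
  \<open>k\<close> Laplacians to a function rescaled by \<open>\<delta>\<close> produces exactly the
  factor that normalises averages and matches the volume density, so every constant is independent
  of \<open>y\<close>. The logarithm enters as fundamental solution of the critical polyharmonic
  operator; its square is integrable at the pole, which is what pairing with \<open>f\<close>
  requires, and truncating it costs only a bounded remainder. The estimate obtained contains squared
  norms plus one; dividing \<open>w\<close> and \<open>f\<close> by \<open>M\<close> turns it into a
  bound linear in \<open>M\<close>, and this linearity makes the nonlinear map Lipschitz.\<close>

lemma partial_deriv_eq: "(f has_derivative f') (at x) \<Longrightarrow> partial_deriv i f x = f' (axis i 1)"
  unfolding partial_deriv_def using frechet_derivative_at by metis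

lemma differentiable_partial_deriv:
  "f differentiable at x \<Longrightarrow> (f has_derivative frechet_derivative f (at x)) (at x)"
  by (simp add: frechet_derivative_works)

lemma partial_deriv_add:
  "f differentiable at x \<Longrightarrow> g differentiable at x \<Longrightarrow>
    partial_deriv i (\<lambda>x. f x + g x) x = partial_deriv i f x + partial_deriv i g x"
  by (subst partial_deriv_eq[OF has_derivative_add[OF differentiable_partial_deriv differentiable_partial_deriv]])
     (simp_all add: partial_deriv_def)

lemma partial_deriv_mult:
  fixes f g :: "real^'n::finite \<Rightarrow> real"
  shows "f differentiable at x \<Longrightarrow> g differentiable at x \<Longrightarrow>
    partial_deriv i (\<lambda>x. f x * g x) x = f x * partial_deriv i g x + partial_deriv i f x * g x"
  by (subst partial_deriv_eq[OF has_derivative_mult[OF differentiable_partial_deriv differentiable_partial_deriv]])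
     (simp_all add: partial_deriv_def)

lemma partial_deriv_const [simp]: "partial_deriv i (\<lambda>x. c) x = 0"
  unfolding partial_deriv_def by simp

lemma partial_deriv_nth: "partial_deriv i (\<lambda>x. x $ j) x = (if i = j then 1 else 0)"
  by (subst partial_deriv_eq[OF bounded_linear.has_derivative[OF bounded_linear_vec_nth has_derivative_ident]])
     (auto simp: axis_def)

lemma partial_deriv_chain:
  assumes "(\<phi> has_real_derivative d) (at (f x))" "f differentiable at x"
  shows "partial_deriv i (\<lambda>x. \<phi> (f x)) x = d * partial_deriv i f x"
proof -
  obtain f' where f': "(f has_derivative f') (at x)"
    using assms(2) differentiable_def by blast
  have "((\<lambda>x. \<phi> (f x)) has_derivative (\<lambda>h. d * f' h)) (at x)"
    using has_derivative_compose[OF f' assms(1)[unfolded has_field_derivative_def]] by simp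
  then show ?thesis using f' by (simp add: partial_deriv_eq)
qed

lemma partial_deriv_cong:
  assumes "open S" "x \<in> S" "\<And>y. y \<in> S \<Longrightarrow> f y = g y"
  shows "partial_deriv i f x = partial_deriv i g x"
proof -
  have "(f has_derivative f') (at x) \<longleftrightarrow> (g has_derivative f') (at x)" for f'
    using assms has_derivative_transform_within_open by metis
  then show ?thesis unfolding partial_deriv_def frechet_derivative_def by simp
qed

lemma Ck_SucD: "Ck (Suc m) f \<Longrightarrow> Ck m f"
proof (induction m arbitrary: f)
  case 0
  then show ?case
    by (auto simp: continuous_on_eq_continuous_within intro: differentiable_imp_continuous_within)
qed simp

lemma Ck_const: "Ck m (\<lambda>x. c)"
proof (induction m arbitrary: c)
  case (Suc m)
  have "partial_deriv i (\<lambda>x. c) = (\<lambda>x. 0)" for i :: 'a by auto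
  then show ?case using Suc by simp
qed simp

lemma Ck_add: "Ck m f \<Longrightarrow> Ck m g \<Longrightarrow> Ck m (\<lambda>x. f x + g x)"
proof (induction m arbitrary: f g)
  case (Suc m)
  then have "partial_deriv i (\<lambda>x. f x + g x) = (\<lambda>x. partial_deriv i f x + partial_deriv i g x)" for i
    by (auto simp: partial_deriv_add)
  with Suc show ?case by auto
qed (auto intro: continuous_intros)

lemma Ck_mult: "Ck m f \<Longrightarrow> Ck m g \<Longrightarrow> Ck m (\<lambda>x. f x * g x)"
proof (induction m arbitrary: f g)
  case (Suc m)
  then have "partial_deriv i (\<lambda>x. f x * g x) = (\<lambda>x. f x * partial_deriv i g x + partial_deriv i f x * g x)" for i
    by (auto simp: partial_deriv_mult)
  with Suc Ck_SucD[OF Suc.prems(1)] Ck_SucD[OF Suc.prems(2)] show ?case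
    by (auto intro!: Ck_add Suc.IH)
qed (auto intro: continuous_intros)

lemma Ck_nth: "Ck m (\<lambda>x. x $ i)"
proof (cases m)
  case (Suc m')
  have "partial_deriv j (\<lambda>x. x $ i) = (\<lambda>x. if j = i then 1 else 0)" for j
    by (auto simp: partial_deriv_nth)
  then show ?thesis using Suc Ck_const
    by (auto intro: bounded_linear_imp_differentiable bounded_linear_vec_nth)
qed (auto intro: continuous_intros)

text \<open>The outer function comes with all its derivatives as a sequence \<open>\<phi>\<close>:
  the chain rule turns \<open>\<phi> j\<close> into \<open>\<phi> (Suc j)\<close> times a partial
  derivative of \<open>f\<close>, so an induction over the order with arbitrary \<open>j\<close>
  closes. The set \<open>S\<close> admits outer functions such as the logarithm that are smooth only
  on part of the line.\<close>

lemma Ck_chain: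
  assumes "\<And>x. f x \<in> S" "\<And>j s. s \<in> S \<Longrightarrow> (\<phi> j has_real_derivative \<phi> (Suc j) s) (at s)"
  shows "Ck m f \<Longrightarrow> Ck m (\<lambda>x. \<phi> j (f x))"
proof (induction m arbitrary: j)
  case 0
  have "isCont (\<phi> j) (f x)" for x using assms DERIV_isCont by blast
  then show ?case using 0
    by (auto simp: continuous_on_eq_continuous_at intro: isCont_o2)
next
  case (Suc m)
  have d: "(\<lambda>x. \<phi> j (f x)) differentiable at x" for x
    using Suc.prems assms(2)[OF assms(1), of j x]
      differentiable_compose[of "\<phi> j" f x UNIV]
    by (auto simp: has_field_derivative_def differentiable_def intro: differentiable_compose)
  have "partial_deriv i (\<lambda>x. \<phi> j (f x)) = (\<lambda>x. \<phi> (Suc j) (f x) * partial_deriv i f x)" for i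
    using Suc.prems assms by (auto intro!: partial_deriv_chain)
  then show ?case using d Suc.IH Suc.prems Ck_SucD[OF Suc.prems] by (auto intro!: Ck_mult)
qed

definition smooth :: "(real^'n::finite \<Rightarrow> real) \<Rightarrow> bool" where
  "smooth f \<longleftrightarrow> (\<forall>m. Ck m f)"

lemma smooth_differentiable: "smooth f \<Longrightarrow> f differentiable at x"
  unfolding smooth_def by (metis Ck.simps(2))

lemma smooth_continuous: "smooth f \<Longrightarrow> continuous_on S f"
  unfolding smooth_def by (metis Ck.simps(1) continuous_on_subset subset_UNIV)

lemma smooth_partial: "smooth f \<Longrightarrow> smooth (partial_deriv i f)"
  unfolding smooth_def by (metis Ck.simps(2))

lemma smooth_const: "smooth (\<lambda>x. c)" by (simp add: smooth_def Ck_const)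
lemma smooth_nth: "smooth (\<lambda>x. x $ i)" by (simp add: smooth_def Ck_nth)
lemma smooth_add: "smooth f \<Longrightarrow> smooth g \<Longrightarrow> smooth (\<lambda>x. f x + g x)" by (simp add: smooth_def Ck_add)
lemma smooth_mult: "smooth f \<Longrightarrow> smooth g \<Longrightarrow> smooth (\<lambda>x. f x * g x)" by (simp add: smooth_def Ck_mult)

lemma smooth_uminus: "smooth f \<Longrightarrow> smooth (\<lambda>x. - f x)"
  using smooth_mult[OF smooth_const[of "-1"], of f] by simp

lemma smooth_diff: "smooth f \<Longrightarrow> smooth g \<Longrightarrow> smooth (\<lambda>x. f x - g x)"
  using smooth_add[OF _ smooth_uminus, of f g] by simp

lemma smooth_sum: "(\<And>i. i \<in> A \<Longrightarrow> smooth (f i)) \<Longrightarrow> smooth (\<lambda>x. \<Sum>i\<in>A. f i x)"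
  by (induction A rule: infinite_finite_induct) (auto intro: smooth_const smooth_add)

lemma smooth_power: "smooth f \<Longrightarrow> smooth (\<lambda>x. f x ^ m)"
  by (induction m) (auto intro: smooth_const smooth_mult)

lemma norm_sq_sum: "(norm (x::real^'n::finite))\<^sup>2 = (\<Sum>i\<in>UNIV. x $ i * x $ i)"
  by (simp add: norm_vec_def L2_set_def sum_nonneg power2_eq_square)

lemma smooth_norm_sq: "smooth (\<lambda>x. (norm x)\<^sup>2)"
  unfolding norm_sq_sum by (intro smooth_sum smooth_mult smooth_nth)

lemma smooth_chain:
  assumes "\<And>x. f x \<in> S" "\<And>j s. s \<in> S \<Longrightarrow> (\<phi> j has_real_derivative \<phi> (Suc j) s) (at s)" "smooth f"
  shows "smooth (\<lambda>x. \<phi> j (f x))"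
  using assms Ck_chain[of f S \<phi>] unfolding smooth_def by blast

lemmas smooth_intros = smooth_const smooth_nth smooth_add smooth_mult smooth_uminus smooth_diff
  smooth_sum smooth_power smooth_norm_sq smooth_partial

lemma partial_deriv_norm_sq: "partial_deriv i (\<lambda>x. (norm x)\<^sup>2) x = 2 * x $ i"
proof -
  have "((\<lambda>x. x \<bullet> x) has_derivative (\<lambda>h. x \<bullet> h + h \<bullet> x)) (at x)"
    by (intro derivative_eq_intros) auto
  from partial_deriv_eq[OF this] show ?thesis
    by (simp add: power2_norm_eq_inner inner_axis inner_commute)
qed

lemma partial_deriv_cmult:
  "f differentiable at x \<Longrightarrow> partial_deriv i (\<lambda>x. c * f x) x = c * partial_deriv i f x"
  by (simp add: partial_deriv_mult)

lemma partial_deriv_sum: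
  "finite A \<Longrightarrow> (\<And>j. j \<in> A \<Longrightarrow> f j differentiable at x) \<Longrightarrow>
    partial_deriv i (\<lambda>x. \<Sum>j\<in>A. f j x) x = (\<Sum>j\<in>A. partial_deriv i (f j) x)"
  by (induction A rule: finite_induct) (auto simp: partial_deriv_add)

lemma partial_deriv_power:
  assumes "f differentiable at x"
  shows "partial_deriv i (\<lambda>x. f x ^ m) x = real m * f x ^ (m - 1) * partial_deriv i f x"
  by (rule partial_deriv_chain[OF _ assms]) (auto intro!: derivative_eq_intros)

lemma partial_deriv_scaled:
  assumes "\<delta> \<noteq> 0" "f differentiable at ((x - y) /\<^sub>R \<delta>)"
  shows "partial_deriv i (\<lambda>x. f ((x - y) /\<^sub>R \<delta>)) x = partial_deriv i f ((x - y) /\<^sub>R \<delta>) / \<delta>"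
proof -
  obtain f' where f': "(f has_derivative f') (at ((x - y) /\<^sub>R \<delta>))"
    using assms(2) differentiable_def by blast
  have "((\<lambda>x. (x - y) /\<^sub>R \<delta>) has_derivative (\<lambda>h. h /\<^sub>R \<delta>)) (at x)"
    by (auto intro!: derivative_eq_intros)
  from has_derivative_compose[OF this f']
  have "partial_deriv i (\<lambda>x. f ((x - y) /\<^sub>R \<delta>)) x = f' (axis i 1 /\<^sub>R \<delta>)"
    by (rule partial_deriv_eq)
  also have "\<dots> = f' (axis i 1) / \<delta>"
    using linear_scale[OF has_derivative_linear[OF f']] by (simp add: field_simps)
  finally show ?thesis using f' by (simp add: partial_deriv_eq)
qed

lemma deriv_along_axis:
  fixes f :: "real^'n::finite \<Rightarrow> real"
  assumes "f differentiable at (p + s *\<^sub>R axis i 1)"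
  shows "((\<lambda>s. f (p + s *\<^sub>R axis i 1)) has_real_derivative partial_deriv i f (p + s *\<^sub>R axis i 1)) (at s)"
proof -
  let ?q = "p + s *\<^sub>R axis i (1::real)"
  let ?f' = "frechet_derivative f (at ?q)"
  have f': "(f has_derivative ?f') (at ?q)"
    using assms by (rule differentiable_partial_deriv)
  have "((\<lambda>s. p + s *\<^sub>R axis i (1::real)) has_derivative (\<lambda>h. h *\<^sub>R axis i 1)) (at s)"
    by (auto intro!: derivative_eq_intros)
  from has_derivative_compose[OF this f']
  have "((\<lambda>s. f (p + s *\<^sub>R axis i 1)) has_derivative (\<lambda>h. ?f' (h *\<^sub>R axis i 1))) (at s)" .
  moreover have "?f' (h *\<^sub>R axis i 1) = partial_deriv i f ?q * h" for h
    using linear_scale[OF has_derivative_linear[OF f']] by (simp add: partial_deriv_def)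
  ultimately show ?thesis by (simp add: has_field_derivative_def)
qed

text \<open>The mean value theorem is applied twice, first along axis \<open>i\<close> to the
  difference of two translates along axis \<open>j\<close>, then along axis \<open>j\<close> to the
  partial derivative. The left side is symmetric in \<open>i\<close> and \<open>j\<close>, the right
  side is not, and \<open>partial_deriv_commute\<close> exploits this.\<close>

lemma second_difference:
  fixes f :: "real^'n::finite \<Rightarrow> real"
  assumes "smooth f" "h > 0"
  shows "\<exists>p. dist p x \<le> 2 * h \<and>
    f (x + h *\<^sub>R axis i 1 + h *\<^sub>R axis j 1) - f (x + h *\<^sub>R axis i 1) - f (x + h *\<^sub>R axis j 1) + f x
      = h\<^sup>2 * partial_deriv j (partial_deriv i f) p"
proof -
  let ?a = "axis i (1::real)" and ?b = "axis j (1::real)"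
  let ?\<phi> = "\<lambda>s. f ((x + h *\<^sub>R ?b) + s *\<^sub>R ?a) - f (x + s *\<^sub>R ?a)"
  let ?\<phi>' = "\<lambda>s. partial_deriv i f ((x + h *\<^sub>R ?b) + s *\<^sub>R ?a) - partial_deriv i f (x + s *\<^sub>R ?a)"
  have "(?\<phi> has_real_derivative ?\<phi>' s) (at s)" for s
    by (intro DERIV_diff deriv_along_axis smooth_differentiable assms)
  then obtain s where s: "0 < s" "s < h" "?\<phi> h - ?\<phi> 0 = (h - 0) * ?\<phi>' s"
    using MVT2[of 0 h ?\<phi> ?\<phi>'] assms by blast
  let ?\<psi> = "\<lambda>t. partial_deriv i f ((x + s *\<^sub>R ?a) + t *\<^sub>R ?b)"
  let ?\<psi>' = "\<lambda>t. partial_deriv j (partial_deriv i f) ((x + s *\<^sub>R ?a) + t *\<^sub>R ?b)"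
  have "(?\<psi> has_real_derivative ?\<psi>' t) (at t)" for t
    by (intro deriv_along_axis smooth_differentiable smooth_partial assms)
  then obtain t where t: "0 < t" "t < h" "?\<psi> h - ?\<psi> 0 = (h - 0) * ?\<psi>' t"
    using MVT2[of 0 h ?\<psi> ?\<psi>'] assms by blast
  have "?\<phi>' s = ?\<psi> h - ?\<psi> 0" by (simp add: algebra_simps)
  then have "?\<phi> h - ?\<phi> 0 = h * (h * ?\<psi>' t)" using s(3) t(3) by simp
  moreover have "dist ((x + s *\<^sub>R ?a) + t *\<^sub>R ?b) x \<le> 2 * h"
  proof -
    have "norm (s *\<^sub>R ?a + t *\<^sub>R ?b) \<le> \<bar>s\<bar> * 1 + \<bar>t\<bar> * 1"
      by (rule order_trans[OF norm_triangle_ineq]) simp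
    then show ?thesis using s t by (simp add: dist_norm algebra_simps)
  qed
  ultimately show ?thesis
    by (intro exI[of _ "(x + s *\<^sub>R ?a) + t *\<^sub>R ?b"]) (simp add: algebra_simps power2_eq_square)
qed

lemma partial_deriv_commute:
  fixes f :: "real^'n::finite \<Rightarrow> real"
  assumes "smooth f"
  shows "partial_deriv i (partial_deriv j f) x = partial_deriv j (partial_deriv i f) x"
proof (rule ccontr)
  let ?G = "partial_deriv i (partial_deriv j f)" and ?H = "partial_deriv j (partial_deriv i f)"
  assume "?G x \<noteq> ?H x"
  \<comment> \<open>Half the gap: a common value within \<open>e\<close> of both \<open>?G x\<close>
    and \<open>?H x\<close> is impossible.\<close>
  define e where "e = dist (?G x) (?H x) / 2"
  have e: "e > 0" using \<open>?G x \<noteq> ?H x\<close> by (simp add: e_def)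
  have "continuous_on UNIV ?G" "continuous_on UNIV ?H"
    by (intro smooth_continuous smooth_partial assms)+
  with e obtain d1 d2 where d: "d1 > 0" "\<And>y. dist y x < d1 \<Longrightarrow> dist (?G y) (?G x) < e"
      "d2 > 0" "\<And>y. dist y x < d2 \<Longrightarrow> dist (?H y) (?H x) < e"
    unfolding continuous_on_iff by (metis UNIV_I)
  define h where "h = min d1 d2 / 3"
  have h: "h > 0" "2 * h < d1" "2 * h < d2" using d by (auto simp: h_def)
  obtain p where p: "dist p x \<le> 2 * h"
    "f (x + h *\<^sub>R axis i 1 + h *\<^sub>R axis j 1) - f (x + h *\<^sub>R axis i 1) - f (x + h *\<^sub>R axis j 1) + f x
      = h\<^sup>2 * ?H p" using second_difference[OF assms h(1)] by blast
  obtain q where q: "dist q x \<le> 2 * h"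
    "f (x + h *\<^sub>R axis j 1 + h *\<^sub>R axis i 1) - f (x + h *\<^sub>R axis j 1) - f (x + h *\<^sub>R axis i 1) + f x
      = h\<^sup>2 * ?G q" using second_difference[OF assms h(1)] by blast
  have "h\<^sup>2 * ?H p = h\<^sup>2 * ?G q" using p(2) q(2) by (simp add: algebra_simps)
  then have "?H p = ?G q" using h by simp
  moreover have "dist (?G q) (?G x) < e" "dist (?H p) (?H x) < e" using d p q h by auto
  ultimately show False
    using dist_triangle2[of "?G x" "?H x" "?G q"] by (simp add: e_def dist_commute field_simps)
qed

section \<open>Test functions: closure properties, integrability, integration by parts\<close>

lemma test_smooth: "v \<in> test_functions \<Longrightarrow> smooth v"
  by (simp add: test_functions_def smooth_def)

lemma test_outside: "v \<in> test_functions \<Longrightarrow> x \<notin> ball 0 1 \<Longrightarrow> v x = 0"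
  unfolding test_functions_def using closure_subset[of "{x. v x \<noteq> 0}"] by auto

text \<open>Any compact set off which \<open>v\<close> vanishes replaces the closure of the support,
  so supports of sums, products and derivatives need not be computed.\<close>

lemma test_functionsI:
  "smooth v \<Longrightarrow> compact K \<Longrightarrow> K \<subseteq> ball 0 1 \<Longrightarrow> (\<And>x. x \<notin> K \<Longrightarrow> v x = 0) \<Longrightarrow> v \<in> test_functions"
  unfolding test_functions_def smooth_def
  using closure_minimal[of "{x. v x \<noteq> 0}" K] compact_imp_closed by blast

lemma test_support:
  assumes "v \<in> test_functions"
  obtains K where "compact K" "K \<subseteq> ball 0 1" "\<And>x. x \<notin> K \<Longrightarrow> v x = 0"
proof
  show "compact (closure {x. v x \<noteq> 0})"
    using assms bounded_subset[OF bounded_ball] unfolding test_functions_def compact_eq_bounded_closed by auto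
  show "closure {x. v x \<noteq> 0} \<subseteq> ball 0 1" using assms by (simp add: test_functions_def)
  show "v x = 0" if "x \<notin> closure {x. v x \<noteq> 0}" for x
    using that closure_subset[of "{x. v x \<noteq> 0}"] by auto
qed

lemma test_mult:
  assumes "smooth f" "v \<in> test_functions"
  shows "(\<lambda>x. f x * v x) \<in> test_functions"
proof -
  obtain K where "compact K" "K \<subseteq> ball 0 1" "\<And>x. x \<notin> K \<Longrightarrow> v x = 0"
    using test_support[OF assms(2)] by blast
  moreover have "smooth (\<lambda>x. f x * v x)" using assms by (auto intro: smooth_mult dest: test_smooth)
  ultimately show ?thesis by (intro test_functionsI[of _ K]) auto
qed

lemma test_add:
  assumes "u \<in> test_functions" "v \<in> test_functions"
  shows "(\<lambda>x. u x + v x) \<in> test_functions"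
proof -
  obtain K where K: "compact K" "K \<subseteq> ball 0 1" "\<And>x. x \<notin> K \<Longrightarrow> u x = 0"
    using test_support[OF assms(1)] by blast
  obtain L where L: "compact L" "L \<subseteq> ball 0 1" "\<And>x. x \<notin> L \<Longrightarrow> v x = 0"
    using test_support[OF assms(2)] by blast
  have "smooth (\<lambda>x. u x + v x)" using assms by (auto intro: smooth_add dest: test_smooth)
  then show ?thesis using K L
    by (intro test_functionsI[of _ "K \<union> L"] compact_Un) auto
qed

lemma test_partial:
  assumes "v \<in> test_functions"
  shows "partial_deriv i v \<in> test_functions"
proof -
  obtain K where K: "compact K" "K \<subseteq> ball 0 1" "\<And>x. x \<notin> K \<Longrightarrow> v x = 0"
    using test_support[OF assms] by blast
  have "partial_deriv i v x = 0" if "x \<notin> K" for x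
    using partial_deriv_cong[of "- K" x v "\<lambda>_. 0" i] that K by (simp add: compact_imp_closed open_Compl)
  then show ?thesis using K assms by (intro test_functionsI[of _ K]) (auto intro: smooth_partial test_smooth)
qed

lemma test_cmult: "v \<in> test_functions \<Longrightarrow> (\<lambda>x. c * v x) \<in> test_functions"
  by (rule test_mult[OF smooth_const])

lemma test_diff: "u \<in> test_functions \<Longrightarrow> v \<in> test_functions \<Longrightarrow> (\<lambda>x. u x - v x) \<in> test_functions"
  using test_add[OF _ test_cmult[of _ "-1"], of u v] by simp

lemma test_zero: "(\<lambda>x. 0) \<in> test_functions"
  by (rule test_functionsI[of _ "{}"]) (auto intro: smooth_const)

lemma test_sum: "(\<And>i. i \<in> A \<Longrightarrow> f i \<in> test_functions) \<Longrightarrow> (\<lambda>x. \<Sum>i\<in>A. f i x) \<in> test_functions"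
  by (induction A rule: infinite_finite_induct) (auto intro: test_zero test_add)

lemma test_mult2: "u \<in> test_functions \<Longrightarrow> v \<in> test_functions \<Longrightarrow> (\<lambda>x. u x * v x) \<in> test_functions"
  by (intro test_mult test_smooth)

lemma test_bounded:
  assumes "v \<in> test_functions"
  obtains B where "B > 0" "\<And>x. \<bar>v x\<bar> \<le> B"
proof -
  obtain B where B: "B > 0" "\<And>x. x \<in> cball 0 1 \<Longrightarrow> norm (v x) \<le> B"
    using compact_imp_bounded[OF compact_continuous_image[OF smooth_continuous[OF test_smooth[OF assms]] compact_cball]]
    unfolding bounded_pos by (metis imageI)
  have "\<bar>v x\<bar> \<le> B" for x
    using B test_outside[OF assms, of x] by (cases "x \<in> ball 0 1") auto
  then show thesis using that B(1) by blast
qed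

lemma test_integrable_lborel:
  assumes "v \<in> test_functions" shows "integrable lborel v"
proof -
  have "integrable lborel (\<lambda>x. indicator (cball 0 1) x *\<^sub>R v x)"
    by (intro borel_integrable_compact smooth_continuous test_smooth assms) simp
  moreover have "(\<lambda>x. indicator (cball 0 1) x *\<^sub>R v x) = v"
    using test_outside[OF assms] by (auto simp: indicator_def fun_eq_iff)
  ultimately show ?thesis by simp
qed

lemma test_measurable: "v \<in> test_functions \<Longrightarrow> v \<in> borel_measurable borel"
  by (intro borel_measurable_continuous_onI smooth_continuous test_smooth)

text \<open>Translation invariance gives every difference quotient integral zero, and dominated
  convergence passes to the derivative. Every later integration by parts reduces to this.\<close>

lemma integral_partial_deriv:
  fixes v :: "real^'n::finite \<Rightarrow> real"
  assumes "v \<in> test_functions"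
  shows "(\<integral>x. partial_deriv i v x \<partial>lborel) = 0"
proof -
  define e where "e n = inverse (real (Suc n))" for n
  have e: "0 < e n" "e n \<le> 1" for n by (auto simp: e_def inverse_le_1_iff)
  let ?D = "\<lambda>n x. (v (e n *\<^sub>R axis i 1 + x) - v x) / e n"
  obtain B where B: "B > 0" "\<And>x. \<bar>partial_deriv i v x\<bar> \<le> B"
    using test_bounded[OF test_partial[OF assms]] by blast
  have [measurable]: "v \<in> borel_measurable borel" by (rule test_measurable[OF assms])
  have int: "integrable lborel (\<lambda>x. v (c + x))" "(\<integral>x. v (c + x) \<partial>lborel) = (\<integral>x. v x \<partial>lborel)" for c
    using test_integrable_lborel[OF assms]
      integrable_distr_eq[of "(+) c" lborel borel v] integral_distr[of "(+) c" lborel borel v]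
    by (auto simp: lborel_distr_plus)
  have D0: "(\<integral>x. ?D n x \<partial>lborel) = 0" for n
    using int test_integrable_lborel[OF assms] by simp
  \<comment> \<open>The steps \<open>e n\<close> are at most 1 and \<open>v\<close> lives in the
    unit ball, so radius 2 contains the support of every difference quotient; inside, the mean value
    theorem gives the bound.\<close>
  have bound: "\<bar>?D n x\<bar> \<le> B * indicator (cball 0 2) x" for n x
  proof (cases "x \<in> cball 0 2")
    case True
    have "((\<lambda>s. v (x + s *\<^sub>R axis i 1)) has_real_derivative partial_deriv i v (x + s *\<^sub>R axis i 1)) (at s)" for s
      by (intro deriv_along_axis smooth_differentiable test_smooth assms)
    then obtain s where "v (x + e n *\<^sub>R axis i 1) - v (x + 0 *\<^sub>R axis i 1) = (e n - 0) * partial_deriv i v (x + s *\<^sub>R axis i 1)"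
      using MVT2[of 0 "e n" "\<lambda>s. v (x + s *\<^sub>R axis i 1)" "\<lambda>s. partial_deriv i v (x + s *\<^sub>R axis i 1)"] e by blast
    then have "?D n x = partial_deriv i v (x + s *\<^sub>R axis i 1)"
      using e(1)[of n] by (simp add: field_simps)
    then show ?thesis using B True by simp
  next
    case False
    then have x: "norm x > 2" by (simp add: not_le)
    have "norm (e n *\<^sub>R axis i (1::real)) \<le> 1" using e[of n] by simp
    then have "norm (e n *\<^sub>R axis i 1 + x) > 1"
      using norm_triangle_ineq2[of x "- (e n *\<^sub>R axis i 1)"] x by (simp add: add.commute)
    then show ?thesis using test_outside[OF assms] x by simp
  qed
  have lim: "(\<lambda>n. ?D n x) \<longlonglongrightarrow> partial_deriv i v x" for x
  proof -
    have "((\<lambda>s. v (x + s *\<^sub>R axis i 1)) has_real_derivative partial_deriv i v (x + 0 *\<^sub>R axis i 1)) (at 0)"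
      by (intro deriv_along_axis smooth_differentiable test_smooth assms)
    then have "((\<lambda>h. (v (x + h *\<^sub>R axis i 1) - v x) / h) \<longlongrightarrow> partial_deriv i v x) (at 0)"
      by (simp add: DERIV_def)
    moreover have "filterlim e (at 0) sequentially"
      unfolding filterlim_at using LIMSEQ_inverse_real_of_nat e(1)
      by (auto simp: e_def[abs_def] less_imp_neq)
    ultimately show ?thesis using filterlim_compose by (fastforce simp: add.commute)
  qed
  have "(\<lambda>n. \<integral>x. ?D n x \<partial>lborel) \<longlonglongrightarrow> (\<integral>x. partial_deriv i v x \<partial>lborel)"
  proof (rule integral_dominated_convergence)
    show "partial_deriv i v \<in> borel_measurable lborel"
      using test_measurable[OF test_partial[OF assms]] by simp
    show "integrable lborel (\<lambda>x. B * indicator (cball 0 2) x :: real)"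
      by (intro integrable_mult_right integrable_real_indicator) (auto intro: emeasure_bounded_finite[unfolded infinity_ennreal_def])
    show "AE x in lborel. norm (?D n x) \<le> B * indicator (cball 0 2) x" for n using bound by simp
  qed (use lim in auto)
  then show ?thesis unfolding D0 by (simp add: LIMSEQ_const_iff)
qed

section \<open>The hyperbolic Laplacian in the ball model\<close>

text \<open>The reciprocal of \<open>conf\<close>. Unlike \<open>conf\<close> it is a polynomial,
  smooth on the whole space, so operators with coefficients written in \<open>rho\<close> preserve
  test functions without a separate look at the boundary.\<close>

definition rho :: "real^'n::finite \<Rightarrow> real" where
  "rho x = (1 - (norm x)\<^sup>2) / 2"

lemma rho_pos: "x \<in> ball 0 1 \<Longrightarrow> rho x > 0"
  by (simp add: rho_def power_less_one_iff abs_square_less_1)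

lemma conf_rho: "conf x = inverse (rho x)"
  by (simp add: conf_def rho_def field_simps)

lemma conf_pos: "x \<in> ball 0 1 \<Longrightarrow> conf x > 0"
  by (simp add: conf_rho rho_pos)

lemma smooth_rho: "smooth rho"
  unfolding rho_def[abs_def] divide_inverse by (intro smooth_intros)

lemma partial_deriv_rho: "partial_deriv i rho x = - x $ i"
proof -
  have "((\<lambda>t::real. (1 - t) / 2) has_real_derivative - 1/2) (at ((norm x)\<^sup>2))"
    by (auto intro!: derivative_eq_intros)
  from partial_deriv_chain[OF this smooth_differentiable[OF smooth_norm_sq]]
  show ?thesis by (simp add: rho_def[abs_def] partial_deriv_norm_sq)
qed

lemma has_derivative_conf_power:
  assumes "x \<in> ball 0 1"
  shows "(\<lambda>x. conf x ^ a) differentiable at x"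
    "partial_deriv i (\<lambda>x. conf x ^ a) x = real a * x $ i * conf x ^ Suc a"
proof -
  have r: "rho x \<noteq> 0" using rho_pos[OF assms] by simp
  let ?\<phi> = "\<lambda>t::real. inverse t ^ a"
  have d: "(?\<phi> has_real_derivative - (real a * inverse (rho x) ^ Suc a)) (at (rho x))"
  proof (cases a)
    case (Suc n)
    show ?thesis unfolding Suc
      using DERIV_power_Suc[OF DERIV_inverse[OF r], of n] by (simp add: algebra_simps)
  qed simp
  have s: "rho differentiable at x" by (intro smooth_differentiable smooth_rho)
  then obtain r' where "(rho has_derivative r') (at x)" unfolding differentiable_def by blast
  from has_derivative_compose[OF this d[unfolded has_field_derivative_def]]
  show "(\<lambda>x. conf x ^ a) differentiable at x"
    unfolding conf_rho differentiable_def by blast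
  show "partial_deriv i (\<lambda>x. conf x ^ a) x = real a * x $ i * conf x ^ Suc a"
    unfolding conf_rho by (subst partial_deriv_chain[OF d s]) (simp add: partial_deriv_rho)
qed

text \<open>The factor \<open>conf\<close> is singular on the unit sphere, but \<open>v\<close>
  vanishes near it: inside the ball the product rule applies, and off the support the product is
  locally zero. The derivative consists of terms of the same shape with exponents \<open>a\<close>
  and \<open>Suc a\<close>, which drives the induction in \<open>test_conf\<close>.\<close>

lemma conf_test:
  fixes v :: "real^'n::finite \<Rightarrow> real"
  assumes v: "v \<in> test_functions"
  shows "(\<lambda>x. conf x ^ a * v x) differentiable at x"
    "partial_deriv i (\<lambda>x. conf x ^ a * v x) x =
      conf x ^ a * partial_deriv i v x + real a * x $ i * (conf x ^ Suc a * v x)"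
proof -
  obtain K where K: "compact K" "K \<subseteq> ball 0 1" "\<And>x. x \<notin> K \<Longrightarrow> v x = 0"
    using test_support[OF v] by blast
  have "(\<lambda>x. conf x ^ a * v x) differentiable at x \<and>
    partial_deriv i (\<lambda>x. conf x ^ a * v x) x =
      conf x ^ a * partial_deriv i v x + real a * x $ i * (conf x ^ Suc a * v x)"
  proof (cases "x \<in> ball 0 1")
    case True
    have "v differentiable at x" by (intro smooth_differentiable test_smooth v)
    with has_derivative_conf_power[OF True] show ?thesis
      by (simp add: partial_deriv_mult algebra_simps)
  next
    case False
    then have x: "x \<in> - K" "open (- K)" using K by (auto simp: compact_imp_closed)
    have z: "conf y ^ a * v y = 0" if "y \<in> - K" for y using K that by simp
    have "((\<lambda>x. conf x ^ a * v x) has_derivative (\<lambda>h. 0)) (at x)"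
      by (rule has_derivative_transform_within_open[OF has_derivative_const[of 0] x(2,1)]) (use z in auto)
    moreover have "partial_deriv i v x = 0"
      using test_outside[OF test_partial[OF v] False] .
    ultimately show ?thesis using K x by (auto simp: partial_deriv_eq differentiable_def)
  qed
  then show "(\<lambda>x. conf x ^ a * v x) differentiable at x"
    "partial_deriv i (\<lambda>x. conf x ^ a * v x) x =
      conf x ^ a * partial_deriv i v x + real a * x $ i * (conf x ^ Suc a * v x)" by auto
qed

lemma test_conf:
  fixes v :: "real^'n::finite \<Rightarrow> real"
  assumes "v \<in> test_functions"
  shows "(\<lambda>x. conf x ^ a * v x) \<in> test_functions"
proof -
  have "Ck m (\<lambda>x. conf x ^ a * v x)" if "v \<in> test_functions" for m a and v :: "real^'n \<Rightarrow> real"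
    using that
  proof (induction m arbitrary: a v)
    case 0
    then show ?case using conf_test(1)
      by (auto simp: continuous_on_eq_continuous_within intro: differentiable_imp_continuous_within)
  next
    case (Suc m)
    have "partial_deriv i (\<lambda>x. conf x ^ a * v x) = (\<lambda>x.
      conf x ^ a * partial_deriv i v x + real a * x $ i * (conf x ^ Suc a * v x))" for i
      using conf_test(2)[OF Suc.prems] by blast
    moreover have "Ck m (\<lambda>x. conf x ^ a * partial_deriv i v x + real a * x $ i * (conf x ^ Suc a * v x))" for i
      by (rule Ck_add[OF Suc.IH[OF test_partial[OF Suc.prems]]
            Ck_mult[OF Ck_mult[OF Ck_const Ck_nth] Suc.IH[OF Suc.prems]]])
    ultimately show ?case
      using conf_test(1)[OF Suc.prems] by (simp only: Ck.simps) auto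
  qed
  then have "smooth (\<lambda>x. conf x ^ a * v x)" using assms by (simp add: smooth_def)
  moreover obtain K where "compact K" "K \<subseteq> ball 0 1" "\<And>x. x \<notin> K \<Longrightarrow> v x = 0"
    using test_support[OF assms] by blast
  ultimately show ?thesis by (intro test_functionsI[of _ K]) auto
qed

section \<open>Integration against the hyperbolic volume\<close>

lemma conf_power_measurable [measurable]: "(\<lambda>x. conf x ^ a) \<in> borel_measurable borel"
  unfolding conf_def[abs_def] by measurable

lemma space_hyp_vol [simp]: "space hyp_vol = ball 0 1"
  by (simp add: hyp_vol_def)

lemma sets_hyp_vol: "sets hyp_vol = sets (lebesgue_on (ball 0 1))"
  by (simp add: hyp_vol_def)

lemma measurable_hyp_vol: "borel_measurable hyp_vol = borel_measurable (lebesgue_on (ball 0 1))"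
  by (rule measurable_cong_sets) (auto simp: sets_hyp_vol)

lemma borel_hyp_vol: "f \<in> borel_measurable borel \<Longrightarrow> f \<in> borel_measurable hyp_vol"
  unfolding measurable_hyp_vol by (intro measurable_restrict_space1 measurable_completion) simp

lemma hyp_vol_integral:
  fixes g :: "real^'n::finite \<Rightarrow> real"
  assumes "g \<in> borel_measurable hyp_vol"
  shows "integrable hyp_vol g \<longleftrightarrow> integrable lebesgue (\<lambda>x. indicator (ball 0 1) x * (conf x ^ CARD('n) * g x))"
    "(\<integral>x. g x \<partial>hyp_vol) = (\<integral>x. indicator (ball 0 1) x * (conf x ^ CARD('n) * g x) \<partial>lebesgue)"
proof -
  have g: "g \<in> borel_measurable (lebesgue_on (ball 0 1))" using assms by (simp add: measurable_hyp_vol)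
  have c: "(\<lambda>x. conf x ^ CARD('n)) \<in> borel_measurable (lebesgue_on (ball 0 1))"
    by (rule borel_hyp_vol[unfolded measurable_hyp_vol]) measurable
  have pos: "AE x in lebesgue_on (ball 0 1). 0 \<le> conf x ^ CARD('n)"
    by (rule AE_I2) (simp add: conf_pos less_imp_le)
  show "integrable hyp_vol g \<longleftrightarrow> integrable lebesgue (\<lambda>x. indicator (ball 0 1) x * (conf x ^ CARD('n) * g x))"
    unfolding hyp_vol_def using integrable_density[OF g c pos]
    by (simp add: integrable_restrict_space)
  show "(\<integral>x. g x \<partial>hyp_vol) = (\<integral>x. indicator (ball 0 1) x * (conf x ^ CARD('n) * g x) \<partial>lebesgue)"
    unfolding hyp_vol_def using integral_density[OF g c pos]
    by (simp add: integral_restrict_space)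
qed

lemma test_measurable_hyp: "v \<in> test_functions \<Longrightarrow> v \<in> borel_measurable hyp_vol"
  by (intro borel_hyp_vol test_measurable)

lemma test_hyp:
  fixes v :: "real^'n::finite \<Rightarrow> real"
  assumes v: "v \<in> test_functions"
  shows test_integrable: "integrable hyp_vol v"
    and test_integral: "(\<integral>x. v x \<partial>hyp_vol) = (\<integral>x. conf x ^ CARD('n) * v x \<partial>lborel)"
proof -
  let ?w = "\<lambda>x. conf x ^ CARD('n) * v x"
  have w: "?w \<in> test_functions" by (rule test_conf[OF v])
  have eq: "(\<lambda>x. indicator (ball 0 1) x * ?w x) = ?w"
    using test_outside[OF v] by (auto simp: indicator_def fun_eq_iff)
  have m: "?w \<in> borel_measurable lborel" using test_measurable[OF w] by simp
  show "integrable hyp_vol v"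
    unfolding hyp_vol_integral(1)[OF test_measurable_hyp[OF v]] eq
    using integrable_completion[OF m] test_integrable_lborel[OF w] by blast
  show "(\<integral>x. v x \<partial>hyp_vol) = (\<integral>x. conf x ^ CARD('n) * v x \<partial>lborel)"
    unfolding hyp_vol_integral(2)[OF test_measurable_hyp[OF v]] eq
    using integral_completion[OF m] by blast
qed

section \<open>Explicit form and symmetry of the Laplace-Beltrami operator\<close>

definition lap :: "(real^'n::finite \<Rightarrow> real) \<Rightarrow> real^'n \<Rightarrow> real" where
  "lap f x = (\<Sum>i\<in>UNIV. partial_deriv i (partial_deriv i f) x)"

text \<open>The radial field, generator of dilations. Its commutator with \<open>lap\<close> is the
  source of the conformal covariance.\<close>

definition euler :: "(real^'n::finite \<Rightarrow> real) \<Rightarrow> real^'n \<Rightarrow> real" where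
  "euler f x = (\<Sum>i\<in>UNIV. x $ i * partial_deriv i f x)"

lemma smooth_lap: "smooth f \<Longrightarrow> smooth (lap f)"
  unfolding lap_def[abs_def] by (intro smooth_intros)

lemma smooth_euler: "smooth f \<Longrightarrow> smooth (euler f)"
  unfolding euler_def[abs_def] by (intro smooth_intros)

lemma test_lap: "f \<in> test_functions \<Longrightarrow> lap f \<in> test_functions"
  unfolding lap_def[abs_def] by (intro test_sum test_partial)

lemma test_euler: "f \<in> test_functions \<Longrightarrow> euler f \<in> test_functions"
  unfolding euler_def[abs_def] by (intro test_sum test_mult smooth_nth test_partial)

text \<open>The gradient contributes two factors \<open>rho\<close>, which cancel two factors
  \<open>conf\<close>; \<open>CARD('n) \<ge> 2\<close> keeps the subtraction in the exponent
  genuine. Outside the ball both sides vanish with \<open>v\<close>, so the identity holds between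
  functions on the whole space and may be used under \<open>partial_deriv\<close>.\<close>

lemma hyp_flux_eq:
  fixes v :: "real^'n::finite \<Rightarrow> real"
  assumes v: "v \<in> test_functions" and N: "CARD('n) \<ge> 2"
  shows "conf y ^ CARD('n) * hyp_grad v y $ i = conf y ^ (CARD('n) - 2) * partial_deriv i v y"
proof (cases "y \<in> ball 0 1")
  case True
  obtain M where M: "CARD('n) = Suc (Suc M)" using N by (metis Suc_le_D numeral_2_eq_2 Suc_le_mono)
  have "hyp_grad v y $ i = (rho y)\<^sup>2 * partial_deriv i v y" by (simp add: hyp_grad_def rho_def)
  then show ?thesis using rho_pos[OF True] unfolding M
    by (simp add: conf_rho field_simps power2_eq_square)
next
  case False
  then show ?thesis using test_outside[OF test_partial[OF v]] by (simp add: hyp_grad_def)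
qed

lemma laplace_beltrami_div:
  fixes v :: "real^'n::finite \<Rightarrow> real"
  assumes v: "v \<in> test_functions" and N: "CARD('n) \<ge> 2"
  shows "laplace_beltrami v x = (\<Sum>i\<in>UNIV. partial_deriv i (\<lambda>y. conf y ^ (CARD('n) - 2) * partial_deriv i v y) x)
      / conf x ^ CARD('n)"
  unfolding laplace_beltrami_def hyp_div_def hyp_flux_eq[OF assms] ..

text \<open>Differentiating the weight in the divergence form yields the first-order term. Both
  coefficients on the right are polynomials, so test functions are mapped to test functions and
  Euclidean calculus applies.\<close>

lemma laplace_beltrami_eq:
  fixes v :: "real^'n::finite \<Rightarrow> real"
  assumes v: "v \<in> test_functions" and N: "CARD('n) \<ge> 2"
  shows "laplace_beltrami v = (\<lambda>x. (rho x)\<^sup>2 * lap v x + (real CARD('n) - 2) * (rho x * euler v x))"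
proof
  fix x
  have eq: "laplace_beltrami v x = (conf x ^ (CARD('n) - 2) * lap v x
      + (real CARD('n) - 2) * (conf x ^ (CARD('n) - 1) * euler v x)) / conf x ^ CARD('n)"
    unfolding laplace_beltrami_div[OF assms] conf_test(2)[OF test_partial[OF v]] lap_def euler_def
    using N by (simp add: sum.distrib sum_distrib_left sum_distrib_right of_nat_diff Suc_diff_Suc numeral_2_eq_2 mult_ac)
  show "laplace_beltrami v x = (rho x)\<^sup>2 * lap v x + (real CARD('n) - 2) * (rho x * euler v x)"
  proof (cases "x \<in> ball 0 1")
    case True
    have r: "rho x > 0" by (rule rho_pos[OF True])
    obtain M where M: "CARD('n) = Suc (Suc M)" using N by (metis Suc_le_D numeral_2_eq_2 Suc_le_mono)
    show ?thesis unfolding eq using r unfolding M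
      by (simp add: conf_rho field_simps power2_eq_square)
  next
    case False
    then show ?thesis unfolding eq
      using test_outside[OF test_lap[OF v]] test_outside[OF test_euler[OF v]] by simp
  qed
qed

lemma test_laplace_beltrami:
  fixes v :: "real^'n::finite \<Rightarrow> real"
  assumes "v \<in> test_functions" "CARD('n) \<ge> 2"
  shows "laplace_beltrami v \<in> test_functions"
  unfolding laplace_beltrami_eq[OF assms]
  by (intro test_add test_mult smooth_intros smooth_rho test_lap test_euler assms)

text \<open>Green's formula: the volume density cancels the denominator in
  \<open>laplace_beltrami_div\<close>, and the product rule moves one derivative from the flux to
  \<open>u\<close> up to an exact derivative. The result is visibly symmetric.\<close>

lemma integral_laplace_beltrami:
  fixes u v :: "real^'n::finite \<Rightarrow> real"
  assumes u: "u \<in> test_functions" and v: "v \<in> test_functions" and N: "CARD('n) \<ge> 2"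
  shows "(\<integral>x. u x * laplace_beltrami v x \<partial>hyp_vol) =
    - (\<integral>x. conf x ^ (CARD('n) - 2) * (\<Sum>i\<in>UNIV. partial_deriv i u x * partial_deriv i v x) \<partial>lborel)"
proof -
  let ?c = "\<lambda>x. conf x ^ (CARD('n) - 2)"
  let ?F = "\<lambda>i x. ?c x * partial_deriv i v x"
  have F: "?F i \<in> test_functions" for i by (intro test_conf test_partial v)
  have "(\<integral>x. u x * laplace_beltrami v x \<partial>hyp_vol) = (\<integral>x. conf x ^ CARD('n) * (u x * laplace_beltrami v x) \<partial>lborel)"
    by (intro test_integral test_mult2 test_laplace_beltrami u v N)
  also have "\<dots> = (\<integral>x. (\<Sum>i\<in>UNIV. u x * partial_deriv i (?F i) x) \<partial>lborel)"
  proof (rule Bochner_Integration.integral_cong[OF refl])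
    fix x :: "real^'n"
    show "conf x ^ CARD('n) * (u x * laplace_beltrami v x) = (\<Sum>i\<in>UNIV. u x * partial_deriv i (?F i) x)"
    proof (cases "x \<in> ball 0 1")
      case True
      then show ?thesis using conf_pos[OF True]
        by (simp add: laplace_beltrami_div[OF v N] sum_distrib_left sum_divide_distrib)
    next
      case False
      then show ?thesis using test_outside[OF u] by simp
    qed
  qed
  also have "\<dots> = (\<integral>x. (\<Sum>i\<in>UNIV. partial_deriv i (\<lambda>x. u x * ?F i x) x - partial_deriv i u x * ?F i x) \<partial>lborel)"
    by (simp add: partial_deriv_mult smooth_differentiable test_smooth[OF u] test_smooth[OF F])
  also have "\<dots> = (\<Sum>i\<in>UNIV. (\<integral>x. partial_deriv i (\<lambda>x. u x * ?F i x) x \<partial>lborel) - (\<integral>x. partial_deriv i u x * ?F i x \<partial>lborel))"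
    by (subst Bochner_Integration.integral_sum)
       (auto intro!: Bochner_Integration.integrable_diff Bochner_Integration.integral_diff sum.cong
          test_integrable_lborel test_partial test_diff test_mult2 F u)
  also have "\<dots> = - (\<Sum>i\<in>UNIV. (\<integral>x. partial_deriv i u x * ?F i x \<partial>lborel))"
    by (simp add: integral_partial_deriv test_mult2[OF u F] sum_negf)
  also have "(\<Sum>i\<in>UNIV. (\<integral>x. partial_deriv i u x * ?F i x \<partial>lborel)) = (\<integral>x. (\<Sum>i\<in>UNIV. partial_deriv i u x * ?F i x) \<partial>lborel)"
    by (subst Bochner_Integration.integral_sum)
       (auto intro!: test_integrable_lborel test_partial test_mult2 F u)
  finally show ?thesis by (simp add: sum_distrib_left mult_ac)
qed

lemma laplace_beltrami_symmetric:
  fixes u v :: "real^'n::finite \<Rightarrow> real"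
  assumes "u \<in> test_functions" "v \<in> test_functions" "CARD('n) \<ge> 2"
  shows "(\<integral>x. u x * laplace_beltrami v x \<partial>hyp_vol) = (\<integral>x. v x * laplace_beltrami u x \<partial>hyp_vol)"
  using assms by (simp add: integral_laplace_beltrami mult.commute)

lemma hyp_length_grad:
  assumes "x \<in> ball 0 1"
  shows "(hyp_length x (hyp_grad u x))\<^sup>2 = (rho x)\<^sup>2 * (\<Sum>i\<in>UNIV. partial_deriv i u x * partial_deriv i u x)"
proof -
  have "(norm (\<chi> i. partial_deriv i u x))\<^sup>2 = (\<Sum>i\<in>UNIV. partial_deriv i u x * partial_deriv i u x)"
    by (simp add: norm_sq_sum)
  then show ?thesis using rho_pos[OF assms]
    by (simp add: hyp_length_def hyp_grad_def conf_rho power_mult_distrib field_simps flip: rho_def)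
qed

lemma integral_grad_sq:
  fixes v :: "real^'n::finite \<Rightarrow> real"
  assumes v: "v \<in> test_functions" and N: "CARD('n) \<ge> 2"
  shows "(\<integral>x. (hyp_length x (hyp_grad v x))\<^sup>2 \<partial>hyp_vol) = - (\<integral>x. v x * laplace_beltrami v x \<partial>hyp_vol)"
proof -
  let ?s = "\<lambda>x. (\<Sum>i\<in>UNIV. partial_deriv i v x * partial_deriv i v x)"
  have s: "?s \<in> test_functions" by (intro test_sum test_mult2 test_partial v)
  have "(\<integral>x. (hyp_length x (hyp_grad v x))\<^sup>2 \<partial>hyp_vol) = (\<integral>x. (rho x)\<^sup>2 * ?s x \<partial>hyp_vol)"
    by (intro Bochner_Integration.integral_cong hyp_length_grad) auto
  also have "\<dots> = (\<integral>x. conf x ^ CARD('n) * ((rho x)\<^sup>2 * ?s x) \<partial>lborel)"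
    by (intro test_integral test_mult s smooth_intros smooth_rho)
  also have "\<dots> = (\<integral>x. conf x ^ (CARD('n) - 2) * ?s x \<partial>lborel)"
  proof (rule Bochner_Integration.integral_cong[OF refl])
    fix x :: "real^'n"
    obtain M where M: "CARD('n) = Suc (Suc M)" using N by (metis Suc_le_D numeral_2_eq_2 Suc_le_mono)
    show "conf x ^ CARD('n) * ((rho x)\<^sup>2 * ?s x) = conf x ^ (CARD('n) - 2) * ?s x"
      using rho_pos[of x] test_outside[OF s, of x] unfolding M
      by (cases "x \<in> ball 0 1") (auto simp: conf_rho field_simps power2_eq_square)
  qed
  finally show ?thesis by (simp add: integral_laplace_beltrami[OF v v N])
qed

section \<open>Spectral gap and coercivity\<close>

lemma lap_lincomb:
  fixes f g :: "real^'n::finite \<Rightarrow> real"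
  assumes "smooth f" "smooth g"
  shows "lap (\<lambda>x. a * f x + b * g x) = (\<lambda>x. a * lap f x + b * lap g x)"
proof -
  have "partial_deriv i (\<lambda>x. a * f x + b * g x) = (\<lambda>x. a * partial_deriv i f x + b * partial_deriv i g x)"
    if "smooth f" "smooth g" for i and f g :: "real^'n \<Rightarrow> real"
    using that by (auto simp: partial_deriv_add partial_deriv_mult smooth_differentiable differentiable_mult)
  then show ?thesis using assms
    by (intro ext) (simp add: lap_def smooth_partial sum.distrib sum_distrib_left)
qed

lemma euler_lincomb:
  assumes "smooth f" "smooth g"
  shows "euler (\<lambda>x. a * f x + b * g x) = (\<lambda>x. a * euler f x + b * euler g x)"
  using assms
  by (auto simp: euler_def partial_deriv_add partial_deriv_mult smooth_differentiable differentiable_mult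
      sum.distrib sum_distrib_left algebra_simps)

lemma laplace_beltrami_lincomb:
  fixes u v :: "real^'n::finite \<Rightarrow> real"
  assumes u: "u \<in> test_functions" and v: "v \<in> test_functions" and N: "CARD('n) \<ge> 2"
  shows "laplace_beltrami (\<lambda>x. a * u x + b * v x) = (\<lambda>x. a * laplace_beltrami u x + b * laplace_beltrami v x)"
proof -
  have "(\<lambda>x. a * u x + b * v x) \<in> test_functions" by (intro test_add test_cmult u v)
  then show ?thesis using u v N
    by (auto simp: laplace_beltrami_eq lap_lincomb euler_lincomb test_smooth algebra_simps)
qed

text \<open>Ground state substitution: \<open>rho\<^sup>c\<close> with \<open>c = (N - 1) / 2\<close> is a positive supersolution, and its
  logarithmic gradient \<open>- c x\<close> is what completes the square.\<close>

lemma spectral_gap: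
  fixes v :: "real^'n::finite \<Rightarrow> real"
  assumes v: "v \<in> test_functions" and N: "CARD('n) \<ge> 2"
  shows "((real CARD('n) - 1) / 2)\<^sup>2 * (\<integral>x. (v x)\<^sup>2 \<partial>hyp_vol) \<le> - (\<integral>x. v x * laplace_beltrami v x \<partial>hyp_vol)"
proof -
  obtain M where M: "CARD('n) = Suc (Suc M)" using N by (metis Suc_le_D numeral_2_eq_2 Suc_le_mono)
  define c where "c = (real CARD('n) - 1) / 2"
  let ?S = "\<lambda>x. \<Sum>i\<in>UNIV. partial_deriv i v x * partial_deriv i v x"
  let ?G = "\<lambda>i x. conf x ^ Suc M * (x $ i * (v x)\<^sup>2)"
  have vv: "(\<lambda>x. (v x)\<^sup>2) \<in> test_functions" unfolding power2_eq_square by (intro test_mult2 v)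
  have S: "?S \<in> test_functions" by (intro test_sum test_mult2 test_partial v)
  have G: "?G i \<in> test_functions" for i by (intro test_conf test_mult smooth_nth vv)
  \<comment> \<open>The divergence of \<open>?G\<close> integrates to zero, so it may be added
    freely. With it the integrand becomes a power of \<open>conf\<close> times a sum of squares plus
    the nonnegative surplus \<open>c * rho x * (v x)\<^sup>2\<close>; the relation
    \<open>real M = 2 * c - 1\<close> makes the coefficients match.\<close>
  have pos: "0 \<le> conf x ^ M * ?S x + c * (\<Sum>i\<in>UNIV. partial_deriv i (?G i) x) - c\<^sup>2 * (conf x ^ CARD('n) * (v x)\<^sup>2)" for x
  proof (cases "x \<in> ball 0 1")
    case False
    then show ?thesis
      using test_outside[OF test_partial[OF G]] test_outside[OF vv] test_outside[OF S] by simp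
  next
    case True
    have r: "rho x > 0" by (rule rho_pos[OF True])
    define E where "E = (\<Sum>i\<in>UNIV. x $ i * partial_deriv i v x)"
    have R: "(\<Sum>i\<in>UNIV. x $ i * x $ i) = 1 - 2 * rho x"
      unfolding norm_sq_sum[symmetric] by (simp add: rho_def field_simps)
    have "partial_deriv i (\<lambda>x. x $ i * (v x)\<^sup>2) x = (v x)\<^sup>2 + 2 * v x * (x $ i * partial_deriv i v x)" for i
      by (subst partial_deriv_mult[OF smooth_differentiable[OF smooth_nth] smooth_differentiable[OF test_smooth[OF vv]]],
          subst partial_deriv_power[OF smooth_differentiable[OF test_smooth[OF v]]]) (simp add: partial_deriv_nth)
    then have "(\<Sum>i\<in>UNIV. partial_deriv i (?G i) x) =
       (\<Sum>i\<in>UNIV. conf x ^ Suc M * ((v x)\<^sup>2 + 2 * v x * (x $ i * partial_deriv i v x))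
          + real (Suc M) * (v x)\<^sup>2 * conf x ^ Suc (Suc M) * (x $ i * x $ i))"
      by (intro sum.cong refl, subst conf_test(2)[OF test_mult[OF smooth_nth vv]]) (simp only: mult_ac)
    also have "\<dots> = conf x ^ Suc M * (real CARD('n) * (v x)\<^sup>2 + 2 * v x * E)
          + real (Suc M) * (v x)\<^sup>2 * conf x ^ Suc (Suc M) * (1 - 2 * rho x)"
      by (simp add: sum.distrib R E_def flip: sum_distrib_left)
    finally have D: "(\<Sum>i\<in>UNIV. partial_deriv i (?G i) x) = \<dots>" .
    have sq: "(\<Sum>i\<in>UNIV. (rho x * partial_deriv i v x + c * v x * x $ i)\<^sup>2)
        = (rho x)\<^sup>2 * ?S x + 2 * c * rho x * v x * E + c\<^sup>2 * (v x)\<^sup>2 * (1 - 2 * rho x)"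
      unfolding R[symmetric] E_def
      by (simp add: power2_eq_square algebra_simps sum.distrib sum_distrib_left)
    have cM: "real M = 2 * c - 1" by (simp add: c_def M field_simps)
    have "conf x ^ M * ?S x + c * (\<Sum>i\<in>UNIV. partial_deriv i (?G i) x) - c\<^sup>2 * (conf x ^ CARD('n) * (v x)\<^sup>2)
      = conf x ^ Suc (Suc M) * ((\<Sum>i\<in>UNIV. (rho x * partial_deriv i v x + c * v x * x $ i)\<^sup>2) + c * rho x * (v x)\<^sup>2)"
      unfolding sq D M unfolding conf_rho power_Suc using r
      by (simp add: cM field_simps power2_eq_square)
    moreover have "c \<ge> 0" using N by (simp add: c_def)
    then have "0 \<le> (\<Sum>i\<in>UNIV. (rho x * partial_deriv i v x + c * v x * x $ i)\<^sup>2) + c * rho x * (v x)\<^sup>2"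
      using r by (simp add: sum_nonneg)
    then have "0 \<le> conf x ^ Suc (Suc M) * ((\<Sum>i\<in>UNIV. (rho x * partial_deriv i v x + c * v x * x $ i)\<^sup>2) + c * rho x * (v x)\<^sup>2)"
      using conf_pos[OF True] by (intro mult_nonneg_nonneg) (auto intro: less_imp_le)
    ultimately show ?thesis by linarith
  qed
  have cS: "integrable lborel (\<lambda>x. conf x ^ M * ?S x)" by (rule test_integrable_lborel[OF test_conf[OF S]])
  have cv: "integrable lborel (\<lambda>x. conf x ^ CARD('n) * (v x)\<^sup>2)" by (rule test_integrable_lborel[OF test_conf[OF vv]])
  have dG: "integrable lborel (\<lambda>x. \<Sum>i\<in>UNIV. partial_deriv i (?G i) x)"
    by (rule Bochner_Integration.integrable_sum) (rule test_integrable_lborel[OF test_partial[OF G]])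
  have dG0: "(\<integral>x. (\<Sum>i\<in>UNIV. partial_deriv i (?G i) x) \<partial>lborel) = 0"
    using Bochner_Integration.integral_sum[of UNIV lborel "\<lambda>i. partial_deriv i (?G i)", OF test_integrable_lborel[OF test_partial[OF G]]]
      integral_partial_deriv[OF G] by simp
  have "0 \<le> (\<integral>x. conf x ^ M * ?S x + c * (\<Sum>i\<in>UNIV. partial_deriv i (?G i) x) - c\<^sup>2 * (conf x ^ CARD('n) * (v x)\<^sup>2) \<partial>lborel)"
    by (rule Bochner_Integration.integral_nonneg) (rule pos)
  also have "\<dots> = (\<integral>x. conf x ^ M * ?S x \<partial>lborel) + c * (\<integral>x. (\<Sum>i\<in>UNIV. partial_deriv i (?G i) x) \<partial>lborel)
      - c\<^sup>2 * (\<integral>x. conf x ^ CARD('n) * (v x)\<^sup>2 \<partial>lborel)"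
    by (simp only: Bochner_Integration.integral_diff[OF Bochner_Integration.integrable_add[OF cS integrable_mult_right[OF dG]] integrable_mult_right[OF cv]]
        Bochner_Integration.integral_add[OF cS integrable_mult_right[OF dG]] integral_mult_right_zero)
  also have "\<dots> = - (\<integral>x. v x * laplace_beltrami v x \<partial>hyp_vol) - c\<^sup>2 * (\<integral>x. (v x)\<^sup>2 \<partial>hyp_vol)"
    using integral_laplace_beltrami[OF v v N] test_integral[OF vv] unfolding dG0 by (simp add: M)
  finally show ?thesis by (simp add: c_def)
qed

section \<open>Powers of the shifted Laplacian and coercivity of the GJMS form\<close>

definition shifted_lap :: "(real^'n::finite \<Rightarrow> real) \<Rightarrow> real^'n \<Rightarrow> real" where
  "shifted_lap v x = - laplace_beltrami v x - ((real CARD('n) - 1) / 2)\<^sup>2 * v x"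

context
  assumes N: "CARD('n::finite) \<ge> 2"
begin

lemma test_shifted_lap:
  "(v :: real^'n \<Rightarrow> real) \<in> test_functions \<Longrightarrow> shifted_lap v \<in> test_functions"
  using test_diff[OF test_cmult[of _ "-1", OF test_laplace_beltrami] test_cmult, of v v] N
  unfolding shifted_lap_def[abs_def] by simp

lemma shifted_lap_lincomb:
  fixes u v :: "real^'n \<Rightarrow> real"
  assumes "u \<in> test_functions" "v \<in> test_functions"
  shows "shifted_lap (\<lambda>x. a * u x + b * v x) = (\<lambda>x. a * shifted_lap u x + b * shifted_lap v x)"
  using laplace_beltrami_lincomb[OF assms N, of a b] by (auto simp: shifted_lap_def algebra_simps)

lemma test_shifted_lap_funpow:
  "(v :: real^'n \<Rightarrow> real) \<in> test_functions \<Longrightarrow> (shifted_lap ^^ i) v \<in> test_functions"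
  by (induction i) (auto intro: test_shifted_lap)

lemma shifted_lap_funpow_lincomb:
  fixes u v :: "real^'n \<Rightarrow> real"
  assumes "u \<in> test_functions" "v \<in> test_functions"
  shows "(shifted_lap ^^ i) (\<lambda>x. a * u x + b * v x) = (\<lambda>x. a * (shifted_lap ^^ i) u x + b * (shifted_lap ^^ i) v x)"
  by (induction i) (auto simp: shifted_lap_lincomb test_shifted_lap_funpow assms)

lemma shifted_lap_symmetric:
  fixes u v :: "real^'n \<Rightarrow> real"
  assumes u: "u \<in> test_functions" and v: "v \<in> test_functions"
  shows "(\<integral>x. u x * shifted_lap v x \<partial>hyp_vol) = (\<integral>x. v x * shifted_lap u x \<partial>hyp_vol)"
proof -
  let ?d = "((real CARD('n) - 1) / 2)\<^sup>2"
  have "(\<integral>x. u x * shifted_lap v x \<partial>hyp_vol) = - (\<integral>x. u x * laplace_beltrami v x \<partial>hyp_vol) - ?d * (\<integral>x. u x * v x \<partial>hyp_vol)"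
    if u: "u \<in> test_functions" and v: "v \<in> test_functions" for u v :: "real^'n \<Rightarrow> real"
  proof -
    have "integrable hyp_vol (\<lambda>x. u x * laplace_beltrami v x)" "integrable hyp_vol (\<lambda>x. u x * v x)"
      by (intro test_integrable test_mult2 test_laplace_beltrami u v N)+
    moreover have "(\<lambda>x. u x * shifted_lap v x) = (\<lambda>x. - (u x * laplace_beltrami v x) - ?d * (u x * v x))"
      by (simp add: shifted_lap_def algebra_simps)
    ultimately show ?thesis by simp
  qed
  then show ?thesis using laplace_beltrami_symmetric[OF u v N] u v by (simp add: mult.commute)
qed

lemma shifted_lap_funpow_symmetric:
  fixes u v :: "real^'n \<Rightarrow> real"
  shows "u \<in> test_functions \<Longrightarrow> v \<in> test_functions \<Longrightarrow>
    (\<integral>x. u x * (shifted_lap ^^ i) v x \<partial>hyp_vol) = (\<integral>x. (shifted_lap ^^ i) u x * v x \<partial>hyp_vol)"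
proof (induction i arbitrary: u)
  case (Suc i)
  then show ?case
    using shifted_lap_symmetric[of u "(shifted_lap ^^ i) v"] Suc.IH[of "shifted_lap u"]
    by (simp add: test_shifted_lap_funpow test_shifted_lap funpow_swap1 mult.commute)
qed simp

lemma shifted_lap_nonneg:
  fixes v :: "real^'n \<Rightarrow> real"
  assumes v: "v \<in> test_functions"
  shows "0 \<le> (\<integral>x. v x * shifted_lap v x \<partial>hyp_vol)"
proof -
  have "integrable hyp_vol (\<lambda>x. v x * laplace_beltrami v x)" "integrable hyp_vol (\<lambda>x. v x * v x)"
    by (intro test_integrable test_mult2 test_laplace_beltrami v N)+
  moreover have "(\<lambda>x. v x * shifted_lap v x) =
      (\<lambda>x. - (v x * laplace_beltrami v x) - ((real CARD('n) - 1) / 2)\<^sup>2 * (v x * v x))"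
    by (simp add: shifted_lap_def algebra_simps)
  ultimately have "(\<integral>x. v x * shifted_lap v x \<partial>hyp_vol) =
      - (\<integral>x. v x * laplace_beltrami v x \<partial>hyp_vol) - ((real CARD('n) - 1) / 2)\<^sup>2 * (\<integral>x. v x * v x \<partial>hyp_vol)"
    by simp
  then show ?thesis using spectral_gap[OF v N] by (simp add: power2_eq_square)
qed

text \<open>Half of the powers move to the other factor by symmetry: an even power becomes the
  integral of a square, an odd one the case of a single \<open>shifted_lap\<close> for an iterate of
  \<open>v\<close>.\<close>

lemma shifted_lap_funpow_nonneg:
  fixes v :: "real^'n \<Rightarrow> real"
  assumes v: "v \<in> test_functions"
  shows "0 \<le> (\<integral>x. v x * (shifted_lap ^^ i) v x \<partial>hyp_vol)"
proof -
  have w: "(shifted_lap ^^ j) v \<in> test_functions" for j by (rule test_shifted_lap_funpow[OF v])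
  show ?thesis
  proof (cases "even i")
    case True
    then obtain j where i: "i = j + j" by (metis mult_2 evenE)
    show ?thesis using shifted_lap_funpow_symmetric[OF v w, of j j]
      by (simp add: i funpow_add)
  next
    case False
    then obtain j where i: "i = j + Suc j" by (metis oddE mult_2 add_Suc_right Suc_eq_plus1)
    have "(shifted_lap ^^ i) v = (shifted_lap ^^ j) ((shifted_lap ^^ Suc j) v)"
      by (simp only: i funpow_add o_apply)
    then show ?thesis using shifted_lap_funpow_symmetric[OF v w, of j "Suc j"] shifted_lap_nonneg[OF w, of j]
      by simp
  qed
qed

text \<open>A product of factors \<open>shifted_lap + d j\<close> with positive \<open>d j\<close>
  is a polynomial in \<open>shifted_lap\<close> with positive coefficients. The family
  \<open>F\<close> is abstract because the statement serves both \<open>gjms\<close> and the signed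
  powers of the Laplace-Beltrami operator.\<close>

lemma product_expansion:
  fixes F :: "nat \<Rightarrow> (real^'n \<Rightarrow> real) \<Rightarrow> real^'n \<Rightarrow> real"
  assumes F0: "\<And>v. v \<in> test_functions \<Longrightarrow> F 0 v = v"
    and FS: "\<And>j v. v \<in> test_functions \<Longrightarrow> F (Suc j) v = F j (\<lambda>x. shifted_lap v x + d j * v x)"
    and d: "\<And>j. d j > 0"
  shows "\<exists>p. (\<forall>i\<le>m. p i > 0) \<and> (\<forall>v\<in>test_functions. F m v = (\<lambda>x. \<Sum>i\<le>m. p i * (shifted_lap ^^ i) v x))"
proof (induction m)
  case 0
  show ?case by (rule exI[of _ "\<lambda>_. 1"]) (simp add: F0)
next
  case (Suc m)
  then obtain p where p: "\<And>i. i \<le> m \<Longrightarrow> p i > 0"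
    "\<And>v. v \<in> test_functions \<Longrightarrow> F m v = (\<lambda>x. \<Sum>i\<le>m. p i * (shifted_lap ^^ i) v x)" by blast
  \<comment> \<open>Coefficients of the polynomial with coefficients \<open>p\<close> multiplied by
    the linear factor \<open>t + d m\<close>.\<close>
  define q where "q i = (if i = 0 then 0 else p (i - 1)) + (if i \<le> m then d m * p i else 0)" for i
  have "q i > 0" if "i \<le> Suc m" for i
    using that p(1)[of i] p(1)[of "i - 1"] d[of m] by (auto simp: q_def add_pos_pos add_nonneg_pos le_Suc_eq)
  moreover have "F (Suc m) v = (\<lambda>x. \<Sum>i\<le>Suc m. q i * (shifted_lap ^^ i) v x)" if v: "v \<in> test_functions" for v
  proof
    fix x
    let ?w = "\<lambda>x. shifted_lap v x + d m * v x"
    have w: "?w \<in> test_functions" by (intro test_add test_cmult test_shifted_lap v)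
    have e: "(shifted_lap ^^ i) ?w = (\<lambda>x. (shifted_lap ^^ Suc i) v x + d m * (shifted_lap ^^ i) v x)" for i
      using shifted_lap_funpow_lincomb[OF test_shifted_lap[OF v] v, of i 1 "d m"]
      by (simp add: funpow_swap1)
    have "F (Suc m) v x = (\<Sum>i\<le>m. p i * (shifted_lap ^^ Suc i) v x) + (\<Sum>i\<le>m. d m * p i * (shifted_lap ^^ i) v x)"
      unfolding FS[OF v] p(2)[OF w] e by (simp add: algebra_simps sum.distrib)
    also have "(\<Sum>i\<le>m. p i * (shifted_lap ^^ Suc i) v x)
        = (\<Sum>i\<le>Suc m. (if i = 0 then 0 else p (i - 1)) * (shifted_lap ^^ i) v x)"
      unfolding sum.atMost_Suc_shift by simp
    also have "(\<Sum>i\<le>m. d m * p i * (shifted_lap ^^ i) v x)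
        = (\<Sum>i\<le>Suc m. (if i \<le> m then d m * p i else 0) * (shifted_lap ^^ i) v x)" by simp
    finally show "F (Suc m) v x = (\<Sum>i\<le>Suc m. q i * (shifted_lap ^^ i) v x)"
      by (simp only: q_def distrib_right sum.distrib)
  qed
  ultimately show ?case by blast
qed

lemma gjms_expansion:
  "\<exists>p. (\<forall>i\<le>m. p i > 0) \<and>
     (\<forall>v\<in>test_functions. gjms m v = (\<lambda>x::real^'n. \<Sum>i\<le>m. p i * (shifted_lap ^^ i) v x))"
\<comment> \<open>The factors in the definition of \<open>gjms\<close> are numbered from 1, the
  recursion from 0. The extra \<open>1 / 4\<close> is the difference of the squared
  \<open>(N - 1) / 2\<close> and \<open>N (N - 2) / 4\<close>, so the constant is the square of
  \<open>j + 1 / 2\<close>.\<close>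
proof (rule product_expansion[where d = "\<lambda>j. 1 / 4 + real (Suc j) * real j"])
  show "gjms (Suc j) v = gjms j (\<lambda>x::real^'n. shifted_lap v x + (1 / 4 + real (Suc j) * real j) * v x)" for j v
    by (auto intro!: arg_cong[of _ _ "gjms j"] simp: P1_def shifted_lap_def power2_eq_square field_simps)
qed (auto intro: add_pos_nonneg)

lemma test_laplace_beltrami_funpow:
  "(v :: real^'n \<Rightarrow> real) \<in> test_functions \<Longrightarrow> (laplace_beltrami ^^ i) v \<in> test_functions"
  by (induction i) (auto intro: test_laplace_beltrami N)

lemma laplace_beltrami_funpow_symmetric:
  fixes u v :: "real^'n \<Rightarrow> real"
  shows "u \<in> test_functions \<Longrightarrow> v \<in> test_functions \<Longrightarrow>
    (\<integral>x. u x * (laplace_beltrami ^^ i) v x \<partial>hyp_vol) = (\<integral>x. (laplace_beltrami ^^ i) u x * v x \<partial>hyp_vol)"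
proof (induction i arbitrary: u)
  case (Suc i)
  then show ?case
    using laplace_beltrami_symmetric[of u "(laplace_beltrami ^^ i) v"] Suc.IH[of "laplace_beltrami u"] N
    by (simp add: test_laplace_beltrami_funpow test_laplace_beltrami funpow_swap1 mult.commute)
qed simp

lemma laplace_beltrami_funpow_cmult:
  fixes v :: "real^'n \<Rightarrow> real"
  assumes v: "v \<in> test_functions"
  shows "(laplace_beltrami ^^ i) (\<lambda>x. c * v x) = (\<lambda>x. c * (laplace_beltrami ^^ i) v x)"
proof (induction i)
  case (Suc i)
  have w: "(laplace_beltrami ^^ i) v \<in> test_functions" by (rule test_laplace_beltrami_funpow[OF v])
  show ?case using laplace_beltrami_lincomb[OF w w N, of c 0] by (simp add: Suc)
qed simp

text \<open>Symmetry and, for odd order, \<open>integral_grad_sq\<close> bring even and odd orders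
  to one form, the quadratic form of a signed power of the Laplacian, which can then be expanded in
  powers of \<open>shifted_lap\<close>.\<close>

lemma nabla_length_integral:
  fixes v :: "real^'n \<Rightarrow> real"
  assumes v: "v \<in> test_functions"
  shows "(\<integral>x. (nabla_length m v x)\<^sup>2 \<partial>hyp_vol) = (\<integral>x. v x * ((-1) ^ m * (laplace_beltrami ^^ m) v x) \<partial>hyp_vol)"
proof (cases "even m")
  case True
  then obtain j where m: "m = j + j" by (metis mult_2 evenE)
  have w: "(laplace_beltrami ^^ j) v \<in> test_functions" by (rule test_laplace_beltrami_funpow[OF v])
  have "m div 2 = j" using m by simp
  then show ?thesis using True laplace_beltrami_funpow_symmetric[OF v w, of j]
    by (simp add: nabla_length_def m funpow_add power2_eq_square)
next
  case False
  then obtain j where m: "m = j + Suc j" by (metis oddE mult_2 add_Suc_right Suc_eq_plus1)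
  have w: "(laplace_beltrami ^^ i) v \<in> test_functions" for i by (rule test_laplace_beltrami_funpow[OF v])
  have j: "(m - Suc 0) div 2 = j" using m by simp
  have "(\<integral>x. (nabla_length m v x)\<^sup>2 \<partial>hyp_vol) = - (\<integral>x. (laplace_beltrami ^^ j) v x * (laplace_beltrami ^^ Suc j) v x \<partial>hyp_vol)"
    using integral_grad_sq[OF w N, of j] False by (simp add: nabla_length_def j)
  also have "\<dots> = - (\<integral>x. v x * (laplace_beltrami ^^ m) v x \<partial>hyp_vol)"
    using laplace_beltrami_funpow_symmetric[OF v w, of j "Suc j"] by (simp only: m funpow_add o_apply)
  finally show ?thesis using False by simp
qed

lemma laplace_beltrami_expansion:
  "\<exists>p. (\<forall>i\<le>m. p i > 0) \<and>
     (\<forall>v\<in>test_functions. (\<lambda>x. (-1) ^ m * (laplace_beltrami ^^ m) v x)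
        = (\<lambda>x::real^'n. \<Sum>i\<le>m. p i * (shifted_lap ^^ i) v x))"
\<comment> \<open>Here every factor is \<open>- laplace_beltrami\<close>, that is
  \<open>shifted_lap\<close> plus the spectral gap, and the gap is positive because the dimension is
  at least 2.\<close>
proof (rule product_expansion[where d = "\<lambda>j. ((real CARD('n) - 1) / 2)\<^sup>2"])
  fix j and v :: "real^'n \<Rightarrow> real" assume v: "v \<in> test_functions"
  show "(\<lambda>x. (-1) ^ Suc j * (laplace_beltrami ^^ Suc j) v x) =
    (\<lambda>x. (-1) ^ j * (laplace_beltrami ^^ j) (\<lambda>x. shifted_lap v x + ((real CARD('n) - 1) / 2)\<^sup>2 * v x) x)"
    using laplace_beltrami_funpow_cmult[OF test_laplace_beltrami[OF v N], of j "-1"]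
    by (simp add: shifted_lap_def funpow_swap1)
qed (use N in auto)

lemma integral_expansion:
  fixes v :: "real^'n \<Rightarrow> real"
  assumes v: "v \<in> test_functions" and u: "u \<in> test_functions"
  shows "(\<integral>x. u x * (\<Sum>i\<le>m. p i * (shifted_lap ^^ i) v x) \<partial>hyp_vol) =
    (\<Sum>i\<le>m. p i * (\<integral>x. u x * (shifted_lap ^^ i) v x \<partial>hyp_vol))"
proof -
  have "integrable hyp_vol (\<lambda>x. u x * (shifted_lap ^^ i) v x)" for i
    by (intro test_integrable test_mult2 test_shifted_lap_funpow u v)
  then show ?thesis by (simp add: sum_distrib_left mult.left_commute)
qed

lemma test_gjms:
  fixes v :: "real^'n \<Rightarrow> real"
  assumes "v \<in> test_functions" shows "gjms m v \<in> test_functions"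
proof -
  obtain p where "gjms m v = (\<lambda>x. \<Sum>i\<le>m. p i * (shifted_lap ^^ i) v x)"
    using gjms_expansion[of m] assms by blast
  then show ?thesis by (simp add: test_sum test_cmult test_shifted_lap_funpow assms)
qed

lemma gjms_symmetric:
  fixes u v :: "real^'n \<Rightarrow> real"
  assumes "u \<in> test_functions" "v \<in> test_functions"
  shows "(\<integral>x. u x * gjms m v x \<partial>hyp_vol) = (\<integral>x. v x * gjms m u x \<partial>hyp_vol)"
proof -
  obtain p where "\<And>v. v \<in> test_functions \<Longrightarrow> gjms m v = (\<lambda>x::real^'n. \<Sum>i\<le>m. p i * (shifted_lap ^^ i) v x)"
    using gjms_expansion[of m] by blast
  then have "(\<integral>x. u x * gjms m v x \<partial>hyp_vol) = (\<Sum>i\<le>m. p i * (\<integral>x. u x * (shifted_lap ^^ i) v x \<partial>hyp_vol))"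
    if "u \<in> test_functions" "v \<in> test_functions" for u v :: "real^'n \<Rightarrow> real"
    using that by (simp add: integral_expansion)
  moreover have "(\<integral>x. u x * (shifted_lap ^^ i) v x \<partial>hyp_vol) = (\<integral>x. v x * (shifted_lap ^^ i) u x \<partial>hyp_vol)" for i
    using shifted_lap_funpow_symmetric[OF assms, of i] by (simp only: mult.commute)
  ultimately show ?thesis using assms by simp
qed

text \<open>The energy and each summand of the Sobolev norm are combinations of the same nonnegative
  quantities \<open>?b i v\<close> with positive coefficients, so they can be compared term by term.
  The energy contains all powers up to \<open>k\<close>, hence every power that occurs in a summand
  of order \<open>m \<le> k\<close>.\<close>

lemma gjms_coercive:
  "\<exists>c>0. \<forall>v\<in>test_functions. c * (sobolev_norm k (v :: real^'n \<Rightarrow> real))\<^sup>2 \<le> (\<integral>x. v x * gjms k v x \<partial>hyp_vol)"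
proof -
  obtain p where p: "\<And>i. i \<le> k \<Longrightarrow> p i > 0"
    "\<And>v. v \<in> test_functions \<Longrightarrow> gjms k v = (\<lambda>x::real^'n. \<Sum>i\<le>k. p i * (shifted_lap ^^ i) v x)"
    using gjms_expansion[of k] by blast
  let ?b = "\<lambda>i (v :: real^'n \<Rightarrow> real). (\<integral>x. v x * (shifted_lap ^^ i) v x \<partial>hyp_vol)"
  let ?a = "\<lambda>v :: real^'n \<Rightarrow> real. (\<integral>x. v x * gjms k v x \<partial>hyp_vol)"
  have a: "?a v = (\<Sum>i\<le>k. p i * ?b i v)" if "v \<in> test_functions" for v
    using that by (simp add: p(2) integral_expansion)
  have pb: "p i * ?b i v \<le> ?a v" if v: "v \<in> test_functions" and i: "i \<le> k" for i v
    unfolding a[OF v] using shifted_lap_funpow_nonneg[OF v] p(1) i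
    by (intro member_le_sum) (auto simp: less_imp_le)
  have ex: "\<exists>C\<ge>0. \<forall>v\<in>(test_functions :: (real^'n \<Rightarrow> real) set). (\<integral>x. (nabla_length m v x)\<^sup>2 \<partial>hyp_vol) \<le> C * ?a v" if m: "m \<le> k" for m
  proof -
    obtain q where q: "\<And>i. i \<le> m \<Longrightarrow> q i > 0"
      "\<And>v. v \<in> test_functions \<Longrightarrow> (\<lambda>x. (-1) ^ m * (laplace_beltrami ^^ m) v x)
        = (\<lambda>x::real^'n. \<Sum>i\<le>m. q i * (shifted_lap ^^ i) v x)"
      using laplace_beltrami_expansion[of m] by blast
    have "(\<integral>x. (nabla_length m v x)\<^sup>2 \<partial>hyp_vol) \<le> (\<Sum>i\<le>m. q i / p i) * ?a v" if v: "v \<in> test_functions" for v :: "real^'n \<Rightarrow> real"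
    proof -
      have "(\<integral>x. (nabla_length m v x)\<^sup>2 \<partial>hyp_vol) = (\<Sum>i\<le>m. q i * ?b i v)"
        unfolding nabla_length_integral[OF v] fun_cong[OF q(2)[OF v]] by (rule integral_expansion[OF v v])
      also have "\<dots> \<le> (\<Sum>i\<le>m. q i / p i * ?a v)"
      proof (rule sum_mono)
        fix i assume "i \<in> {..m}"
        then have i: "i \<le> m" "i \<le> k" using m by auto
        have "q i * ?b i v = q i / p i * (p i * ?b i v)" using p(1)[OF i(2)] by simp
        also have "\<dots> \<le> q i / p i * ?a v"
          using q(1)[OF i(1)] p(1)[OF i(2)] by (intro mult_left_mono pb v i) auto
        finally show "q i * ?b i v \<le> q i / p i * ?a v" .
      qed
      finally show ?thesis by (simp add: sum_distrib_right)
    qed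
    moreover have "(\<Sum>i\<le>m. q i / p i) \<ge> 0"
      using q(1) p(1) m by (intro sum_nonneg divide_nonneg_nonneg) (auto simp: less_imp_le)
    ultimately show ?thesis by blast
  qed
  have "\<forall>m. \<exists>C. m \<le> k \<longrightarrow> C \<ge> 0 \<and> (\<forall>v\<in>(test_functions :: (real^'n \<Rightarrow> real) set).
      (\<integral>x. (nabla_length m v x)\<^sup>2 \<partial>hyp_vol) \<le> C * ?a v)"
    using ex by blast
  from choice[OF this] obtain C where C: "\<And>m. m \<le> k \<Longrightarrow> C m \<ge> 0"
    "\<And>m (v :: real^'n \<Rightarrow> real). m \<le> k \<Longrightarrow> v \<in> test_functions \<Longrightarrow> (\<integral>x. (nabla_length m v x)\<^sup>2 \<partial>hyp_vol) \<le> C m * ?a v"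
    by blast
  define D where "D = (\<Sum>m\<le>k. C m) + 1"
  have D: "D > 0" using C(1) by (auto simp: D_def intro!: add_nonneg_pos sum_nonneg)
  have "1 / D * (sobolev_norm k v)\<^sup>2 \<le> ?a v" if v: "v \<in> test_functions" for v
  proof -
    have "0 \<le> p 0 * ?b 0 v"
      using p(1)[of 0] shifted_lap_funpow_nonneg[OF v, of 0] by (intro mult_nonneg_nonneg) auto
    also have "\<dots> \<le> ?a v" by (rule pb[OF v]) simp
    finally have a0: "0 \<le> ?a v" .
    have "(sobolev_norm k v)\<^sup>2 = (\<Sum>m\<le>k. \<integral>x. (nabla_length m v x)\<^sup>2 \<partial>hyp_vol)"
      unfolding sobolev_norm_def by (intro real_sqrt_pow2 sum_nonneg Bochner_Integration.integral_nonneg) simp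
    also have "\<dots> \<le> (\<Sum>m\<le>k. C m * ?a v)" by (intro sum_mono C(2) v) simp
    also have "\<dots> \<le> D * ?a v" using a0 by (simp add: D_def distrib_right sum_distrib_right)
    finally show ?thesis using D by (simp add: field_simps)
  qed
  then show ?thesis using D by (intro exI[of _ "1 / D"]) auto
qed

end

lemma sobolev_norm_L2:
  "(\<integral>x. (v x)\<^sup>2 \<partial>hyp_vol) \<le> (sobolev_norm k v)\<^sup>2"
proof -
  have "(sobolev_norm k v)\<^sup>2 = (\<Sum>m\<le>k. \<integral>x. (nabla_length m v x)\<^sup>2 \<partial>hyp_vol)"
    unfolding sobolev_norm_def by (intro real_sqrt_pow2 sum_nonneg Bochner_Integration.integral_nonneg) simp
  also have "\<dots> \<ge> (\<integral>x. (nabla_length 0 v x)\<^sup>2 \<partial>hyp_vol)"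
    by (rule member_le_sum) (auto intro: Bochner_Integration.integral_nonneg)
  finally show ?thesis by (simp add: nabla_length_def)
qed

section \<open>Square integrable functions\<close>

lemma L2_measurable: "f \<in> L2 M \<Longrightarrow> f \<in> borel_measurable M"
  and L2_integrable: "f \<in> L2 M \<Longrightarrow> integrable M (\<lambda>x. (f x)\<^sup>2)"
  by (auto simp: L2_def)

lemma L2_mult_integrable:
  assumes "f \<in> L2 M" "g \<in> L2 M"
  shows "integrable M (\<lambda>x. f x * g x)"
proof (rule Bochner_Integration.integrable_bound)
  show "integrable M (\<lambda>x. (f x)\<^sup>2 + (g x)\<^sup>2)"
    using assms by (intro Bochner_Integration.integrable_add L2_integrable)
  show "(\<lambda>x. f x * g x) \<in> borel_measurable M"
    using assms by (intro borel_measurable_times L2_measurable)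
  have "\<bar>a * b\<bar> \<le> a\<^sup>2 + b\<^sup>2" for a b :: real
    using sum_squares_bound[of "\<bar>a\<bar>" "\<bar>b\<bar>"] mult_nonneg_nonneg[of "\<bar>a\<bar>" "\<bar>b\<bar>"]
    unfolding abs_mult power2_abs by linarith
  then show "AE x in M. norm (f x * g x) \<le> norm ((f x)\<^sup>2 + (g x)\<^sup>2)" by simp
qed

lemma L2_lincomb:
  assumes "f \<in> L2 M" "g \<in> L2 M"
  shows "(\<lambda>x. a * f x + b * g x) \<in> L2 M"
proof -
  have "(\<lambda>x. (a * f x + b * g x)\<^sup>2) = (\<lambda>x. a\<^sup>2 * (f x)\<^sup>2 + (2 * a * b) * (f x * g x) + b\<^sup>2 * (g x)\<^sup>2)"
    by (simp add: power2_eq_square algebra_simps)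
  moreover have "integrable M (\<lambda>x. a\<^sup>2 * (f x)\<^sup>2 + (2 * a * b) * (f x * g x) + b\<^sup>2 * (g x)\<^sup>2)"
    using assms by (intro Bochner_Integration.integrable_add integrable_mult_right L2_integrable L2_mult_integrable)
  ultimately show ?thesis using assms by (auto simp: L2_def)
qed

lemma L2_diff: "f \<in> L2 M \<Longrightarrow> g \<in> L2 M \<Longrightarrow> (\<lambda>x. f x - g x) \<in> L2 M"
  using L2_lincomb[of f M g 1 "-1"] by simp

lemma L2_bounded_mult:
  assumes g: "g \<in> L2 M" and h: "h \<in> borel_measurable M" and B: "AE x in M. \<bar>h x\<bar> \<le> B"
  shows "(\<lambda>x. g x * h x) \<in> L2 M" "(\<integral>x. (g x * h x)\<^sup>2 \<partial>M) \<le> B\<^sup>2 * (\<integral>x. (g x)\<^sup>2 \<partial>M)"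
proof -
  have m: "(\<lambda>x. g x * h x) \<in> borel_measurable M" using L2_measurable[OF g] h by measurable
  have le: "AE x in M. (g x * h x)\<^sup>2 \<le> B\<^sup>2 * (g x)\<^sup>2"
    using B
  proof eventually_elim
    case (elim x)
    then have "(h x)\<^sup>2 \<le> B\<^sup>2" by (metis abs_le_square_iff abs_ge_zero abs_of_nonneg order_trans)
    from mult_left_mono[OF this zero_le_power2[of "g x"]] show ?case
      by (simp add: power_mult_distrib mult.commute)
  qed
  have i: "integrable M (\<lambda>x. (g x * h x)\<^sup>2)"
    by (rule Bochner_Integration.integrable_bound[of _ "\<lambda>x. B\<^sup>2 * (g x)\<^sup>2"])
       (use le m L2_integrable[OF g] in auto)
  then show "(\<lambda>x. g x * h x) \<in> L2 M" using m by (simp add: L2_def)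
  show "(\<integral>x. (g x * h x)\<^sup>2 \<partial>M) \<le> B\<^sup>2 * (\<integral>x. (g x)\<^sup>2 \<partial>M)"
    using integral_mono_AE[OF i integrable_mult_right[OF L2_integrable[OF g]] le] by simp
qed

lemma quadratic_discriminant_le:
  fixes a b c :: real
  assumes "\<And>t. 0 \<le> a + 2 * t * b + t\<^sup>2 * c"
  shows "b\<^sup>2 \<le> a * c"
proof (cases "c = 0")
  case True
  have "b = 0"
  proof (rule ccontr)
    assume "b \<noteq> 0"
    then have "2 * (- (a + 1) / (2 * b)) * b = - (a + 1)" by simp
    then show False using assms[of "- (a + 1) / (2 * b)"] True by simp
  qed
  then show ?thesis using True by simp
next
  case False
  have "c > 0"
  proof (rule ccontr)
    assume "\<not> c > 0"
    with False have c: "c < 0" by simp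
    \<comment> \<open>At this \<open>t\<close> the product \<open>t * c\<close> lies below
      \<open>- (\<bar>a\<bar> + 1 + 2 * \<bar>b\<bar>)\<close>, and since \<open>t \<ge> 1\<close>
      the quadratic drops to at most \<open>a - \<bar>a\<bar> - 1\<close>.\<close>
    define t where "t = (\<bar>a\<bar> + 1 + 2 * \<bar>b\<bar>) / \<bar>c\<bar> + 1"
    have t: "t \<ge> 1" unfolding t_def by (simp add: divide_nonneg_nonneg)
    have tc: "t * c = - (\<bar>a\<bar> + 1 + 2 * \<bar>b\<bar>) + c" using c by (simp add: t_def field_simps)
    have "a + 2 * t * b + t\<^sup>2 * c = a + t * (2 * b + t * c)" by (simp add: algebra_simps power2_eq_square)
    also have "\<dots> \<le> a + t * (- \<bar>a\<bar> - 1)"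
      unfolding tc using t c by (intro add_left_mono mult_left_mono) auto
    also have "\<dots> \<le> a + 1 * (- \<bar>a\<bar> - 1)" by (intro add_left_mono mult_right_mono_neg t) auto
    also have "\<dots> < 0" by simp
    finally show False using assms[of t] by simp
  qed
  then show ?thesis using assms[of "- b / c"] by (simp add: field_simps power2_eq_square)
qed

lemma L2_Cauchy_Schwarz:
  assumes f: "f \<in> L2 M" and g: "g \<in> L2 M"
  shows "(\<integral>x. f x * g x \<partial>M)\<^sup>2 \<le> (\<integral>x. (f x)\<^sup>2 \<partial>M) * (\<integral>x. (g x)\<^sup>2 \<partial>M)"
proof (rule quadratic_discriminant_le)
  fix t
  have "0 \<le> (\<integral>x. (1 * f x + t * g x)\<^sup>2 \<partial>M)" by (rule Bochner_Integration.integral_nonneg) simp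
  also have "(\<lambda>x. (1 * f x + t * g x)\<^sup>2) = (\<lambda>x. (f x)\<^sup>2 + 2 * t * (f x * g x) + t\<^sup>2 * (g x)\<^sup>2)"
    by (simp add: power2_eq_square algebra_simps)
  also have "(\<integral>x. (f x)\<^sup>2 + 2 * t * (f x * g x) + t\<^sup>2 * (g x)\<^sup>2 \<partial>M)
      = (\<integral>x. (f x)\<^sup>2 \<partial>M) + 2 * t * (\<integral>x. f x * g x \<partial>M) + t\<^sup>2 * (\<integral>x. (g x)\<^sup>2 \<partial>M)"
    using f g by (simp add: L2_integrable L2_mult_integrable)
  finally show "0 \<le> (\<integral>x. (f x)\<^sup>2 \<partial>M) + 2 * t * (\<integral>x. f x * g x \<partial>M) + t\<^sup>2 * (\<integral>x. (g x)\<^sup>2 \<partial>M)" .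
qed

lemma L2_tendsto_mult:
  assumes \<phi>: "\<And>n. \<phi> n \<in> L2 M" and w: "w \<in> L2 M" and g: "g \<in> L2 M"
    and lim: "(\<lambda>n. \<integral>x. (\<phi> n x - w x)\<^sup>2 \<partial>M) \<longlonglongrightarrow> 0"
  shows "(\<lambda>n. \<integral>x. \<phi> n x * g x \<partial>M) \<longlonglongrightarrow> (\<integral>x. w x * g x \<partial>M)"
proof -
  have "(\<lambda>n. (\<integral>x. (\<phi> n x - w x) * g x \<partial>M)\<^sup>2) \<longlonglongrightarrow> 0"
  proof (rule tendsto_sandwich[of "\<lambda>_. 0"])
    show "(\<lambda>n. (\<integral>x. (\<phi> n x - w x)\<^sup>2 \<partial>M) * (\<integral>x. (g x)\<^sup>2 \<partial>M)) \<longlonglongrightarrow> 0"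
      using tendsto_mult_left_zero[OF lim] .
    show "\<forall>\<^sub>F n in sequentially. (\<integral>x. (\<phi> n x - w x) * g x \<partial>M)\<^sup>2 \<le> (\<integral>x. (\<phi> n x - w x)\<^sup>2 \<partial>M) * (\<integral>x. (g x)\<^sup>2 \<partial>M)"
      by (intro always_eventually allI L2_Cauchy_Schwarz L2_diff \<phi> w g)
  qed auto
  then have "(\<lambda>n. \<integral>x. (\<phi> n x - w x) * g x \<partial>M) \<longlonglongrightarrow> 0"
    by (simp add: power_tendsto_0_iff)
  moreover have "(\<integral>x. (\<phi> n x - w x) * g x \<partial>M) = (\<integral>x. \<phi> n x * g x \<partial>M) - (\<integral>x. w x * g x \<partial>M)" for n
    using L2_mult_integrable[OF \<phi> g] L2_mult_integrable[OF w g] by (simp add: left_diff_distrib)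
  ultimately show ?thesis by (simp add: LIM_zero_iff)
qed

lemma L2_tendsto_square:
  assumes \<phi>: "\<And>n. \<phi> n \<in> L2 M" and w: "w \<in> L2 M"
    and lim: "(\<lambda>n. \<integral>x. (\<phi> n x - w x)\<^sup>2 \<partial>M) \<longlonglongrightarrow> 0"
  shows "(\<lambda>n. \<integral>x. (\<phi> n x)\<^sup>2 \<partial>M) \<longlonglongrightarrow> (\<integral>x. (w x)\<^sup>2 \<partial>M)"
proof -
  have "(\<integral>x. (\<phi> n x)\<^sup>2 \<partial>M) = (\<integral>x. (\<phi> n x - w x)\<^sup>2 \<partial>M) + 2 * (\<integral>x. \<phi> n x * w x \<partial>M) - (\<integral>x. w x * w x \<partial>M)" for n
  proof -
    have "(\<integral>x. (\<phi> n x - w x)\<^sup>2 \<partial>M) = (\<integral>x. (\<phi> n x)\<^sup>2 - 2 * (\<phi> n x * w x) + w x * w x \<partial>M)"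
      by (simp add: power2_eq_square algebra_simps)
    also have "\<dots> = (\<integral>x. (\<phi> n x)\<^sup>2 \<partial>M) - 2 * (\<integral>x. \<phi> n x * w x \<partial>M) + (\<integral>x. w x * w x \<partial>M)"
      using L2_integrable[OF \<phi>] L2_mult_integrable[OF \<phi> w] L2_mult_integrable[OF w w] by simp
    finally show ?thesis by simp
  qed
  moreover have "(\<lambda>n. (\<integral>x. (\<phi> n x - w x)\<^sup>2 \<partial>M) + 2 * (\<integral>x. \<phi> n x * w x \<partial>M) - (\<integral>x. w x * w x \<partial>M))
      \<longlonglongrightarrow> 0 + 2 * (\<integral>x. w x * w x \<partial>M) - (\<integral>x. w x * w x \<partial>M)"
    by (intro tendsto_intros lim L2_tendsto_mult \<phi> w)
  ultimately show ?thesis by (simp add: power2_eq_square)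
qed

text \<open>Riesz-Fischer for genuine functions instead of classes: a rapidly convergent subsequence
  converges almost everywhere, its pointwise limit is the candidate, and Fatou's lemma transfers the
  Cauchy estimate to the limit.\<close>

lemma L2_complete:
  fixes f :: "nat \<Rightarrow> 'a \<Rightarrow> real"
  assumes f: "\<And>n. f n \<in> L2 M"
    and Cauchy: "\<And>e. e > 0 \<Longrightarrow> \<exists>n0. \<forall>m\<ge>n0. \<forall>n\<ge>n0. (\<integral>x. (f m x - f n x)\<^sup>2 \<partial>M) < e"
  obtains w where "w \<in> L2 M" "(\<lambda>n. \<integral>x. (f n x - w x)\<^sup>2 \<partial>M) \<longlonglongrightarrow> 0"
proof -
  have [measurable]: "f n \<in> borel_measurable M" for n by (rule L2_measurable[OF f])
  have "\<exists>n0. \<forall>m\<ge>n0. \<forall>n\<ge>n0. (\<integral>x. (f m x - f n x)\<^sup>2 \<partial>M) < (1/4) ^ i" for i :: nat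
    by (rule Cauchy) simp
  then obtain q where q: "\<And>i m n. m \<ge> q i \<Longrightarrow> n \<ge> q i \<Longrightarrow> (\<integral>x. (f m x - f n x)\<^sup>2 \<partial>M) < (1/4) ^ i"
    by metis
  \<comment> \<open>The partial sums make both indices of a consecutive difference large enough
    (\<open>r i\<close> and \<open>r (Suc i)\<close> reach \<open>q i\<close>), and the summand
    \<open>i\<close> sends them to infinity.\<close>
  define r where "r i = (\<Sum>j\<le>i. q j) + i" for i
  have r: "r i \<ge> q i" "r (Suc i) \<ge> q i" "r i \<ge> i" for i
    using member_le_sum[of i "{..i}" q] by (auto simp: r_def)
  let ?g = "\<lambda>i. f (r i)"
  let ?d = "\<lambda>i x. (?g (Suc i) x - ?g i x)\<^sup>2"
  have d: "(\<integral>x. ?d i x \<partial>M) < (1/4) ^ i" for i using q r by blast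
  \<comment> \<open>The integrals decay like \<open>(1/4) ^ i\<close>, so the weights
    \<open>2 ^ i\<close> leave a summable series. Almost everywhere its terms stay bounded, hence
    consecutive differences decay like \<open>sqrt (1/2) ^ i\<close> and telescoping gives
    convergence.\<close>
  have "(\<integral>\<^sup>+x. (\<Sum>i. ennreal (2 ^ i * ?d i x)) \<partial>M) = (\<Sum>i. \<integral>\<^sup>+x. ennreal (2 ^ i * ?d i x) \<partial>M)"
    by (rule nn_integral_suminf) measurable
  also have "\<dots> \<le> (\<Sum>i. ennreal ((1/2) ^ i))"
  proof (intro suminf_le)
    fix i :: nat
    have "(\<integral>\<^sup>+x. ennreal (2 ^ i * ?d i x) \<partial>M) = ennreal (\<integral>x. 2 ^ i * ?d i x \<partial>M)"
      by (intro nn_integral_eq_integral integrable_mult_right L2_integrable L2_diff f) simp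
    also have "(\<integral>x. 2 ^ i * ?d i x \<partial>M) \<le> 2 ^ i * (1/4) ^ i"
      using d[of i] by simp
    also have "(2::real) ^ i * (1/4) ^ i = (1/2) ^ i" by (simp flip: power_mult_distrib)
    finally show "(\<integral>\<^sup>+x. ennreal (2 ^ i * ?d i x) \<partial>M) \<le> ennreal ((1/2) ^ i)"
      by (simp add: ennreal_leI)
  qed auto
  also have "\<dots> = ennreal (\<Sum>i. (1/2) ^ i)"
    by (intro suminf_ennreal2) (auto intro: summable_geometric)
  also have "\<dots> < top" by simp
  finally have "(\<integral>\<^sup>+x. (\<Sum>i. ennreal (2 ^ i * ?d i x)) \<partial>M) \<noteq> \<infinity>" by simp
  then have "AE x in M. (\<Sum>i. ennreal (2 ^ i * ?d i x)) \<noteq> \<infinity>"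
    by (intro nn_integral_PInf_AE) measurable
  then have conv: "AE x in M. convergent (\<lambda>i. ?g i x)"
  proof eventually_elim
    case (elim x)
    then have "summable (\<lambda>i. 2 ^ i * ?d i x)"
      by (intro summable_suminf_not_top) (auto simp: infinity_ennreal_def)
    then have "bounded (range (\<lambda>i. 2 ^ i * ?d i x))"
      using summable_LIMSEQ_zero convergent_imp_bounded by blast
    then obtain B where B: "\<And>i. 2 ^ i * ?d i x \<le> B" unfolding bounded_iff by force
    have B0: "B \<ge> 0" using B[of 0] by (metis zero_le_power2 mult_1 order_trans power_0)
    have "\<bar>?g (Suc i) x - ?g i x\<bar> \<le> sqrt B * sqrt (1/2) ^ i" for i
    proof -
      have "?d i x \<le> B * (1/2) ^ i" using B[of i] by (simp add: field_simps)
      then have "sqrt (?d i x) \<le> sqrt (B * (1/2) ^ i)" by (rule real_sqrt_le_mono)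
      then show ?thesis unfolding real_sqrt_abs real_sqrt_mult unfolding real_sqrt_power .
    qed
    moreover have sm: "summable (\<lambda>i. sqrt B * sqrt (1/2) ^ i)"
      by (intro summable_mult summable_geometric) (simp add: real_sqrt_divide)
    ultimately have "summable (\<lambda>i. ?g (Suc i) x - ?g i x)"
      by (intro summable_comparison_test'[OF sm, of 0]) auto
    from summable_LIMSEQ[OF this]
    have "(\<lambda>n. ?g n x - ?g 0 x) \<longlonglongrightarrow> (\<Sum>i. ?g (Suc i) x - ?g i x)"
      using sum_lessThan_telescope[of "\<lambda>i. ?g i x"] by simp
    from tendsto_add[OF this tendsto_const[of "?g 0 x"]] show ?case by (auto intro: convergentI)
  qed
  define w where "w x = lim (\<lambda>i. ?g i x)" for x
  have [measurable]: "w \<in> borel_measurable M" unfolding w_def[abs_def] by measurable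
  have bound: "(\<integral>\<^sup>+x. ennreal ((f n x - w x)\<^sup>2) \<partial>M) \<le> ennreal e"
    if e: "e > 0" and n0: "\<And>m n. m \<ge> n0 \<Longrightarrow> n \<ge> n0 \<Longrightarrow> (\<integral>x. (f m x - f n x)\<^sup>2 \<partial>M) < e" and n: "n \<ge> n0" for e n n0
  proof -
    have "AE x in M. ennreal ((f n x - w x)\<^sup>2) = liminf (\<lambda>i. ennreal ((f n x - ?g i x)\<^sup>2))"
      using conv
    proof eventually_elim
      case (elim x)
      then have "(\<lambda>i. ?g i x) \<longlonglongrightarrow> w x" by (simp add: w_def convergent_LIMSEQ_iff)
      then have "(\<lambda>i. ennreal ((f n x - ?g i x)\<^sup>2)) \<longlonglongrightarrow> ennreal ((f n x - w x)\<^sup>2)"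
        by (intro tendsto_ennrealI tendsto_intros)
      from lim_imp_Liminf[OF trivial_limit_sequentially this] show ?case by (rule sym)
    qed
    then have "(\<integral>\<^sup>+x. ennreal ((f n x - w x)\<^sup>2) \<partial>M) = (\<integral>\<^sup>+x. liminf (\<lambda>i. ennreal ((f n x - ?g i x)\<^sup>2)) \<partial>M)"
      by (rule nn_integral_cong_AE)
    also have "\<dots> \<le> liminf (\<lambda>i. \<integral>\<^sup>+x. ennreal ((f n x - ?g i x)\<^sup>2) \<partial>M)"
      by (rule nn_integral_liminf) measurable
    also have "\<dots> \<le> limsup (\<lambda>i. \<integral>\<^sup>+x. ennreal ((f n x - ?g i x)\<^sup>2) \<partial>M)"
      by (rule Liminf_le_Limsup) simp
    also have "\<dots> \<le> ennreal e"
    proof (rule Limsup_bounded)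
      show "\<forall>\<^sub>F i in sequentially. (\<integral>\<^sup>+x. ennreal ((f n x - ?g i x)\<^sup>2) \<partial>M) \<le> ennreal e"
      proof (rule eventually_sequentiallyI[of n0])
        fix i assume "i \<ge> n0"
        then have "r i \<ge> n0" using r(3)[of i] by simp
        then have "(\<integral>x. (f n x - ?g i x)\<^sup>2 \<partial>M) < e" by (intro n0 n)
        moreover have "(\<integral>\<^sup>+x. ennreal ((f n x - ?g i x)\<^sup>2) \<partial>M) = ennreal (\<integral>x. (f n x - ?g i x)\<^sup>2 \<partial>M)"
          by (intro nn_integral_eq_integral L2_integrable L2_diff f) simp
        ultimately show "(\<integral>\<^sup>+x. ennreal ((f n x - ?g i x)\<^sup>2) \<partial>M) \<le> ennreal e"
          by (simp add: ennreal_leI)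
      qed
    qed
    finally show ?thesis .
  qed
  have bound': "(\<lambda>x. f n x - w x) \<in> L2 M \<and> (\<integral>x. (f n x - w x)\<^sup>2 \<partial>M) \<le> e"
    if e: "e > 0" and n0: "\<And>m n. m \<ge> n0 \<Longrightarrow> n \<ge> n0 \<Longrightarrow> (\<integral>x. (f m x - f n x)\<^sup>2 \<partial>M) < e" and n: "n \<ge> n0" for e n n0
  proof -
    have le: "(\<integral>\<^sup>+x. ennreal ((f n x - w x)\<^sup>2) \<partial>M) \<le> ennreal e" using bound[OF that] .
    then have "(\<integral>\<^sup>+x. ennreal (norm ((f n x - w x)\<^sup>2)) \<partial>M) < \<infinity>"
      by (simp add: order_le_less_trans)
    then have i: "integrable M (\<lambda>x. (f n x - w x)\<^sup>2)"
      by (intro integrableI_bounded) measurable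
    have "ennreal (\<integral>x. (f n x - w x)\<^sup>2 \<partial>M) \<le> ennreal e"
      using nn_integral_eq_integral[OF i] le by simp
    then show ?thesis using i e by (simp add: L2_def)
  qed
  obtain n1 where n1: "\<And>m n. m \<ge> n1 \<Longrightarrow> n \<ge> n1 \<Longrightarrow> (\<integral>x. (f m x - f n x)\<^sup>2 \<partial>M) < 1"
    using Cauchy[of 1] by auto
  have "(\<lambda>x. f n1 x - w x) \<in> L2 M" using bound'[of 1 n1 n1] n1 by simp
  from L2_diff[OF f[of n1] this] have w: "w \<in> L2 M" by simp
  have "(\<lambda>n. \<integral>x. (f n x - w x)\<^sup>2 \<partial>M) \<longlonglongrightarrow> 0"
  proof (rule LIMSEQ_I)
    fix e :: real assume e: "e > 0"
    then obtain n0 where n0: "\<And>m n. m \<ge> n0 \<Longrightarrow> n \<ge> n0 \<Longrightarrow> (\<integral>x. (f m x - f n x)\<^sup>2 \<partial>M) < e / 2"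
      using Cauchy[of "e / 2"] by auto
    have "norm ((\<integral>x. (f n x - w x)\<^sup>2 \<partial>M) - 0) < e" if "n \<ge> n0" for n
      using bound'[of "e/2" n0 n] n0 that e by (auto intro: order_le_less_trans)
    then show "\<exists>no. \<forall>n\<ge>no. norm ((\<integral>x. (f n x - w x)\<^sup>2 \<partial>M) - 0) < e" by blast
  qed
  with w show thesis by (rule that)
qed

lemma test_L2: "v \<in> test_functions \<Longrightarrow> v \<in> L2 hyp_vol"
  unfolding L2_def power2_eq_square
  using test_measurable_hyp test_integrable[OF test_mult2] by blast

section \<open>Energy solutions of the linear equation\<close>

definition gjms_form :: "nat \<Rightarrow> (real^'n::finite \<Rightarrow> real) \<Rightarrow> (real^'n \<Rightarrow> real) \<Rightarrow> real" where
  "gjms_form k u v = (\<integral>x. u x * gjms k v x \<partial>hyp_vol)"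

text \<open>A strong and a weak description at once. The approximating sequence is Cauchy for
  \<open>gjms_form\<close>, which by coercivity yields membership in the Sobolev space and lets
  estimates pass to the limit; in the equation all derivatives fall on the test function, so
  \<open>gjms\<close> is never applied to \<open>w\<close>.\<close>

definition energy_solution :: "nat \<Rightarrow> (real^'n::finite \<Rightarrow> real) \<Rightarrow> (real^'n \<Rightarrow> real) \<Rightarrow> bool" where
  "energy_solution k f w \<longleftrightarrow> w \<in> L2 hyp_vol \<and>
     (\<exists>\<phi>. (\<forall>n::nat. \<phi> n \<in> test_functions) \<and>
       (\<forall>e>0. \<exists>n0. \<forall>m\<ge>n0. \<forall>n\<ge>n0. gjms_form k (\<lambda>x. \<phi> m x - \<phi> n x) (\<lambda>x. \<phi> m x - \<phi> n x) < e) \<and>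
       (\<lambda>n. \<integral>x. (\<phi> n x - w x)\<^sup>2 \<partial>hyp_vol) \<longlonglongrightarrow> 0) \<and>
     (\<forall>v\<in>test_functions. (\<integral>x. w x * gjms k v x \<partial>hyp_vol) = (\<integral>x. f x * v x \<partial>hyp_vol))"

context
  fixes k :: nat
  assumes N: "CARD('n::finite) \<ge> 2"
begin

lemma gjms_form_symmetric:
  fixes u v :: "real^'n \<Rightarrow> real"
  shows "u \<in> test_functions \<Longrightarrow> v \<in> test_functions \<Longrightarrow> gjms_form k u v = gjms_form k v u"
  unfolding gjms_form_def by (rule gjms_symmetric[OF N])

lemma gjms_form_lincomb_left:
  fixes u v w :: "real^'n \<Rightarrow> real"
  assumes "u \<in> test_functions" "v \<in> test_functions" "w \<in> test_functions"
  shows "gjms_form k (\<lambda>x. a * u x + b * v x) w = a * gjms_form k u w + b * gjms_form k v w"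
proof -
  have "integrable hyp_vol (\<lambda>x. u x * gjms k w x)" "integrable hyp_vol (\<lambda>x. v x * gjms k w x)"
    by (intro test_integrable test_mult2 test_gjms N assms)+
  moreover have "(\<lambda>x. (a * u x + b * v x) * gjms k w x) = (\<lambda>x. a * (u x * gjms k w x) + b * (v x * gjms k w x))"
    by (simp add: algebra_simps)
  ultimately show ?thesis by (simp add: gjms_form_def)
qed

lemma gjms_form_quadratic:
  fixes u v :: "real^'n \<Rightarrow> real"
  assumes u: "u \<in> test_functions" and v: "v \<in> test_functions"
  shows "gjms_form k (\<lambda>x. a * u x + b * v x) (\<lambda>x. a * u x + b * v x)
    = a\<^sup>2 * gjms_form k u u + 2 * a * b * gjms_form k u v + b\<^sup>2 * gjms_form k v v"
proof -
  have w: "(\<lambda>x. a * u x + b * v x) \<in> test_functions" by (intro test_add test_cmult u v)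
  have "gjms_form k (\<lambda>x. a * u x + b * v x) z = a * gjms_form k u z + b * gjms_form k v z" if "z \<in> test_functions" for z
    by (rule gjms_form_lincomb_left[OF u v that])
  then show ?thesis
    using w u v gjms_form_symmetric[OF u w] gjms_form_symmetric[OF v w] gjms_form_symmetric[OF v u]
    by (simp add: power2_eq_square algebra_simps)
qed

lemma gjms_form_diff:
  fixes u v :: "real^'n \<Rightarrow> real"
  assumes "u \<in> test_functions" "v \<in> test_functions"
  shows "gjms_form k (\<lambda>x. u x - v x) (\<lambda>x. u x - v x)
    = gjms_form k u u - 2 * gjms_form k u v + gjms_form k v v"
  using gjms_form_quadratic[OF assms, of 1 "-1"] by simp

lemma gjms_form_coercive:
  "\<exists>c>0. \<forall>v\<in>test_functions. c * (sobolev_norm k (v :: real^'n \<Rightarrow> real))\<^sup>2 \<le> gjms_form k v v \<and>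
     c * (\<integral>x. (v x)\<^sup>2 \<partial>hyp_vol) \<le> gjms_form k v v"
proof -
  obtain c where c: "c > 0"
    "\<And>v. v \<in> test_functions \<Longrightarrow> c * (sobolev_norm k (v :: real^'n \<Rightarrow> real))\<^sup>2 \<le> gjms_form k v v"
    using gjms_coercive[OF N, of k] unfolding gjms_form_def by blast
  have "c * (\<integral>x. (v x)\<^sup>2 \<partial>hyp_vol) \<le> gjms_form k v v" if "v \<in> test_functions" for v :: "real^'n \<Rightarrow> real"
    using c(2)[OF that] mult_left_mono[OF sobolev_norm_L2[of v k], of c] c(1) by linarith
  then show ?thesis using c by blast
qed

lemma energy_solution_sobolev:
  fixes w :: "real^'n \<Rightarrow> real"
  assumes "energy_solution k f w"
  shows "w \<in> sobolev_space k"
proof -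
  obtain c where c: "c > 0"
    "\<And>v. v \<in> test_functions \<Longrightarrow> c * (sobolev_norm k (v :: real^'n \<Rightarrow> real))\<^sup>2 \<le> gjms_form k v v"
    using gjms_form_coercive by blast
  obtain \<phi> :: "nat \<Rightarrow> real^'n \<Rightarrow> real" where \<phi>: "\<And>n. \<phi> n \<in> test_functions"
    "\<And>e. e > 0 \<Longrightarrow> \<exists>n0. \<forall>m\<ge>n0. \<forall>n\<ge>n0. gjms_form k (\<lambda>x. \<phi> m x - \<phi> n x) (\<lambda>x. \<phi> m x - \<phi> n x) < e"
    "(\<lambda>n. \<integral>x. (\<phi> n x - w x)\<^sup>2 \<partial>hyp_vol) \<longlonglongrightarrow> 0"
    using assms unfolding energy_solution_def by blast
  have "\<exists>n0. \<forall>m\<ge>n0. \<forall>n\<ge>n0. sobolev_norm k (\<lambda>x. \<phi> m x - \<phi> n x) < e" if e: "e > 0" for e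
  proof -
    obtain n0 where n0: "\<And>m n. m \<ge> n0 \<Longrightarrow> n \<ge> n0 \<Longrightarrow> gjms_form k (\<lambda>x. \<phi> m x - \<phi> n x) (\<lambda>x. \<phi> m x - \<phi> n x) < c * e\<^sup>2"
      using \<phi>(2)[of "c * e\<^sup>2"] c e by auto
    have "sobolev_norm k (\<lambda>x. \<phi> m x - \<phi> n x) < e" if "m \<ge> n0" "n \<ge> n0" for m n
    proof -
      have "c * (sobolev_norm k (\<lambda>x. \<phi> m x - \<phi> n x))\<^sup>2 < c * e\<^sup>2"
        using c(2)[OF test_diff[OF \<phi>(1) \<phi>(1)], of m n] n0[OF that] by linarith
      then show ?thesis using c e by (simp add: power2_less_imp_less)
    qed
    then show ?thesis by blast
  qed
  with \<phi> show ?thesis using assms unfolding sobolev_space_def energy_solution_def by blast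
qed

text \<open>Linearity of the solution relation; it reduces the Lipschitz estimate for two solutions
  to the bound for one.\<close>

lemma energy_solution_diff:
  fixes w1 w2 f1 f2 :: "real^'n \<Rightarrow> real"
  assumes f: "f1 \<in> L2 hyp_vol" "f2 \<in> L2 hyp_vol"
    and s1: "energy_solution k f1 w1" and s2: "energy_solution k f2 w2"
  shows "energy_solution k (\<lambda>x. f1 x - f2 x) (\<lambda>x. w1 x - w2 x)"
proof -
  have w: "w1 \<in> L2 hyp_vol" "w2 \<in> L2 hyp_vol" using s1 s2 by (auto simp: energy_solution_def)
  obtain \<phi> :: "nat \<Rightarrow> real^'n \<Rightarrow> real" where \<phi>: "\<And>n. \<phi> n \<in> test_functions"
    "\<And>e. e > 0 \<Longrightarrow> \<exists>n0. \<forall>m\<ge>n0. \<forall>n\<ge>n0. gjms_form k (\<lambda>x. \<phi> m x - \<phi> n x) (\<lambda>x. \<phi> m x - \<phi> n x) < e"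
    "(\<lambda>n. \<integral>x. (\<phi> n x - w1 x)\<^sup>2 \<partial>hyp_vol) \<longlonglongrightarrow> 0"
    using s1 unfolding energy_solution_def by blast
  obtain \<psi> :: "nat \<Rightarrow> real^'n \<Rightarrow> real" where \<psi>: "\<And>n. \<psi> n \<in> test_functions"
    "\<And>e. e > 0 \<Longrightarrow> \<exists>n0. \<forall>m\<ge>n0. \<forall>n\<ge>n0. gjms_form k (\<lambda>x. \<psi> m x - \<psi> n x) (\<lambda>x. \<psi> m x - \<psi> n x) < e"
    "(\<lambda>n. \<integral>x. (\<psi> n x - w2 x)\<^sup>2 \<partial>hyp_vol) \<longlonglongrightarrow> 0"
    using s2 unfolding energy_solution_def by blast
  let ?\<chi> = "\<lambda>n x. \<phi> n x - \<psi> n x"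
  obtain c where c: "c > 0" "\<And>v. v \<in> test_functions \<Longrightarrow> c * (\<integral>x. (v x)\<^sup>2 \<partial>hyp_vol) \<le> gjms_form k (v :: real^'n \<Rightarrow> real) v"
    using gjms_form_coercive by blast
  have pos: "0 \<le> gjms_form k v v" if "v \<in> test_functions" for v :: "real^'n \<Rightarrow> real"
  proof -
    have "0 \<le> c * (\<integral>x. (v x)\<^sup>2 \<partial>hyp_vol)" using c(1) by simp
    also have "\<dots> \<le> gjms_form k v v" by (rule c(2)[OF that])
    finally show ?thesis .
  qed
  \<comment> \<open>The form of the sum is nonnegative, so the parallelogram identity bounds the
    form of the difference.\<close>
  have diff_le: "gjms_form k (\<lambda>x. u x - v x) (\<lambda>x. u x - v x) \<le> 2 * gjms_form k u u + 2 * gjms_form k v v"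
    if "u \<in> test_functions" "v \<in> test_functions" for u v :: "real^'n \<Rightarrow> real"
    using gjms_form_quadratic[OF that, of 1 1] gjms_form_quadratic[OF that, of 1 "-1"] pos[OF test_add[OF that]] by simp
  have "\<exists>n0. \<forall>m\<ge>n0. \<forall>n\<ge>n0. gjms_form k (\<lambda>x. ?\<chi> m x - ?\<chi> n x) (\<lambda>x. ?\<chi> m x - ?\<chi> n x) < e" if e: "e > 0" for e
  proof -
    obtain n1 n2 where n:
      "\<And>m n. m \<ge> n1 \<Longrightarrow> n \<ge> n1 \<Longrightarrow> gjms_form k (\<lambda>x. \<phi> m x - \<phi> n x) (\<lambda>x. \<phi> m x - \<phi> n x) < e / 4"
      "\<And>m n. m \<ge> n2 \<Longrightarrow> n \<ge> n2 \<Longrightarrow> gjms_form k (\<lambda>x. \<psi> m x - \<psi> n x) (\<lambda>x. \<psi> m x - \<psi> n x) < e / 4"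
      using \<phi>(2)[of "e/4"] \<psi>(2)[of "e/4"] e by fastforce
    have "gjms_form k (\<lambda>x. ?\<chi> m x - ?\<chi> n x) (\<lambda>x. ?\<chi> m x - ?\<chi> n x) < e" if "m \<ge> max n1 n2" "n \<ge> max n1 n2" for m n
    proof -
      have "(\<lambda>x. ?\<chi> m x - ?\<chi> n x) = (\<lambda>x. (\<phi> m x - \<phi> n x) - (\<psi> m x - \<psi> n x))" by auto
      then show ?thesis
        using diff_le[OF test_diff[OF \<phi>(1) \<phi>(1)] test_diff[OF \<psi>(1) \<psi>(1)], of m n m n] n(1)[of m n] n(2)[of m n] that
        by simp
    qed
    then show ?thesis by blast
  qed
  moreover have "(\<lambda>n. \<integral>x. (?\<chi> n x - (w1 x - w2 x))\<^sup>2 \<partial>hyp_vol) \<longlonglongrightarrow> 0"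
  proof (rule tendsto_sandwich[of "\<lambda>_. 0"])
    show "(\<lambda>n. 2 * (\<integral>x. (\<phi> n x - w1 x)\<^sup>2 \<partial>hyp_vol) + 2 * (\<integral>x. (\<psi> n x - w2 x)\<^sup>2 \<partial>hyp_vol)) \<longlonglongrightarrow> 0"
      using tendsto_add[OF tendsto_mult_left[OF \<phi>(3), of 2] tendsto_mult_left[OF \<psi>(3), of 2]] by simp
    have "(\<integral>x. (?\<chi> n x - (w1 x - w2 x))\<^sup>2 \<partial>hyp_vol)
        \<le> 2 * (\<integral>x. (\<phi> n x - w1 x)\<^sup>2 \<partial>hyp_vol) + 2 * (\<integral>x. (\<psi> n x - w2 x)\<^sup>2 \<partial>hyp_vol)" for n
    proof -
      have i: "integrable hyp_vol (\<lambda>x. (\<phi> n x - w1 x)\<^sup>2)" "integrable hyp_vol (\<lambda>x. (\<psi> n x - w2 x)\<^sup>2)"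
        by (intro L2_integrable L2_diff test_L2 \<phi> \<psi> w)+
      have "(\<integral>x. (?\<chi> n x - (w1 x - w2 x))\<^sup>2 \<partial>hyp_vol) \<le> (\<integral>x. 2 * (\<phi> n x - w1 x)\<^sup>2 + 2 * (\<psi> n x - w2 x)\<^sup>2 \<partial>hyp_vol)"
      proof (rule integral_mono)
        show "integrable hyp_vol (\<lambda>x. (?\<chi> n x - (w1 x - w2 x))\<^sup>2)"
          by (intro L2_integrable L2_diff test_L2 \<phi> \<psi> w)
        show "integrable hyp_vol (\<lambda>x. 2 * (\<phi> n x - w1 x)\<^sup>2 + 2 * (\<psi> n x - w2 x)\<^sup>2)" using i by simp
        show "(?\<chi> n x - (w1 x - w2 x))\<^sup>2 \<le> 2 * (\<phi> n x - w1 x)\<^sup>2 + 2 * (\<psi> n x - w2 x)\<^sup>2" for x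
          using zero_le_power2[of "(\<phi> n x - w1 x) + (\<psi> n x - w2 x)"]
          by (simp add: power2_eq_square algebra_simps)
      qed
      also have "\<dots> = 2 * (\<integral>x. (\<phi> n x - w1 x)\<^sup>2 \<partial>hyp_vol) + 2 * (\<integral>x. (\<psi> n x - w2 x)\<^sup>2 \<partial>hyp_vol)" using i by simp
      finally show ?thesis .
    qed
    then show "\<forall>\<^sub>F n in sequentially. (\<integral>x. (?\<chi> n x - (w1 x - w2 x))\<^sup>2 \<partial>hyp_vol)
        \<le> 2 * (\<integral>x. (\<phi> n x - w1 x)\<^sup>2 \<partial>hyp_vol) + 2 * (\<integral>x. (\<psi> n x - w2 x)\<^sup>2 \<partial>hyp_vol)" by simp
  qed auto
  moreover have "?\<chi> n \<in> test_functions" for n by (intro test_diff \<phi> \<psi>)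
  moreover have "(\<integral>x. (w1 x - w2 x) * gjms k v x \<partial>hyp_vol) = (\<integral>x. (f1 x - f2 x) * v x \<partial>hyp_vol)"
    if v: "v \<in> test_functions" for v
  proof -
    have "integrable hyp_vol (\<lambda>x. w1 x * gjms k v x)" "integrable hyp_vol (\<lambda>x. w2 x * gjms k v x)"
      "integrable hyp_vol (\<lambda>x. f1 x * v x)" "integrable hyp_vol (\<lambda>x. f2 x * v x)"
      by (intro L2_mult_integrable w f test_L2 test_gjms N v)+
    then show ?thesis using s1 s2 v by (simp add: energy_solution_def left_diff_distrib)
  qed
  ultimately show ?thesis using L2_diff[OF w] unfolding energy_solution_def
    by (intro conjI exI[of _ ?\<chi>]) blast+
qed

text \<open>Formally the equation is tested with \<open>w\<close> itself. As \<open>w\<close> is not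
  a test function, \<open>\<phi> n\<close> takes its place: the limit in \<open>m\<close> turns
  \<open>gjms_form k (\<phi> m) (\<phi> n)\<close> into the integral of \<open>f\<close> against
  \<open>\<phi> n\<close> by the equation, the limit in \<open>n\<close> bounds \<open>c\<close>
  times the squared norm of \<open>w\<close> by the integral of \<open>f\<close> against
  \<open>w\<close>, and Cauchy-Schwarz finishes.\<close>

lemma energy_solution_bound:
  "\<exists>C>0. \<forall>f w :: real^'n \<Rightarrow> real. f \<in> L2 hyp_vol \<longrightarrow> energy_solution k f w \<longrightarrow>
    (\<integral>x. (w x)\<^sup>2 \<partial>hyp_vol) \<le> C * (\<integral>x. (f x)\<^sup>2 \<partial>hyp_vol)"
proof -
  obtain c where c: "c > 0" "\<And>v. v \<in> test_functions \<Longrightarrow> c * (\<integral>x. (v x)\<^sup>2 \<partial>hyp_vol) \<le> gjms_form k (v :: real^'n \<Rightarrow> real) v"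
    using gjms_form_coercive by blast
  have "(\<integral>x. (w x)\<^sup>2 \<partial>hyp_vol) \<le> (1 / c\<^sup>2) * (\<integral>x. (f x)\<^sup>2 \<partial>hyp_vol)"
    if f: "f \<in> L2 hyp_vol" and s: "energy_solution k f w" for f w :: "real^'n \<Rightarrow> real"
  proof -
    have w: "w \<in> L2 hyp_vol" using s by (simp add: energy_solution_def)
    obtain \<phi> :: "nat \<Rightarrow> real^'n \<Rightarrow> real" where \<phi>: "\<And>n. \<phi> n \<in> test_functions"
      "\<And>e. e > 0 \<Longrightarrow> \<exists>n0. \<forall>m\<ge>n0. \<forall>n\<ge>n0. gjms_form k (\<lambda>x. \<phi> m x - \<phi> n x) (\<lambda>x. \<phi> m x - \<phi> n x) < e"
      "(\<lambda>n. \<integral>x. (\<phi> n x - w x)\<^sup>2 \<partial>hyp_vol) \<longlonglongrightarrow> 0"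
      using s unfolding energy_solution_def by blast
    let ?W = "\<integral>x. (w x)\<^sup>2 \<partial>hyp_vol" and ?p = "\<lambda>n. \<integral>x. (\<phi> n x)\<^sup>2 \<partial>hyp_vol"
      and ?q = "\<lambda>n. \<integral>x. f x * \<phi> n x \<partial>hyp_vol"
    have p: "?p \<longlonglongrightarrow> ?W" by (rule L2_tendsto_square[OF test_L2[OF \<phi>(1)] w \<phi>(3)])
    have q: "?q \<longlonglongrightarrow> (\<integral>x. f x * w x \<partial>hyp_vol)"
      using L2_tendsto_mult[OF test_L2[OF \<phi>(1)] w f \<phi>(3)] by (simp add: mult.commute)
    have "2 * c * ?W \<le> 2 * (\<integral>x. f x * w x \<partial>hyp_vol) + e" if e: "e > 0" for e
    proof -
      obtain n0 where n0: "\<And>m n. m \<ge> n0 \<Longrightarrow> n \<ge> n0 \<Longrightarrow> gjms_form k (\<lambda>x. \<phi> m x - \<phi> n x) (\<lambda>x. \<phi> m x - \<phi> n x) < e"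
        using \<phi>(2)[OF e] by blast
      have "c * ?p n \<le> 2 * ?q n - c * ?W + e" if n: "n \<ge> n0" for n
      proof (rule tendsto_lowerbound)
        show "(\<lambda>m. 2 * gjms_form k (\<phi> m) (\<phi> n) - c * ?p m + e) \<longlonglongrightarrow> 2 * ?q n - c * ?W + e"
        proof -
          have "(\<lambda>m. gjms_form k (\<phi> m) (\<phi> n)) \<longlonglongrightarrow> (\<integral>x. w x * gjms k (\<phi> n) x \<partial>hyp_vol)"
            unfolding gjms_form_def
            by (rule L2_tendsto_mult[OF test_L2[OF \<phi>(1)] w test_L2[OF test_gjms[OF N \<phi>(1)]] \<phi>(3)])
          also have "(\<integral>x. w x * gjms k (\<phi> n) x \<partial>hyp_vol) = ?q n"
            using s \<phi>(1) unfolding energy_solution_def by blast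
          finally show ?thesis by (intro tendsto_intros p)
        qed
        \<comment> \<open>Coercivity for \<open>\<phi> m\<close> and \<open>\<phi> n\<close>
          separately, with the mixed term recovered from the small form of their difference.\<close>
        have "c * ?p n \<le> 2 * gjms_form k (\<phi> m) (\<phi> n) - c * ?p m + e" if m: "m \<ge> n0" for m
          using c(2)[OF \<phi>(1), of n] c(2)[OF \<phi>(1), of m] n0[OF m n] gjms_form_diff[OF \<phi>(1) \<phi>(1), of m n] by linarith
        then show "\<forall>\<^sub>F m in sequentially. c * ?p n \<le> 2 * gjms_form k (\<phi> m) (\<phi> n) - c * ?p m + e"
          by (auto simp: eventually_sequentially)
      qed simp
      then have ev: "\<forall>\<^sub>F n in sequentially. c * ?p n \<le> 2 * ?q n - c * ?W + e"
        by (auto simp: eventually_sequentially)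
      have "c * ?W \<le> 2 * (\<integral>x. f x * w x \<partial>hyp_vol) - c * ?W + e"
        by (rule tendsto_le[OF _ _ _ ev]) (intro tendsto_intros p q trivial_limit_sequentially)+
      then show ?thesis by simp
    qed
    then have "2 * c * ?W \<le> 2 * (\<integral>x. f x * w x \<partial>hyp_vol)" by (rule field_le_epsilon)
    then have 1: "c * ?W \<le> (\<integral>x. f x * w x \<partial>hyp_vol)" by simp
    have W: "0 \<le> ?W" by simp
    then have "(c * ?W)\<^sup>2 \<le> (\<integral>x. f x * w x \<partial>hyp_vol)\<^sup>2" using 1 c(1) by (intro power_mono) auto
    also have "\<dots> \<le> (\<integral>x. (f x)\<^sup>2 \<partial>hyp_vol) * ?W" by (rule L2_Cauchy_Schwarz[OF f w])
    finally have "c\<^sup>2 * ?W * ?W \<le> (\<integral>x. (f x)\<^sup>2 \<partial>hyp_vol) * ?W" by (simp only: power_mult_distrib power2_eq_square[of ?W] mult.assoc)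
    then have pos: "c\<^sup>2 * ?W \<le> (\<integral>x. (f x)\<^sup>2 \<partial>hyp_vol)" if "?W > 0"
      by (rule mult_right_le_imp_le[OF _ that])
    have "c\<^sup>2 * ?W \<le> (\<integral>x. (f x)\<^sup>2 \<partial>hyp_vol)"
    proof (cases "?W > 0")
      case False
      then have "?W = 0" using W by linarith
      then show ?thesis by simp
    qed (rule pos)
    then show ?thesis using c(1) by (simp add: field_simps)
  qed
  moreover have "1 / c\<^sup>2 > 0" using c(1) by simp
  ultimately show ?thesis by blast
qed

text \<open>Minimizing sequences of the energy functional are Cauchy by the parallelogram law.\<close>

lemma energy_solution_exists:
  fixes f :: "real^'n \<Rightarrow> real"
  assumes f: "f \<in> L2 hyp_vol"
  shows "\<exists>w. energy_solution k f w"
proof -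
  obtain c where c: "c > 0" "\<And>v. v \<in> test_functions \<Longrightarrow> c * (\<integral>x. (v x)\<^sup>2 \<partial>hyp_vol) \<le> gjms_form k (v :: real^'n \<Rightarrow> real) v"
    using gjms_form_coercive by blast
  let ?F = "\<lambda>v. \<integral>x. f x * v x \<partial>hyp_vol"
  define J where "J v = gjms_form k v v - 2 * ?F v" for v :: "real^'n \<Rightarrow> real"
  have fv: "integrable hyp_vol (\<lambda>x. f x * v x)" if "v \<in> test_functions" for v
    by (intro L2_mult_integrable f test_L2 that)
  have F: "?F (\<lambda>x. a * u x + b * v x) = a * ?F u + b * ?F v" if "u \<in> test_functions" "v \<in> test_functions" for a b u v
  proof -
    have "(\<lambda>x. f x * (a * u x + b * v x)) = (\<lambda>x. a * (f x * u x) + b * (f x * v x))"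
      by (simp add: algebra_simps)
    then show ?thesis using fv that by simp
  qed
  \<comment> \<open>The square of \<open>c * v - f\<close> has nonnegative integral; this bounds the
    energy from below.\<close>
  have "- ((\<integral>x. (f x)\<^sup>2 \<partial>hyp_vol) / c) \<le> J v" if v: "v \<in> test_functions" for v
  proof -
    have "0 \<le> (\<integral>x. (c * v x - f x)\<^sup>2 \<partial>hyp_vol)" by simp
    also have "(\<lambda>x. (c * v x - f x)\<^sup>2) = (\<lambda>x. c\<^sup>2 * (v x)\<^sup>2 - 2 * c * (f x * v x) + (f x)\<^sup>2)"
      by (simp add: power2_eq_square algebra_simps)
    also have "(\<integral>x. c\<^sup>2 * (v x)\<^sup>2 - 2 * c * (f x * v x) + (f x)\<^sup>2 \<partial>hyp_vol)
        = c\<^sup>2 * (\<integral>x. (v x)\<^sup>2 \<partial>hyp_vol) - 2 * c * ?F v + (\<integral>x. (f x)\<^sup>2 \<partial>hyp_vol)"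
      using L2_integrable[OF test_L2[OF v]] fv[OF v] L2_integrable[OF f] by simp
    finally have "0 \<le> c * (c * (\<integral>x. (v x)\<^sup>2 \<partial>hyp_vol) - 2 * ?F v) + (\<integral>x. (f x)\<^sup>2 \<partial>hyp_vol)"
      by (simp add: power2_eq_square algebra_simps)
    also have "\<dots> \<le> c * J v + (\<integral>x. (f x)\<^sup>2 \<partial>hyp_vol)"
      unfolding J_def using c(1) c(2)[OF v] by (intro add_right_mono mult_left_mono) auto
    finally show ?thesis using c(1) by (simp add: field_simps)
  qed
  then have bdd: "bdd_below (J ` test_functions)" by (meson bdd_belowI2)
  define I where "I = Inf (J ` test_functions)"
  have I: "I \<le> J v" if "v \<in> test_functions" for v
    unfolding I_def using that bdd by (intro cInf_lower) auto
  have "\<exists>v\<in>test_functions. J v < I + 1 / real (Suc n)" for n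
    using cInf_lessD[of "J ` test_functions" "I + 1 / real (Suc n)"] test_zero unfolding I_def by auto
  then obtain \<phi> where \<phi>: "\<And>n. \<phi> n \<in> test_functions" "\<And>n. J (\<phi> n) < I + 1 / real (Suc n)" by metis
  have parallelogram: "gjms_form k (\<lambda>x. \<phi> m x - \<phi> n x) (\<lambda>x. \<phi> m x - \<phi> n x) \<le> 2 / real (Suc m) + 2 / real (Suc n)" for m n
  proof -
    have "I \<le> J (\<lambda>x. (1/2) * \<phi> m x + (1/2) * \<phi> n x)" by (intro I test_add test_cmult \<phi>)
    then have "4 * I \<le> gjms_form k (\<phi> m) (\<phi> m) + 2 * gjms_form k (\<phi> m) (\<phi> n) + gjms_form k (\<phi> n) (\<phi> n)
        - 4 * ?F (\<phi> m) - 4 * ?F (\<phi> n)"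
      unfolding J_def gjms_form_quadratic[OF \<phi>(1) \<phi>(1)] F[OF \<phi>(1) \<phi>(1)]
      by (simp add: power2_eq_square field_simps)
    then show ?thesis
      using \<phi>(2)[of m] \<phi>(2)[of n] unfolding gjms_form_diff[OF \<phi>(1) \<phi>(1)] J_def by simp
  qed
  have Cauchy: "\<exists>n0. \<forall>m\<ge>n0. \<forall>n\<ge>n0. gjms_form k (\<lambda>x. \<phi> m x - \<phi> n x) (\<lambda>x. \<phi> m x - \<phi> n x) < e" if e: "e > 0" for e
  proof -
    obtain n0 where n0: "inverse (real (Suc n0)) < e / 4" using reals_Archimedean[of "e/4"] e by auto
    have small: "2 / real (Suc n) < e / 2" if "n \<ge> n0" for n
    proof -
      have "inverse (real (Suc n)) \<le> inverse (real (Suc n0))" using that by (intro le_imp_inverse_le) auto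
      moreover have "2 / real (Suc n) = 2 * inverse (real (Suc n))" by (simp only: divide_inverse)
      ultimately show ?thesis using n0 by linarith
    qed
    have "gjms_form k (\<lambda>x. \<phi> m x - \<phi> n x) (\<lambda>x. \<phi> m x - \<phi> n x) < e" if "m \<ge> n0" "n \<ge> n0" for m n
      using parallelogram[of m n] small[OF that(1)] small[OF that(2)] by simp
    then show ?thesis by blast
  qed
  have L2C: "\<exists>n0. \<forall>m\<ge>n0. \<forall>n\<ge>n0. (\<integral>x. (\<phi> m x - \<phi> n x)\<^sup>2 \<partial>hyp_vol) < e" if e: "e > 0" for e
  proof -
    obtain n0 where n0: "\<And>m n. m \<ge> n0 \<Longrightarrow> n \<ge> n0 \<Longrightarrow> gjms_form k (\<lambda>x. \<phi> m x - \<phi> n x) (\<lambda>x. \<phi> m x - \<phi> n x) < c * e"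
      using Cauchy[of "c * e"] c e by auto
    have "(\<integral>x. (\<phi> m x - \<phi> n x)\<^sup>2 \<partial>hyp_vol) < e" if "m \<ge> n0" "n \<ge> n0" for m n
    proof -
      have "c * (\<integral>x. (\<phi> m x - \<phi> n x)\<^sup>2 \<partial>hyp_vol) < c * e"
        using c(2)[OF test_diff[OF \<phi>(1) \<phi>(1)], of m n] n0[OF that] by linarith
      then show ?thesis using c(1) by simp
    qed
    then show ?thesis by blast
  qed
  obtain w where w: "w \<in> L2 hyp_vol" "(\<lambda>n. \<integral>x. (\<phi> n x - w x)\<^sup>2 \<partial>hyp_vol) \<longlonglongrightarrow> 0"
    by (rule L2_complete[of \<phi> hyp_vol, OF test_L2[OF \<phi>(1)] L2C])
  have "(\<integral>x. w x * gjms k v x \<partial>hyp_vol) = ?F v" if v: "v \<in> test_functions" for v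
  proof -
    \<comment> \<open>Comparing \<open>J (\<phi> n)\<close> with the energy after a step
      \<open>t\<close> in direction \<open>v\<close> bounds the first variation \<open>d n\<close>.
      The added 1 keeps the divisor away from zero, and \<open>t = - d n / q\<close> minimises the
      resulting quadratic majorant.\<close>
    define q where "q = gjms_form k v v + 1"
    define d where "d n = gjms_form k (\<phi> n) v - ?F v" for n
    have "0 \<le> c * (\<integral>x. (v x)\<^sup>2 \<partial>hyp_vol)" using c(1) by simp
    then have q: "q \<ge> 1" using c(2)[OF v] by (simp add: q_def)
    have d: "(d n)\<^sup>2 \<le> q * (1 / real (Suc n))" for n
    proof -
      define t where "t = - d n / q"
      have dn: "gjms_form k (\<phi> n) v = d n + ?F v" and qq: "gjms_form k v v = q - 1"
        by (simp_all add: d_def q_def)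
      have "I \<le> J (\<lambda>x. 1 * \<phi> n x + t * v x)" by (intro I test_add test_cmult \<phi> v)
      also have "\<dots> = J (\<phi> n) + 2 * t * d n + t\<^sup>2 * (q - 1)"
        unfolding J_def gjms_form_quadratic[OF \<phi>(1) v] F[OF \<phi>(1) v]
        by (simp add: dn qq algebra_simps)
      also have "\<dots> \<le> J (\<phi> n) + 2 * t * d n + t\<^sup>2 * q"
        by (intro add_left_mono mult_left_mono) auto
      also have "\<dots> = J (\<phi> n) - (d n)\<^sup>2 / q"
        using q unfolding t_def by (simp add: field_simps power2_eq_square)
      finally have "(d n)\<^sup>2 / q \<le> 1 / real (Suc n)" using \<phi>(2)[of n] by linarith
      then show ?thesis using q by (simp add: field_simps)
    qed
    have "(\<lambda>n. (d n)\<^sup>2) \<longlonglongrightarrow> 0"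
    proof (rule tendsto_sandwich[of "\<lambda>_. 0"])
      show "(\<lambda>n. q * (1 / real (Suc n))) \<longlonglongrightarrow> 0"
        using tendsto_mult_left[OF LIMSEQ_inverse_real_of_nat, of q] by (simp only: divide_inverse mult_zero_right mult_1)
    qed (use d in auto)
    then have "d \<longlonglongrightarrow> 0" by (simp add: power_tendsto_0_iff)
    then have "(\<lambda>n. gjms_form k (\<phi> n) v) \<longlonglongrightarrow> ?F v" unfolding d_def by (simp add: LIM_zero_iff)
    moreover have "(\<lambda>n. gjms_form k (\<phi> n) v) \<longlonglongrightarrow> (\<integral>x. w x * gjms k v x \<partial>hyp_vol)"
      unfolding gjms_form_def
      by (rule L2_tendsto_mult[OF test_L2[OF \<phi>(1)] w(1) test_L2[OF test_gjms[OF N v]] w(2)])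
    ultimately show ?thesis by (rule LIMSEQ_unique[rotated])
  qed
  with w \<phi>(1) Cauchy show ?thesis unfolding energy_solution_def by blast
qed

end

section \<open>Conformal covariance\<close>

lemma smooth_lap_funpow: "smooth f \<Longrightarrow> smooth ((lap ^^ j) f)"
  by (induction j) (auto intro: smooth_lap)

lemma test_lap_funpow: "f \<in> test_functions \<Longrightarrow> (lap ^^ j) f \<in> test_functions"
  by (induction j) (auto intro: test_lap)

lemma lap_funpow_lincomb:
  fixes f g :: "real^'n::finite \<Rightarrow> real"
  assumes "smooth f" "smooth g"
  shows "(lap ^^ j) (\<lambda>x. a * f x + b * g x) = (\<lambda>x. a * (lap ^^ j) f x + b * (lap ^^ j) g x)"
  by (induction j) (simp_all add: lap_lincomb smooth_lap_funpow assms)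

lemma lap_mult:
  fixes f g :: "real^'n::finite \<Rightarrow> real"
  assumes f: "smooth f" and g: "smooth g"
  shows "lap (\<lambda>x. f x * g x) x = f x * lap g x + 2 * (\<Sum>i\<in>UNIV. partial_deriv i f x * partial_deriv i g x) + lap f x * g x"
proof -
  have p: "partial_deriv i (\<lambda>x. f x * g x) = (\<lambda>x. f x * partial_deriv i g x + partial_deriv i f x * g x)" for i
    by (auto simp: partial_deriv_mult smooth_differentiable f g)
  have "partial_deriv i (\<lambda>x. f x * partial_deriv i g x + partial_deriv i f x * g x) x
     = f x * partial_deriv i (partial_deriv i g) x + 2 * (partial_deriv i f x * partial_deriv i g x)
       + partial_deriv i (partial_deriv i f) x * g x" for i
    by (subst partial_deriv_add)
       (simp_all add: partial_deriv_mult smooth_differentiable smooth_partial smooth_mult f g)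
  then show ?thesis unfolding lap_def p
    by (simp add: sum.distrib sum_distrib_left sum_distrib_right)
qed

lemma lap_partial_deriv:
  assumes "smooth f"
  shows "lap (partial_deriv i f) x = partial_deriv i (lap f) x"
proof -
  have "partial_deriv j (partial_deriv j (partial_deriv i f)) = partial_deriv i (partial_deriv j (partial_deriv j f))" for j
  proof -
    have "partial_deriv j (partial_deriv i f) = partial_deriv i (partial_deriv j f)"
      using partial_deriv_commute[OF assms] by blast
    then show ?thesis using partial_deriv_commute[OF smooth_partial[OF assms]] by auto
  qed
  then show ?thesis unfolding lap_def[abs_def]
    by (subst partial_deriv_sum) (auto intro: smooth_differentiable smooth_partial assms)
qed

text \<open>The commutator of \<open>lap\<close> with the dilation field is \<open>2 * lap\<close>,
  the infinitesimal form of \<open>lap\<close> being homogeneous of degree -2.\<close>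

lemma lap_euler:
  fixes f :: "real^'n::finite \<Rightarrow> real"
  assumes f: "smooth f"
  shows "lap (euler f) = (\<lambda>x. euler (lap f) x + 2 * lap f x)"
proof
  fix x
  have l0: "lap (\<lambda>x. x $ i) x = 0" for i :: 'n
  proof -
    have "partial_deriv j (\<lambda>x. x $ i) = (\<lambda>x. if j = i then 1 else 0)" for j
      by (auto simp: partial_deriv_nth)
    then show ?thesis by (simp add: lap_def)
  qed
  have "partial_deriv i (euler f) = (\<lambda>x. \<Sum>j\<in>UNIV. partial_deriv i (\<lambda>x. x $ j * partial_deriv j f x) x)" for i
    unfolding euler_def[abs_def]
    by (intro ext partial_deriv_sum) (simp, rule smooth_differentiable[OF smooth_mult[OF smooth_nth smooth_partial[OF f]]])
  then have "lap (euler f) x = (\<Sum>i\<in>UNIV. \<Sum>j\<in>UNIV. partial_deriv i (partial_deriv i (\<lambda>x. x $ j * partial_deriv j f x)) x)"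
    unfolding lap_def
    by (intro sum.cong refl, simp only:, intro partial_deriv_sum)
       (simp, rule smooth_differentiable[OF smooth_partial[OF smooth_mult[OF smooth_nth smooth_partial[OF f]]]])
  also have "\<dots> = (\<Sum>j\<in>UNIV. lap (\<lambda>x. x $ j * partial_deriv j f x) x)"
    unfolding lap_def by (rule sum.swap)
  also have "\<dots> = (\<Sum>j\<in>UNIV. x $ j * partial_deriv j (lap f) x + 2 * partial_deriv j (partial_deriv j f) x)"
  proof (rule sum.cong[OF refl])
    fix j :: 'n
    have "(\<Sum>i\<in>UNIV. partial_deriv i (\<lambda>x. x $ j) x * partial_deriv i (partial_deriv j f) x) = partial_deriv j (partial_deriv j f) x"
      by (simp add: partial_deriv_nth if_distrib[of "\<lambda>t. t * _"] cong: if_cong)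
    then show "lap (\<lambda>x. x $ j * partial_deriv j f x) x = x $ j * partial_deriv j (lap f) x + 2 * partial_deriv j (partial_deriv j f) x"
      by (simp add: lap_mult[OF smooth_nth smooth_partial[OF f]] lap_partial_deriv[OF f] l0)
  qed
  finally show "lap (euler f) x = euler (lap f) x + 2 * lap f x"
    by (simp add: euler_def lap_def sum.distrib sum_distrib_left)
qed

lemma lap_funpow_euler:
  fixes f :: "real^'n::finite \<Rightarrow> real"
  assumes f: "smooth f"
  shows "(lap ^^ j) (euler f) = (\<lambda>x. euler ((lap ^^ j) f) x + 2 * real j * (lap ^^ j) f x)"
proof (induction j)
  case (Suc j)
  have "lap (\<lambda>x. 1 * euler ((lap ^^ j) f) x + (2 * real j) * (lap ^^ j) f x) =
    (\<lambda>x. 1 * lap (euler ((lap ^^ j) f)) x + (2 * real j) * lap ((lap ^^ j) f) x)"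
    by (intro lap_lincomb smooth_euler smooth_lap_funpow f)
  then show ?case
    by (simp add: Suc lap_euler smooth_lap_funpow f algebra_simps)
qed simp

text \<open>General constants \<open>A\<close> and \<open>B\<close> cover both quadratic factors
  that occur: \<open>rho\<close>, with \<open>A = 1/2\<close> and \<open>B = -1/2\<close>, and
  \<open>(norm x)\<^sup>2 + e\<close>, with \<open>A = e\<close> and \<open>B = 1\<close>.\<close>

lemma lap_quadratic_mult:
  fixes g :: "real^'n::finite \<Rightarrow> real"
  assumes g: "smooth g"
  shows "lap (\<lambda>x. (A + B * (norm x)\<^sup>2) * g x)
    = (\<lambda>x. (A + B * (norm x)\<^sup>2) * lap g x + 4 * B * euler g x + 2 * real CARD('n) * B * g x)"
proof
  fix x :: "real^'n"
  let ?s = "\<lambda>x::real^'n. A + B * (norm x)\<^sup>2"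
  have s: "smooth ?s" by (intro smooth_intros)
  have p: "partial_deriv i ?s = (\<lambda>x. 2 * B * x $ i)" for i
    by (auto simp: partial_deriv_add partial_deriv_cmult partial_deriv_norm_sq
        smooth_differentiable[OF smooth_norm_sq] smooth_differentiable[OF smooth_mult[OF smooth_const smooth_norm_sq]])
  have "partial_deriv i (\<lambda>x. 2 * B * x $ i) x = 2 * B" for i :: 'n
    by (simp add: partial_deriv_cmult smooth_differentiable[OF smooth_nth] partial_deriv_nth)
  then have "lap ?s x = 2 * real CARD('n) * B" by (simp add: lap_def p)
  then show "lap (\<lambda>x. ?s x * g x) x = ?s x * lap g x + 4 * B * euler g x + 2 * real CARD('n) * B * g x"
    unfolding lap_mult[OF s g] p by (simp add: euler_def sum_distrib_left mult_ac)
qed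

lemma lap_funpow_quadratic_lap:
  fixes h :: "real^'n::finite \<Rightarrow> real"
  assumes h: "smooth h"
  shows "(lap ^^ j) (\<lambda>x. (A + B * (norm x)\<^sup>2) * lap h x)
    = (\<lambda>x. (A + B * (norm x)\<^sup>2) * (lap ^^ Suc j) h x + 4 * B * real j * euler ((lap ^^ j) h) x
        + 2 * B * real j * (real CARD('n) + 2 * real j - 2) * (lap ^^ j) h x)"
proof (induction j)
  case (Suc j)
  let ?s = "\<lambda>x::real^'n. A + B * (norm x)\<^sup>2" and ?L = "\<lambda>i. (lap ^^ i) h"
  have L: "smooth (?L i)" for i by (rule smooth_lap_funpow[OF h])
  have sL: "smooth (\<lambda>x. ?s x * ?L (Suc j) x)" by (intro smooth_mult smooth_add smooth_const smooth_norm_sq L)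
  let ?b = "2 * B * real j * (real CARD('n) + 2 * real j - 2)"
  have "(lap ^^ Suc j) (\<lambda>x. ?s x * lap h x)
      = lap (\<lambda>x. 1 * (1 * (?s x * ?L (Suc j) x) + 4 * B * real j * euler (?L j) x) + ?b * ?L j x)"
    using Suc by simp
  also have "\<dots> = (\<lambda>x. 1 * (1 * lap (\<lambda>x. ?s x * ?L (Suc j) x) x + 4 * B * real j * lap (euler (?L j)) x) + ?b * lap (?L j) x)"
    unfolding lap_lincomb[OF smooth_add[OF smooth_mult[OF smooth_const sL] smooth_mult[OF smooth_const smooth_euler[OF L]]] L]
      lap_lincomb[OF sL smooth_euler[OF L]] ..
  also have "\<dots> = (\<lambda>x. ?s x * ?L (Suc (Suc j)) x + 4 * B * real (Suc j) * euler (?L (Suc j)) x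
        + 2 * B * real (Suc j) * (real CARD('n) + 2 * real (Suc j) - 2) * ?L (Suc j) x)"
    unfolding lap_quadratic_mult[OF L] lap_euler[OF L] by (auto simp: algebra_simps)
  finally show ?case .
qed simp

text \<open>The errors from moving the quadratic factor through \<open>lap ^^ j\<close> are
  themselves images under \<open>lap ^^ j\<close>, by \<open>lap_funpow_euler\<close>, so they can
  be subtracted beforehand; in dimension \<open>2 k\<close> the zeroth-order coefficient becomes a
  multiple of \<open>real j + 1 - real k\<close>. This one identity feeds both the conformal
  covariance and the computation of the fundamental solution.\<close>

lemma lap_funpow_quadratic_commutator:
  fixes h :: "real^'n::finite \<Rightarrow> real"
  assumes h: "smooth h" and N: "CARD('n) = 2 * k"
  shows "(lap ^^ j) (\<lambda>x. (A + B * (norm x)\<^sup>2) * lap h x - 4 * B * real j * euler h x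
        + 4 * B * real j * (real j + 1 - real k) * h x)
    = (\<lambda>x. (A + B * (norm x)\<^sup>2) * (lap ^^ Suc j) h x)"
proof -
  let ?s = "\<lambda>x::real^'n. A + B * (norm x)\<^sup>2"
  have sL: "smooth (\<lambda>x. ?s x * lap h x)" by (intro smooth_mult smooth_add smooth_const smooth_norm_sq smooth_lap h)
  note e = smooth_euler[OF h]
  have "(lap ^^ j) (\<lambda>x. 1 * (1 * (?s x * lap h x) + (- 4 * B * real j) * euler h x)
        + (4 * B * real j * (real j + 1 - real k)) * h x)
    = (\<lambda>x. 1 * (1 * (lap ^^ j) (\<lambda>x. ?s x * lap h x) x + (- 4 * B * real j) * (lap ^^ j) (euler h) x)
        + (4 * B * real j * (real j + 1 - real k)) * (lap ^^ j) h x)"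
    unfolding lap_funpow_lincomb[OF smooth_add[OF smooth_mult[OF smooth_const sL] smooth_mult[OF smooth_const e]] h]
      lap_funpow_lincomb[OF sL e] ..
  also have "\<dots> = (\<lambda>x. ?s x * (lap ^^ Suc j) h x)"
    unfolding lap_funpow_quadratic_lap[OF h] lap_funpow_euler[OF h] using N by (auto simp: algebra_simps)
  finally show ?thesis by simp
qed

section \<open>Powers of \<open>rho\<close> as conformal weights\<close>

lemma rho_quadratic: "rho x = 1 / 2 + (- 1 / 2) * (norm x)\<^sup>2"
  by (simp add: rho_def field_simps)

lemma euler_rho_mult:
  fixes g :: "real^'n::finite \<Rightarrow> real"
  assumes "smooth g"
  shows "euler (\<lambda>x. rho x * g x) x = rho x * euler g x - (1 - 2 * rho x) * g x"
proof -
  have R: "(\<Sum>i\<in>UNIV. x $ i * x $ i) = 1 - 2 * rho x"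
    unfolding norm_sq_sum[symmetric] by (simp add: rho_def field_simps)
  have "euler (\<lambda>x. rho x * g x) x = (\<Sum>i\<in>UNIV. rho x * (x $ i * partial_deriv i g x) - x $ i * x $ i * g x)"
    by (simp add: euler_def partial_deriv_mult smooth_differentiable[OF smooth_rho] smooth_differentiable[OF assms]
        partial_deriv_rho algebra_simps)
  also have "\<dots> = rho x * euler g x - (\<Sum>i\<in>UNIV. x $ i * x $ i) * g x"
    by (simp add: sum_subtractf euler_def sum_distrib_left sum_distrib_right)
  finally show ?thesis unfolding R .
qed

text \<open>Both sides carry an extra factor \<open>rho\<close>, so that the power
  \<open>a - 1\<close> produced by differentiation never appears and the induction can start at
  \<open>a = 0\<close>.\<close>

lemma euler_rho_power_mult:
  fixes h :: "real^'n::finite \<Rightarrow> real"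
  assumes h: "smooth h"
  shows "rho x * euler (\<lambda>x. rho x ^ a * h x) x = rho x ^ a * (rho x * euler h x - real a * (1 - 2 * rho x) * h x)"
proof (induction a)
  case (Suc a)
  have "euler (\<lambda>x. rho x ^ Suc a * h x) x = rho x * euler (\<lambda>x. rho x ^ a * h x) x - (1 - 2 * rho x) * (rho x ^ a * h x)"
    using euler_rho_mult[of "\<lambda>x. rho x ^ a * h x"] by (simp add: mult.assoc smooth_mult smooth_power smooth_rho h)
  then have "rho x * euler (\<lambda>x. rho x ^ Suc a * h x) x
      = rho x * (rho x * euler (\<lambda>x. rho x ^ a * h x) x) - rho x * ((1 - 2 * rho x) * (rho x ^ a * h x))"
    by (simp only: right_diff_distrib)
  then show ?case unfolding Suc by (simp add: algebra_simps)
qed simp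

text \<open>The left side is the Laplace-Beltrami operator on \<open>rho ^ a * h\<close>, by
  \<open>laplace_beltrami_eq\<close>: conjugation with \<open>rho ^ a\<close> changes only the
  first- and zeroth-order coefficients, and \<open>gjms_conformal_aux\<close> consumes exactly
  these.\<close>

lemma laplace_rho_power_mult:
  fixes h :: "real^'n::finite \<Rightarrow> real"
  assumes h: "smooth h"
  defines "N \<equiv> real CARD('n)"
  shows "(rho x)\<^sup>2 * lap (\<lambda>x. rho x ^ a * h x) x + (N - 2) * (rho x * euler (\<lambda>x. rho x ^ a * h x) x)
    = rho x ^ a * ((rho x)\<^sup>2 * lap h x + (N - 2 - 2 * real a) * rho x * euler h x
        + (real a * (real a + 1 - N) + real a * (N - 2 - 2 * real a) * rho x) * h x)"
proof (induction a)
  case (Suc a)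
  let ?g = "\<lambda>x. rho x ^ a * h x"
  have g: "smooth ?g" by (intro smooth_mult smooth_power smooth_rho h)
  have l: "lap (\<lambda>x. rho x ^ Suc a * h x) x = rho x * lap ?g x - 2 * euler ?g x - N * ?g x"
    using fun_cong[OF lap_quadratic_mult[OF g, of "1/2" "-1/2"], of x, folded rho_quadratic]
    by (simp add: mult.assoc N_def)
  have e: "euler (\<lambda>x. rho x ^ Suc a * h x) x = rho x * euler ?g x - (1 - 2 * rho x) * ?g x"
    using euler_rho_mult[OF g] by (simp add: mult.assoc)
  have "(rho x)\<^sup>2 * lap (\<lambda>x. rho x ^ Suc a * h x) x + (N - 2) * (rho x * euler (\<lambda>x. rho x ^ Suc a * h x) x)
    = rho x * ((rho x)\<^sup>2 * lap ?g x + (N - 2) * (rho x * euler ?g x)) - 2 * rho x * (rho x * euler ?g x)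
      - N * (rho x)\<^sup>2 * ?g x - (N - 2) * rho x * (1 - 2 * rho x) * ?g x"
    unfolding l e by (simp add: algebra_simps power2_eq_square)
  also have "\<dots> = rho x ^ Suc a * ((rho x)\<^sup>2 * lap h x + (N - 2 - 2 * real (Suc a)) * rho x * euler h x
        + (real (Suc a) * (real (Suc a) + 1 - N) + real (Suc a) * (N - 2 - 2 * real (Suc a)) * rho x) * h x)"
    unfolding Suc unfolding euler_rho_power_mult[OF h] by (simp add: algebra_simps power2_eq_square)
  finally show ?case .
qed simp

text \<open>The conformal weights of the partial products change with \<open>m\<close>: this is what makes the covariance of
  \<open>gjms k\<close> accessible to induction.\<close>

lemma gjms_conformal_aux:
  fixes h :: "real^'n::finite \<Rightarrow> real"
  assumes N: "CARD('n) = 2 * k" and k: "k \<ge> 1"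
  shows "m \<le> k \<Longrightarrow> h \<in> test_functions \<Longrightarrow>
    gjms m (\<lambda>x. rho x ^ (k - m) * h x) = (\<lambda>x. rho x ^ (k + m) * ((-1) ^ m * (lap ^^ m) h x))"
proof (induction m arbitrary: h)
  case (Suc j)
  define a where "a = k - Suc j"
  have ka: "k - j = Suc a" "real k = real a + 1 + real j" using Suc.prems(1) by (auto simp: a_def)
  note h = Suc.prems(2)
  have sh: "smooth h" by (rule test_smooth[OF h])
  let ?g = "\<lambda>x. rho x ^ a * h x"
  have g: "?g \<in> test_functions" by (intro test_mult smooth_power smooth_rho h)
  \<comment> \<open>The innermost factor raises the weight by one and leaves \<open>- h'\<close>.
    The coefficients of \<open>h'\<close> are those of
    \<open>lap_funpow_quadratic_commutator\<close> with \<open>B = -1/2\<close>, so the remaining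
    \<open>lap ^^ j\<close> collapses it to \<open>rho\<close> times
    \<open>(lap ^^ Suc j) h\<close>.\<close>
  define h' where "h' x = rho x * lap h x - 4 * (- 1 / 2) * real j * euler h x
        + 4 * (- 1 / 2) * real j * (real j + 1 - real k) * h x" for x
  have h': "h' \<in> test_functions"
    unfolding h'_def[abs_def] by (intro test_add test_diff test_cmult test_euler test_mult smooth_rho test_lap h)
  have N2: "CARD('n) \<ge> 2" using N k by simp
  have "P1 ?g x + real (Suc j) * real j * ?g x = rho x ^ (k - j) * (- h' x)" for x
    unfolding P1_def laplace_beltrami_eq[OF g N2] laplace_rho_power_mult[OF sh] ka(1) h'_def
    using ka(2) N by (simp add: field_simps power2_eq_square)
  then have "gjms (Suc j) ?g = gjms j (\<lambda>x. rho x ^ (k - j) * (- h' x))" by simp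
  also have "\<dots> = (\<lambda>x. rho x ^ (k + j) * ((-1) ^ j * (lap ^^ j) (\<lambda>x. - h' x) x))"
    using Suc.prems(1) test_cmult[OF h', of "-1"] by (intro Suc.IH) auto
  also have "(lap ^^ j) (\<lambda>x. - h' x) = (\<lambda>x. - (lap ^^ j) h' x)"
    using lap_funpow_lincomb[OF test_smooth[OF h'] test_smooth[OF h'], of j "-1" 0] by simp
  also have "(lap ^^ j) h' = (\<lambda>x. rho x * (lap ^^ Suc j) h x)"
    unfolding h'_def[abs_def] rho_quadratic by (rule lap_funpow_quadratic_commutator[OF sh N])
  finally show ?case by (simp add: a_def mult_ac)
qed simp

text \<open>At \<open>m = k\<close> the inner weight is \<open>rho ^ 0\<close>: in the critical
  dimension the operator acts on functions of conformal weight zero.\<close>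

lemma gjms_conformal:
  fixes h :: "real^'n::finite \<Rightarrow> real"
  assumes N: "CARD('n) = 2 * k" and k: "k \<ge> 1" and h: "h \<in> test_functions"
  shows "gjms k h = (\<lambda>x. rho x ^ CARD('n) * ((-1) ^ k * (lap ^^ k) h x))"
  using gjms_conformal_aux[OF N k le_refl h] N by (simp add: mult_2)

section \<open>Regularised fundamental solution of the polyharmonic operator\<close>

lemma lap_radial:
  fixes e :: real
  assumes S: "\<And>x::real^'n::finite. (norm x)\<^sup>2 + e \<in> S"
    and F: "\<And>t. t \<in> S \<Longrightarrow> (F has_real_derivative F' t) (at t)"
    and F': "\<And>t. t \<in> S \<Longrightarrow> (F' has_real_derivative F'' t) (at t)"
  shows "lap (\<lambda>x::real^'n. F ((norm x)\<^sup>2 + e)) x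
      = 4 * (norm x)\<^sup>2 * F'' ((norm x)\<^sup>2 + e) + 2 * real CARD('n) * F' ((norm x)\<^sup>2 + e)"
    and "euler (\<lambda>x::real^'n. F ((norm x)\<^sup>2 + e)) x = 2 * (norm x)\<^sup>2 * F' ((norm x)\<^sup>2 + e)"
proof -
  let ?s = "\<lambda>x::real^'n. (norm x)\<^sup>2 + e"
  have s: "?s differentiable at x" for x
    by (intro smooth_differentiable smooth_intros)
  have ps: "partial_deriv i ?s x = 2 * x $ i" for i x
    by (simp add: partial_deriv_add smooth_differentiable[OF smooth_norm_sq] partial_deriv_norm_sq)
  have p: "partial_deriv i (\<lambda>x. F (?s x)) = (\<lambda>x. 2 * (x $ i * F' (?s x)))" for i
    by (intro ext) (simp only: partial_deriv_chain[OF F[OF S] s] ps mult_ac)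
  have d': "(\<lambda>x. F' (?s x)) differentiable at x" for x
    using differentiable_compose[of F' ?s x UNIV] F'[OF S] s
    by (auto simp: has_field_derivative_def differentiable_def intro: differentiable_compose)
  have p': "partial_deriv i (\<lambda>x. F' (?s x)) x = 2 * x $ i * F'' (?s x)" for i x
    using partial_deriv_chain[OF F'[OF S] s] by (simp add: ps mult_ac)
  have "partial_deriv i (partial_deriv i (\<lambda>x. F (?s x))) x = 4 * (x $ i * x $ i) * F'' (?s x) + 2 * F' (?s x)" for i
  proof -
    have "(\<lambda>x. x $ i * F' (?s x)) differentiable at x"
      by (rule differentiable_mult[OF smooth_differentiable[OF smooth_nth] d'])
    then show ?thesis unfolding p
      by (subst partial_deriv_cmult, assumption, subst partial_deriv_mult[OF smooth_differentiable[OF smooth_nth] d'])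
         (simp add: p' partial_deriv_nth)
  qed
  then show "lap (\<lambda>x::real^'n. F (?s x)) x = 4 * (norm x)\<^sup>2 * F'' (?s x) + 2 * real CARD('n) * F' (?s x)"
    by (simp add: lap_def sum.distrib norm_sq_sum sum_distrib_left sum_distrib_right)
  show "euler (\<lambda>x::real^'n. F (?s x)) x = 2 * (norm x)\<^sup>2 * F' (?s x)"
    unfolding euler_def p by (simp add: norm_sq_sum sum_distrib_left sum_distrib_right mult_ac)
qed

text \<open>The logarithm with all its derivatives, in the indexed form that
  \<open>smooth_chain\<close> requires.\<close>

definition ln_derivs :: "nat \<Rightarrow> real \<Rightarrow> real" where
  "ln_derivs j t = (case j of 0 \<Rightarrow> ln t | Suc i \<Rightarrow> (-1) ^ i * fact i * inverse t ^ Suc i)"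

lemma ln_derivs_deriv:
  assumes "t > 0" shows "(ln_derivs j has_real_derivative ln_derivs (Suc j) t) (at t)"
proof (cases j)
  case 0
  have "ln_derivs 0 = ln" by (auto simp: ln_derivs_def)
  then show ?thesis using DERIV_ln[OF assms] 0 by (simp add: ln_derivs_def)
next
  case (Suc i)
  have "ln_derivs j = (\<lambda>t. (-1) ^ i * fact i * inverse t ^ Suc i)" by (auto simp: ln_derivs_def Suc)
  moreover have "((\<lambda>t. (-1) ^ i * fact i * inverse t ^ Suc i) has_real_derivative
      (-1) ^ i * fact i * ((1 + of_nat i) * (- (inverse t ^ Suc (Suc 0)) * inverse t ^ i))) (at t)"
    using assms by (intro DERIV_cmult DERIV_power_Suc DERIV_inverse) simp
  moreover have "(-1) ^ i * fact i * ((1 + of_nat i) * (- (inverse t ^ Suc (Suc 0)) * inverse t ^ i)) = ln_derivs (Suc j) t"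
    by (simp add: ln_derivs_def Suc algebra_simps)
  ultimately show ?thesis by simp
qed

lemma smooth_ln_radial:
  assumes "e > 0"
  shows "smooth (\<lambda>x::real^'n::finite. ln_derivs j ((norm x)\<^sup>2 + e))"
proof (rule smooth_chain[where S = "{0<..}" and \<phi> = ln_derivs and f = "\<lambda>x. (norm x)\<^sup>2 + e"])
  show "(norm x)\<^sup>2 + e \<in> {0<..}" for x :: "real^'n" using assms by (simp add: add_nonneg_pos)
  show "smooth (\<lambda>x::real^'n. (norm x)\<^sup>2 + e)" by (intro smooth_intros)
qed (simp add: ln_derivs_deriv)

lemma smooth_inverse_radial:
  assumes "e > 0"
  shows "smooth (\<lambda>x::real^'n::finite. inverse ((norm x)\<^sup>2 + e) ^ p)"
  using smooth_power[OF smooth_ln_radial[OF assms, of 1]] by (simp add: ln_derivs_def)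

lemma radial_inverse_power:
  fixes x :: "real^'n::finite"
  assumes e: "e > 0"
  shows "lap (\<lambda>x. inverse ((norm x)\<^sup>2 + e) ^ p) x =
      (4 * real p * (real p + 1) - 2 * real p * real CARD('n)) * inverse ((norm x)\<^sup>2 + e) ^ Suc p
      - 4 * e * real p * (real p + 1) * inverse ((norm x)\<^sup>2 + e) ^ Suc (Suc p)" (is ?lap)
    and "euler (\<lambda>x. inverse ((norm x)\<^sup>2 + e) ^ p) x =
      - 2 * real p * inverse ((norm x)\<^sup>2 + e) ^ p + 2 * e * real p * inverse ((norm x)\<^sup>2 + e) ^ Suc p" (is ?euler)
proof -
  define s where "s x = (norm x)\<^sup>2 + e" for x :: "real^'n"
  have s0: "s x > 0" for x :: "real^'n" using e by (simp add: s_def add_nonneg_pos)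
  have S: "(norm x)\<^sup>2 + e \<in> {0<..}" for x :: "real^'n" using s0 by (simp add: s_def)
  have D: "((\<lambda>t. inverse t ^ q) has_real_derivative - (real q * inverse t ^ Suc q)) (at t)" if "t \<in> {0<..}" for t q
  proof (cases q)
    case (Suc n)
    then show ?thesis using DERIV_power_Suc[OF DERIV_inverse, of t n] that by (simp add: algebra_simps)
  qed simp
  have D': "((\<lambda>t. - (real p * inverse t ^ Suc p)) has_real_derivative real p * (real p + 1) * inverse t ^ Suc (Suc p)) (at t)"
    if "t \<in> {0<..}" for t
    using DERIV_minus[OF DERIV_cmult[OF D[OF that, of "Suc p"], of "real p"]] by (simp add: algebra_simps)
  have n: "(norm x)\<^sup>2 = s x - e" by (simp add: s_def)
  have si: "s x * inverse (s x) = 1" using s0[of x] by simp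
  have L: "lap (\<lambda>x. inverse (s x) ^ p) x = 4 * (s x - e) * (real p * (real p + 1) * inverse (s x) ^ Suc (Suc p))
      + 2 * real CARD('n) * - (real p * inverse (s x) ^ Suc p)"
    "euler (\<lambda>x. inverse (s x) ^ p) x = 2 * (s x - e) * - (real p * inverse (s x) ^ Suc p)"
    using lap_radial[of e "{0<..}" "\<lambda>t. inverse t ^ p" "\<lambda>t. - (real p * inverse t ^ Suc p)"
        "\<lambda>t. real p * (real p + 1) * inverse t ^ Suc (Suc p)" x, OF S D D'] unfolding s_def by simp_all
  have "4 * (s x - e) * (real p * (real p + 1) * inverse (s x) ^ Suc (Suc p)) =
     4 * real p * (real p + 1) * ((s x * inverse (s x)) * inverse (s x) ^ Suc p)
      - 4 * e * real p * (real p + 1) * inverse (s x) ^ Suc (Suc p)"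
    by (simp add: algebra_simps)
  with L(1) show ?lap unfolding si s_def[symmetric] by (simp add: algebra_simps)
  have "2 * (s x - e) * - (real p * inverse (s x) ^ Suc p) =
     - 2 * real p * ((s x * inverse (s x)) * inverse (s x) ^ p) + 2 * e * real p * inverse (s x) ^ Suc p"
    by (simp add: algebra_simps)
  with L(2) show ?euler unfolding si s_def[symmetric] by simp
qed

text \<open>Induction through \<open>lap_funpow_quadratic_commutator\<close> with
  \<open>A = e\<close>, \<open>B = 1\<close>: the bracket there, applied to the power
  \<open>k - Suc j\<close>, collapses to a multiple of the power \<open>k - j\<close>, to which the
  induction hypothesis applies; dividing by the quadratic factor adds one to the final exponent. The
  constant does not depend on \<open>e\<close> and stays nonzero while \<open>j < k\<close>.\<close>

lemma polyharmonic_inverse_power: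
  assumes N: "CARD('n::finite) = 2 * k"
  shows "j < k \<Longrightarrow> \<exists>C\<noteq>0. \<forall>e>0. (lap ^^ j) (\<lambda>x::real^'n. inverse ((norm x)\<^sup>2 + e) ^ (k - j))
    = (\<lambda>x. C * e ^ j * inverse ((norm x)\<^sup>2 + e) ^ (k + j))"
proof (induction j)
  case 0
  show ?case by (rule exI[of _ 1]) simp
next
  case (Suc j)
  then obtain C where C: "C \<noteq> 0" "\<And>e. e > 0 \<Longrightarrow> (lap ^^ j) (\<lambda>x::real^'n. inverse ((norm x)\<^sup>2 + e) ^ (k - j))
    = (\<lambda>x. C * e ^ j * inverse ((norm x)\<^sup>2 + e) ^ (k + j))" by auto
  define p where "p = k - Suc j"
  have kp: "k - j = Suc p" "real k = real p + 1 + real j" "p > 0" using Suc.prems by (auto simp: p_def)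
  define D where "D = - 4 * real p * (real k + real j) * C"
  have D: "D \<noteq> 0" using C kp by (simp add: D_def)
  have "(lap ^^ Suc j) (\<lambda>x::real^'n. inverse ((norm x)\<^sup>2 + e) ^ p)
    = (\<lambda>x. D * e ^ Suc j * inverse ((norm x)\<^sup>2 + e) ^ (k + Suc j))" if e: "e > 0" for e
  proof
    fix x :: "real^'n"
    define s where "s x = (norm x)\<^sup>2 + e" for x :: "real^'n"
    have s0: "s x > 0" for x :: "real^'n" using e by (simp add: s_def add_nonneg_pos)
    let ?h = "\<lambda>x. inverse (s x) ^ p"
    have h: "smooth ?h" unfolding s_def by (rule smooth_inverse_radial[OF e])
    have hS: "smooth (\<lambda>x. inverse (s x) ^ Suc p)" unfolding s_def by (rule smooth_inverse_radial[OF e])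
    \<comment> \<open>In dimension \<open>2 k\<close> the terms with
      \<open>inverse (s x) ^ p\<close> cancel: with \<open>k = p + 1 + j\<close> their coefficients
      are \<open>- 4 * p * j\<close>, \<open>8 * p * j\<close> and
      \<open>- 4 * p * j\<close>.\<close>
    have br: "(e + 1 * (norm x)\<^sup>2) * lap ?h x - 4 * 1 * real j * euler ?h x + 4 * 1 * real j * (real j + 1 - real k) * ?h x
      = (- 4 * e * real p * (real k + real j)) * inverse (s x) ^ Suc p" for x
    proof -
      have n: "e + 1 * (norm x)\<^sup>2 = s x" by (simp add: s_def)
      have rp: "lap ?h x = (4 * real p * (real p + 1) - 2 * real p * real CARD('n)) * inverse (s x) ^ Suc p
          - 4 * e * real p * (real p + 1) * inverse (s x) ^ Suc (Suc p)"
        "euler ?h x = - 2 * real p * inverse (s x) ^ p + 2 * e * real p * inverse (s x) ^ Suc p"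
        unfolding s_def by (rule radial_inverse_power[OF e])+
      have si: "s x * inverse (s x) ^ Suc q = inverse (s x) ^ q" for q using s0[of x] by (simp add: field_simps)
      have "s x * lap ?h x = (4 * real p * (real p + 1) - 2 * real p * real CARD('n)) * (s x * inverse (s x) ^ Suc p)
          - 4 * e * real p * (real p + 1) * (s x * inverse (s x) ^ Suc (Suc p))"
        unfolding rp(1) by (simp add: algebra_simps)
      then have lapS: "s x * lap ?h x = 4 * real p * (real p + 1 - real k) * inverse (s x) ^ p
          - 4 * e * real p * (real p + 1) * inverse (s x) ^ Suc p"
        unfolding si using N by (simp add: algebra_simps)
      show ?thesis unfolding n lapS unfolding rp(2) kp(2)
        by (simp add: algebra_simps)
    qed
    have "s x * (lap ^^ Suc j) ?h x = (lap ^^ j) (\<lambda>x. (- 4 * e * real p * (real k + real j)) * inverse (s x) ^ Suc p) x"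
      using fun_cong[OF lap_funpow_quadratic_commutator[OF h N, of j e 1], of x] unfolding br
      by (simp add: s_def add.commute)
    also have "\<dots> = (- 4 * e * real p * (real k + real j)) * (lap ^^ j) (\<lambda>x. inverse (s x) ^ Suc p) x"
      using fun_cong[OF lap_funpow_lincomb[OF hS hS, of j "- 4 * e * real p * (real k + real j)" 0], of x] by simp
    also have "(lap ^^ j) (\<lambda>x. inverse (s x) ^ Suc p) x = C * e ^ j * inverse (s x) ^ (k + j)"
      using fun_cong[OF C(2)[OF e], of x] unfolding kp(1) s_def by simp
    finally have "s x * (lap ^^ Suc j) ?h x = D * e ^ Suc j * inverse (s x) ^ (k + j)"
      by (simp add: D_def mult_ac)
    then have "(lap ^^ Suc j) ?h x = D * e ^ Suc j * inverse (s x) ^ (k + Suc j)"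
      using s0[of x] by (simp add: field_simps del: funpow.simps)
    then show "(lap ^^ Suc j) (\<lambda>x. inverse ((norm x)\<^sup>2 + e) ^ p) x = D * e ^ Suc j * inverse ((norm x)\<^sup>2 + e) ^ (k + Suc j)"
      by (simp add: s_def del: funpow.simps)
  qed
  then show ?case using D unfolding p_def by blast
qed

text \<open>Up to a constant factor the right hand side is an approximate identity as \<open>e\<close> tends to 0, so
  \<open>ln (|x|\<^sup>2 + e)\<close> is a regularised fundamental solution.\<close>

lemma polyharmonic_ln:
  assumes N: "CARD('n::finite) = 2 * k" and k: "k \<ge> 1"
  shows "\<exists>C\<noteq>0. \<forall>e>0. (lap ^^ k) (\<lambda>x::real^'n. ln ((norm x)\<^sup>2 + e))
    = (\<lambda>x. C * e ^ k * inverse ((norm x)\<^sup>2 + e) ^ (2 * k))"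
proof -
  define j where "j = k - 1"
  have kj: "k = Suc j" using k by (simp add: j_def)
  obtain C where C: "C \<noteq> 0" "\<And>e. e > 0 \<Longrightarrow> (lap ^^ j) (\<lambda>x::real^'n. inverse ((norm x)\<^sup>2 + e) ^ (k - j))
    = (\<lambda>x. C * e ^ j * inverse ((norm x)\<^sup>2 + e) ^ (k + j))"
    using polyharmonic_inverse_power[OF N, of j] kj by auto
  define D where "D = 4 * (2 * real k - 1) * C"
  have D: "D \<noteq> 0" using C k by (simp add: D_def)
  have "(lap ^^ k) (\<lambda>x::real^'n. ln ((norm x)\<^sup>2 + e)) = (\<lambda>x. D * e ^ k * inverse ((norm x)\<^sup>2 + e) ^ (2 * k))"
    if e: "e > 0" for e
  proof
    fix x :: "real^'n"
    define s where "s x = (norm x)\<^sup>2 + e" for x :: "real^'n"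
    have s0: "s x > 0" for x :: "real^'n" using e by (simp add: s_def add_nonneg_pos)
    have S: "(norm x)\<^sup>2 + e \<in> {0<..}" for x :: "real^'n" using s0 by (simp add: s_def)
    let ?h = "\<lambda>x. ln (s x)"
    have h: "smooth ?h" using smooth_ln_radial[OF e, of 0] by (simp add: s_def ln_derivs_def)
    have i: "smooth (\<lambda>x. inverse (s x))" using smooth_inverse_radial[OF e, of 1] by (simp add: s_def)
    have d0: "(ln has_real_derivative inverse t) (at t)" if "t \<in> {0<..}" for t :: real
      using DERIV_ln[of t] that by simp
    have d1: "(inverse has_real_derivative - (inverse t)\<^sup>2) (at t)" if "t \<in> {0<..}" for t :: real
      using DERIV_inverse[of t] that by (simp add: power2_eq_square)
    have L: "lap ?h x = 4 * (s x - e) * - (inverse (s x))\<^sup>2 + 2 * real CARD('n) * inverse (s x)"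
      "euler ?h x = 2 * (s x - e) * inverse (s x)" for x
      using lap_radial[of e "{0<..}" ln inverse "\<lambda>t. - (inverse t)\<^sup>2" x, OF S d0 d1] unfolding s_def by simp_all
    \<comment> \<open>With \<open>j = k - 1\<close> the coefficient of the logarithm itself
      vanishes, so the bracket is a constant plus a multiple of
      \<open>inverse (s x)\<close>.\<close>
    have br: "(e + 1 * (norm x)\<^sup>2) * lap ?h x - 4 * 1 * real j * euler ?h x + 4 * 1 * real j * (real j + 1 - real k) * ?h x
      = (- 4 * real j) * 1 + (4 * e * (2 * real k - 1)) * inverse (s x)" for x
    proof -
      have n: "e + 1 * (norm x)\<^sup>2 = s x" by (simp add: s_def)
      show ?thesis unfolding n L N using s0[of x] by (simp add: kj field_simps power2_eq_square)
    qed
    \<comment> \<open>The constant disappears under \<open>lap ^^ j\<close> if \<open>j > 0\<close>,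
      and otherwise it carries the factor \<open>j\<close>.\<close>
    have c0: "(lap ^^ j) (\<lambda>x::real^'n. 1) x * real j = 0"
    proof (cases j)
      case (Suc i)
      have z: "lap (\<lambda>x::real^'n. c) = (\<lambda>x. 0)" for c
      proof -
        have "partial_deriv i (\<lambda>x::real^'n. c) = (\<lambda>x. 0)" for i c by auto
        then show ?thesis by (auto simp: lap_def)
      qed
      have "(lap ^^ i) (\<lambda>x::real^'n. 0) = (\<lambda>x. 0)" for i by (induction i) (simp_all add: z)
      then show ?thesis by (simp add: Suc funpow_swap1 z)
    qed simp
    have "s x * (lap ^^ k) ?h x = (lap ^^ j) (\<lambda>x. (- 4 * real j) * 1 + (4 * e * (2 * real k - 1)) * inverse (s x)) x"
      using fun_cong[OF lap_funpow_quadratic_commutator[OF h N, of j e 1], of x] unfolding br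
      by (simp add: s_def add.commute kj)
    also have "\<dots> = (4 * e * (2 * real k - 1)) * (lap ^^ j) (\<lambda>x. inverse (s x)) x"
      unfolding lap_funpow_lincomb[OF smooth_const i] using c0 by (auto simp: mult.commute)
    also have "(lap ^^ j) (\<lambda>x. inverse (s x)) x = C * e ^ j * inverse (s x) ^ (k + j)"
      using fun_cong[OF C(2)[OF e], of x] unfolding s_def by (simp add: kj)
    finally have "s x * (lap ^^ k) ?h x = D * e ^ k * inverse (s x) ^ (k + j)"
      by (simp add: D_def kj mult_ac)
    then have "(lap ^^ k) ?h x = D * e ^ k * inverse (s x) ^ Suc (k + j)"
      using s0[of x] by (simp add: field_simps)
    moreover have k2: "2 * k = Suc (k + j)" by (simp add: kj)
    ultimately have "(lap ^^ k) ?h x = D * e ^ k * inverse (s x) ^ (2 * k)"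
      unfolding k2 by simp
    then show "(lap ^^ k) (\<lambda>x. ln ((norm x)\<^sup>2 + e)) x = D * e ^ k * inverse ((norm x)\<^sup>2 + e) ^ (2 * k)"
      by (simp add: s_def)
  qed
  then show ?thesis using D by blast
qed

section \<open>A smooth regularisation of the logarithm\<close>

text \<open>With \<open>u = 1 / s\<close>, differentiating \<open>P u * exp (- u)\<close> in
  \<open>s\<close> multiplies by \<open>u\<^sup>2\<close> and replaces \<open>P\<close> by
  \<open>P - P'\<close>; \<open>[:0, 0, 1:]\<close> is the monomial of degree 2.\<close>

fun flat_poly :: "nat \<Rightarrow> real poly" where
  "flat_poly 0 = 1"
| "flat_poly (Suc j) = [:0, 0, 1:] * (flat_poly j - pderiv (flat_poly j))"

text \<open>\<open>flat j\<close> is the \<open>j\<close>-th derivative of the function \<open>exp (- 1 / s)\<close>, extended by zero to \<open>s \<le> 0\<close>.\<close>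

definition flat :: "nat \<Rightarrow> real \<Rightarrow> real" where
  "flat j s = (if s > 0 then poly (flat_poly j) (inverse s) * exp (- inverse s) else 0)"

lemma poly_exp_tendsto_0:
  fixes p :: "real poly"
  shows "((\<lambda>u. poly p u * exp (- u)) \<longlongrightarrow> 0) at_top"
proof -
  have "((\<lambda>u::real. \<Sum>i\<le>degree p. coeff p i * (u ^ i / exp u)) \<longlongrightarrow> (\<Sum>i\<le>degree p. coeff p i * 0)) at_top"
    by (intro tendsto_sum tendsto_mult tendsto_const tendsto_power_div_exp_0)
  moreover have "(\<lambda>u. poly p u * exp (- u)) = (\<lambda>u::real. \<Sum>i\<le>degree p. coeff p i * (u ^ i / exp u))"
    by (auto simp: poly_altdef sum_distrib_right exp_minus divide_inverse mult.assoc)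
  ultimately show ?thesis by simp
qed

text \<open>The critical point is \<open>s = 0\<close>: there the difference quotient from the right
  is a polynomial in \<open>1 / h\<close> times \<open>exp (- 1 / h)\<close>, which tends to 0, and
  \<open>flat j\<close> is 0 on the left.\<close>

lemma flat_deriv: "(flat j has_real_derivative flat (Suc j) s) (at s)"
proof -
  consider "s > 0" | "s < 0" | "s = 0" by linarith
  then show ?thesis
  proof cases
    case 1
    let ?p = "flat_poly j"
    have "((\<lambda>s. poly ?p (inverse s) * exp (- inverse s)) has_real_derivative
        poly ?p (inverse s) * (exp (- inverse s) * - (- (inverse s ^ Suc (Suc 0))))
          + (poly (pderiv ?p) (inverse s) * - (inverse s ^ Suc (Suc 0))) * exp (- inverse s)) (at s)"
      using 1 by (intro DERIV_mult' DERIV_fun_exp DERIV_minus DERIV_inverse DERIV_chain2[OF poly_DERIV]) auto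
    moreover have "poly ?p (inverse s) * (exp (- inverse s) * - (- (inverse s ^ Suc (Suc 0))))
          + (poly (pderiv ?p) (inverse s) * - (inverse s ^ Suc (Suc 0))) * exp (- inverse s) = flat (Suc j) s"
      using 1 by (simp add: flat_def algebra_simps)
    ultimately have "((\<lambda>s. poly ?p (inverse s) * exp (- inverse s)) has_real_derivative flat (Suc j) s) (at s)" by simp
    then show ?thesis
      by (rule has_field_derivative_transform_within_open[of _ _ _ "{0<..}"]) (use 1 in \<open>auto simp: flat_def\<close>)
  next
    case 2
    have "((\<lambda>s. 0) has_real_derivative flat (Suc j) s) (at s)" using 2 by (simp add: flat_def)
    then show ?thesis
      by (rule has_field_derivative_transform_within_open[of _ _ _ "{..<0}"]) (use 2 in \<open>auto simp: flat_def\<close>)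
  next
    case 3
    have "((\<lambda>h. flat j h / h) \<longlongrightarrow> 0) (at_right 0)"
    proof -
      have "((\<lambda>h. poly ([:0, 1:] * flat_poly j) (inverse h) * exp (- inverse h)) \<longlongrightarrow> 0) (at_right (0::real))"
        by (rule filterlim_compose[OF poly_exp_tendsto_0 filterlim_inverse_at_top_right])
      moreover have "\<forall>\<^sub>F h in at_right 0. poly ([:0, 1:] * flat_poly j) (inverse h) * exp (- inverse h) = flat j h / h"
        by (auto simp: eventually_at_right_field flat_def divide_inverse intro!: exI[of _ 1])
      ultimately show ?thesis by (rule Lim_transform_eventually)
    qed
    moreover have "((\<lambda>h. flat j h / h) \<longlongrightarrow> 0) (at_left 0)"
    proof (rule Lim_transform_eventually[OF tendsto_const])
      show "\<forall>\<^sub>F h in at_left 0. 0 = flat j h / h"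
        by (auto simp: eventually_at_left_field flat_def intro!: exI[of _ "-1"])
    qed
    ultimately have "((\<lambda>h. flat j h / h) \<longlongrightarrow> 0) (at 0)" by (simp add: filterlim_split_at)
    then show ?thesis unfolding 3 DERIV_def by (simp add: flat_def)
  qed
qed

lemma flat_pos: "s > 0 \<Longrightarrow> flat 0 s > 0"
  by (simp add: flat_def)

lemma flat_nonneg: "flat 0 s \<ge> 0"
  by (simp add: flat_def)

lemma continuous_flat: "continuous_on A (flat j)"
  by (intro continuous_at_imp_continuous_on ballI DERIV_isCont[OF flat_deriv])

text \<open>The index \<open>a\<close> will be the regularisation parameter, in which all bounds have to be uniform.\<close>

fun unif_Ck :: "nat \<Rightarrow> ('i \<Rightarrow> real^'n::finite \<Rightarrow> real) \<Rightarrow> bool" where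
  "unif_Ck 0 g \<longleftrightarrow> (\<exists>C. \<forall>a. \<forall>x\<in>cball 0 1. \<bar>g a x\<bar> \<le> C)"
| "unif_Ck (Suc m) g \<longleftrightarrow> (\<exists>C. \<forall>a. \<forall>x\<in>cball 0 1. \<bar>g a x\<bar> \<le> C) \<and>
     (\<forall>a x. g a differentiable at x) \<and> (\<forall>i. unif_Ck m (\<lambda>a. partial_deriv i (g a)))"

lemma unif_Ck_0: "unif_Ck m g \<Longrightarrow> unif_Ck 0 g"
  by (cases m) auto

lemma unif_Ck_SucD: "unif_Ck (Suc m) g \<Longrightarrow> unif_Ck m g"
proof (induction m arbitrary: g)
  case (Suc m)
  then show ?case by (metis unif_Ck.simps(2))
qed auto

lemma unif_Ck_0_I: "(\<And>a x. x \<in> cball 0 1 \<Longrightarrow> \<bar>g a x\<bar> \<le> C) \<Longrightarrow> unif_Ck 0 g"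
  unfolding unif_Ck.simps by blast

lemma unif_Ck_0_E:
  assumes "unif_Ck 0 g" obtains C where "\<And>a x. x \<in> cball 0 1 \<Longrightarrow> \<bar>g a x\<bar> \<le> C"
  using assms unfolding unif_Ck.simps by blast

lemma unif_Ck_SucI:
  "unif_Ck 0 g \<Longrightarrow> (\<And>a x. g a differentiable at x) \<Longrightarrow> (\<And>i. unif_Ck m (\<lambda>a. partial_deriv i (g a))) \<Longrightarrow> unif_Ck (Suc m) g"
  unfolding unif_Ck.simps by blast

lemma unif_Ck_0_add:
  assumes "unif_Ck 0 f" "unif_Ck 0 g" shows "unif_Ck 0 (\<lambda>a x. f a x + g a x)"
proof -
  obtain C where C: "\<And>a x. x \<in> cball 0 1 \<Longrightarrow> \<bar>f a x\<bar> \<le> C" using unif_Ck_0_E[OF assms(1)] by blast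
  obtain D where D: "\<And>a x. x \<in> cball 0 1 \<Longrightarrow> \<bar>g a x\<bar> \<le> D" using unif_Ck_0_E[OF assms(2)] by blast
  have "\<bar>f a x + g a x\<bar> \<le> C + D" if "x \<in> cball 0 1" for a x
    using abs_triangle_ineq[of "f a x" "g a x"] C[OF that, of a] D[OF that, of a] by linarith
  then show ?thesis by (rule unif_Ck_0_I)
qed

lemma unif_Ck_0_mult:
  assumes "unif_Ck 0 f" "unif_Ck 0 g" shows "unif_Ck 0 (\<lambda>a x. f a x * g a x)"
proof -
  obtain C where C: "\<And>a x. x \<in> cball 0 1 \<Longrightarrow> \<bar>f a x\<bar> \<le> C" using unif_Ck_0_E[OF assms(1)] by blast
  obtain D where D: "\<And>a x. x \<in> cball 0 1 \<Longrightarrow> \<bar>g a x\<bar> \<le> D" using unif_Ck_0_E[OF assms(2)] by blast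
  have "\<bar>f a x * g a x\<bar> \<le> C * D" if "x \<in> cball 0 1" for a x
    using C[OF that, of a] D[OF that, of a] unfolding abs_mult by (intro mult_mono) auto
  then show ?thesis by (rule unif_Ck_0_I)
qed

lemma unif_Ck_add: "unif_Ck m f \<Longrightarrow> unif_Ck m g \<Longrightarrow> unif_Ck m (\<lambda>a x. f a x + g a x)"
proof (induction m arbitrary: f g)
  case (Suc m)
  have "(\<lambda>a. partial_deriv i (\<lambda>x. f a x + g a x)) = (\<lambda>a x. partial_deriv i (f a) x + partial_deriv i (g a) x)" for i
    using Suc.prems by (intro ext) (simp add: partial_deriv_add)
  then show ?case using Suc unif_Ck_0_add[OF unif_Ck_0[OF Suc.prems(1)] unif_Ck_0[OF Suc.prems(2)]]
    by (intro unif_Ck_SucI) auto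
qed (rule unif_Ck_0_add)

lemma unif_Ck_mult: "unif_Ck m f \<Longrightarrow> unif_Ck m g \<Longrightarrow> unif_Ck m (\<lambda>a x. f a x * g a x)"
proof (induction m arbitrary: f g)
  case (Suc m)
  have "(\<lambda>a. partial_deriv i (\<lambda>x. f a x * g a x)) = (\<lambda>a x. f a x * partial_deriv i (g a) x + partial_deriv i (f a) x * g a x)" for i
    using Suc.prems by (intro ext) (simp add: partial_deriv_mult)
  moreover have "unif_Ck m (\<lambda>a x. f a x * partial_deriv i (g a) x + partial_deriv i (f a) x * g a x)" for i
    using Suc.prems unif_Ck_SucD[OF Suc.prems(1)] unif_Ck_SucD[OF Suc.prems(2)]
    by (intro unif_Ck_add Suc.IH) auto
  ultimately show ?case using Suc.prems unif_Ck_0_mult[OF unif_Ck_0[OF Suc.prems(1)] unif_Ck_0[OF Suc.prems(2)]]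
    by (intro unif_Ck_SucI) auto
qed (rule unif_Ck_0_mult)

lemma unif_Ck_smooth: "smooth f \<Longrightarrow> unif_Ck m (\<lambda>_. f)"
proof (induction m arbitrary: f)
  case 0
  have "bounded (f ` cball 0 1)"
    by (intro compact_imp_bounded compact_continuous_image smooth_continuous 0 compact_cball)
  then show ?case unfolding bounded_iff by auto
next
  case (Suc m)
  have "bounded (f ` cball 0 1)"
    by (intro compact_imp_bounded compact_continuous_image smooth_continuous Suc compact_cball)
  then have "unif_Ck 0 (\<lambda>_. f)" unfolding bounded_iff by auto
  then show ?case using Suc smooth_partial smooth_differentiable by auto
qed

lemma unif_Ck_param:
  assumes "\<And>a. \<bar>c a\<bar> \<le> C" shows "unif_Ck m (\<lambda>a (x::real^'n::finite). c a)"
proof (cases m)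
  case 0
  then show ?thesis using assms by auto
next
  case (Suc m')
  have "(\<lambda>a. partial_deriv i (\<lambda>x::real^'n. c a)) = (\<lambda>a x. 0)" for i
    by (intro ext) (rule partial_deriv_const)
  then show ?thesis using assms unif_Ck_smooth[OF smooth_const, of m' 0] by (auto simp: Suc)
qed

text \<open>On the closed unit ball all inner values lie in one compact set \<open>K\<close>,
  independent of the index; each \<open>\<phi> j\<close> is continuous there, hence bounded, and
  this supplies the uniform constants.\<close>

lemma unif_Ck_chain:
  assumes K: "compact K" "\<And>a x. x \<in> cball 0 1 \<Longrightarrow> f a x \<in> K" "\<And>j. continuous_on K (\<phi> j)"
    and d: "\<And>j a x. (\<phi> j has_real_derivative \<phi> (Suc j) (f a x)) (at (f a x))"
  shows "unif_Ck m f \<Longrightarrow> unif_Ck m (\<lambda>a x. \<phi> j (f a x))"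
proof (induction m arbitrary: j)
  case 0
  have "bounded (\<phi> j ` K)" by (intro compact_imp_bounded compact_continuous_image K)
  then obtain B where B: "\<And>t. t \<in> K \<Longrightarrow> \<bar>\<phi> j t\<bar> \<le> B" unfolding bounded_iff by auto
  show ?case by (rule unif_Ck_0_I[of _ B]) (intro B K(2))
next
  case (Suc m)
  have "bounded (\<phi> j ` K)" by (intro compact_imp_bounded compact_continuous_image K)
  then obtain B where B: "\<And>t. t \<in> K \<Longrightarrow> \<bar>\<phi> j t\<bar> \<le> B" unfolding bounded_iff by auto
  have "unif_Ck 0 (\<lambda>a x. \<phi> j (f a x))" by (rule unif_Ck_0_I[of _ B]) (intro B K(2))
  moreover have "(\<lambda>x. \<phi> j (f a x)) differentiable at x" for a x
  proof -
    have "f a differentiable at x" using Suc.prems by simp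
    moreover have "\<phi> j differentiable at (f a x)"
      using d[of j a x] unfolding has_field_derivative_def differentiable_def by blast
    ultimately show ?thesis using differentiable_chain_at[of "f a" x "\<phi> j"] by (simp add: o_def)
  qed
  moreover have "(\<lambda>a. partial_deriv i (\<lambda>x. \<phi> j (f a x))) = (\<lambda>a x. \<phi> (Suc j) (f a x) * partial_deriv i (f a) x)" for i
    using Suc.prems d by (intro ext partial_deriv_chain) auto
  moreover have "unif_Ck m (\<lambda>a x. \<phi> (Suc j) (f a x) * partial_deriv i (f a) x)" for i
    using Suc.prems unif_Ck_SucD[OF Suc.prems] by (intro unif_Ck_mult Suc.IH) auto
  ultimately show ?case by (intro unif_Ck_SucI) auto
qed

lemma unif_Ck_lap:
  assumes "unif_Ck (Suc (Suc m)) f" shows "unif_Ck m (\<lambda>a. lap (f a))"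
proof -
  have "unif_Ck m (\<lambda>a x. \<Sum>i\<in>A. partial_deriv i (partial_deriv i (f a)) x)" for A
  proof (induction A rule: infinite_finite_induct)
    case (insert i A)
    have "unif_Ck m (\<lambda>a. partial_deriv i (partial_deriv i (f a)))" using assms by simp
    from unif_Ck_add[OF this insert(3)] show ?case using insert(1,2) by simp
  qed (simp_all add: unif_Ck_smooth smooth_const)
  then show ?thesis unfolding lap_def[abs_def] .
qed

lemma unif_Ck_lap_funpow: "unif_Ck (2 * j + m) f \<Longrightarrow> unif_Ck m (\<lambda>a. (lap ^^ j) (f a))"
proof (induction j arbitrary: m)
  case (Suc j)
  have "unif_Ck (Suc (Suc m)) (\<lambda>a. (lap ^^ j) (f a))" using Suc.prems by (intro Suc.IH) (simp del: unif_Ck.simps)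
  then show ?case using unif_Ck_lap[of m "\<lambda>a. (lap ^^ j) (f a)"] by simp
qed simp


text \<open>The added term is positive for \<open>s < 1 / 4\<close> and vanishes to infinite order
  at \<open>1 / 4\<close>, so the identity is lifted away from 0 near \<open>s = 0\<close> without
  losing smoothness. Its logarithm is a smooth substitute for \<open>ln s\<close> near the pole and
  equal to it beyond \<open>1 / 4\<close>.\<close>

definition pos_reg :: "real \<Rightarrow> real" where
  "pos_reg s = s + flat 0 (1 / 4 - s)"

lemma pos_reg_pos: "s \<ge> 0 \<Longrightarrow> pos_reg s > 0"
  using flat_pos[of "1 / 4 - s"] flat_nonneg[of "1 / 4 - s"]
  by (cases "s = 0") (auto simp: pos_reg_def intro: add_pos_nonneg)

lemma pos_reg_eq: "s \<ge> 1 / 4 \<Longrightarrow> pos_reg s = s"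
  by (simp add: pos_reg_def flat_def)

lemma continuous_pos_reg: "continuous_on A pos_reg"
proof -
  have "continuous_on A (\<lambda>s. s + flat 0 (1 / 4 - s))"
    by (intro continuous_intros continuous_on_compose2[OF continuous_flat[of UNIV 0]]) auto
  then show ?thesis by (simp add: pos_reg_def[abs_def])
qed

lemma smooth_pos_reg: "smooth (\<lambda>x::real^'n::finite. pos_reg ((norm x)\<^sup>2 + e))"
proof -
  have "smooth (\<lambda>x::real^'n. flat 0 (1 / 4 - ((norm x)\<^sup>2 + e)))"
    by (rule smooth_chain[where S = UNIV and \<phi> = flat and f = "\<lambda>x. 1 / 4 - ((norm x)\<^sup>2 + e)"])
       (auto intro: flat_deriv intro!: smooth_diff smooth_add smooth_const smooth_norm_sq)
  then show ?thesis unfolding pos_reg_def by (intro smooth_add smooth_const smooth_norm_sq)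
qed

lemma smooth_ln_pos_reg:
  assumes "e \<ge> 0" shows "smooth (\<lambda>x::real^'n::finite. ln (pos_reg ((norm x)\<^sup>2 + e)))"
proof -
  have "smooth (\<lambda>x::real^'n. ln_derivs 0 (pos_reg ((norm x)\<^sup>2 + e)))"
    by (rule smooth_chain[where S = "{0<..}" and \<phi> = ln_derivs and f = "\<lambda>x. pos_reg ((norm x)\<^sup>2 + e)"])
       (use assms in \<open>auto intro: ln_derivs_deriv pos_reg_pos smooth_pos_reg\<close>)
  then show ?thesis by (simp add: ln_derivs_def)
qed

text \<open>The parameter only shifts the argument, which stays in \<open>{0..2}\<close>; on this
  interval \<open>pos_reg\<close> is positive, hence bounded away from 0 by compactness. The bounds
  therefore survive \<open>e n\<close> tending to 0, unlike those for
  \<open>ln ((norm x)\<^sup>2 + e n)\<close>.\<close>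

lemma unif_Ck_ln_pos_reg:
  assumes e: "\<And>n::nat. 0 \<le> e n \<and> e n \<le> 1"
  shows "unif_Ck m (\<lambda>n (x::real^'n::finite). ln (pos_reg ((norm x)\<^sup>2 + e n)))"
proof -
  let ?s = "\<lambda>n (x::real^'n). (norm x)\<^sup>2 + e n"
  have s: "?s n x \<in> {0..2}" if "x \<in> cball 0 1" for n x
  proof -
    have "(norm x)\<^sup>2 \<le> 1" using that by (simp add: power_le_one)
    then show ?thesis using e[of n] by auto
  qed
  have us: "unif_Ck m ?s"
    using e by (intro unif_Ck_add unif_Ck_smooth smooth_norm_sq unif_Ck_param[of _ 1]) auto
  have u4: "unif_Ck m (\<lambda>n x. 1 / 4 + (- 1) * ?s n x)"
    by (intro unif_Ck_add unif_Ck_mult unif_Ck_smooth smooth_const us)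
  have "unif_Ck m (\<lambda>n x. flat 0 (1 / 4 + (- 1) * ?s n x))"
  proof (rule unif_Ck_chain[where K = "{-2..1}" and \<phi> = flat])
    show "1 / 4 + (- 1) * ?s n x \<in> {-2..1}" if "x \<in> cball 0 1" for n x
      using s[OF that, of n] by auto
  qed (rule compact_Icc continuous_flat flat_deriv u4)+
  from unif_Ck_add[OF us this] have uc: "unif_Ck m (\<lambda>n x. pos_reg (?s n x))"
    by (simp add: pos_reg_def algebra_simps)
  have "unif_Ck m (\<lambda>n x. ln_derivs 0 (pos_reg (?s n x)))"
  proof (rule unif_Ck_chain[where K = "pos_reg ` {0..2}" and \<phi> = ln_derivs])
    show "compact (pos_reg ` {0..2})" by (intro compact_continuous_image continuous_pos_reg compact_Icc)
    show "continuous_on (pos_reg ` {0..2}) (ln_derivs j)" for j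
      by (intro continuous_at_imp_continuous_on ballI DERIV_isCont[OF ln_derivs_deriv]) (auto intro: pos_reg_pos)
    show "pos_reg (?s n x) \<in> pos_reg ` {0..2}" if "x \<in> cball 0 1" for n x by (intro imageI s that)
    show "(ln_derivs j has_real_derivative ln_derivs (Suc j) (pos_reg (?s n x))) (at (pos_reg (?s n x)))" for j n x
      using e[of n] by (intro ln_derivs_deriv pos_reg_pos) simp
  qed (rule uc)
  then show ?thesis by (simp add: ln_derivs_def)
qed

section \<open>Approximate identities\<close>

lemma test_Lipschitz:
  fixes v :: "real^'n::finite \<Rightarrow> real"
  assumes v: "v \<in> test_functions"
  obtains L where "L \<ge> 0" "\<And>x y. \<bar>v x - v y\<bar> \<le> L * norm (x - y)"
proof -
  have "\<exists>B. \<forall>x. \<bar>partial_deriv i v x\<bar> \<le> B" for i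
    using test_bounded[OF test_partial[OF v]] by metis
  then obtain B where B: "\<And>i x. \<bar>partial_deriv i v x\<bar> \<le> B i" by metis
  have B0: "B i \<ge> 0" for i using B[of i 0] by linarith
  have "norm (v x - v y) \<le> (\<Sum>i\<in>UNIV. B i) * norm (x - y)" for x y
  proof (rule differentiable_bound[of UNIV])
    fix x :: "real^'n"
    let ?D = "frechet_derivative v (at x)"
    show D: "(v has_derivative ?D) (at x within UNIV)"
      using differentiable_partial_deriv[OF smooth_differentiable[OF test_smooth[OF v]]] by simp
    show "onorm ?D \<le> (\<Sum>i\<in>UNIV. B i)"
    proof (rule onorm_le)
      fix h :: "real^'n"
      have lin: "linear ?D" using D by (rule has_derivative_linear)
      have "?D h = ?D (\<Sum>i\<in>UNIV. h $ i *\<^sub>R axis i 1)"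
        using basis_expansion[of h] by (simp add: scalar_mult_eq_scaleR)
      also have "\<dots> = (\<Sum>i\<in>UNIV. h $ i * partial_deriv i v x)"
        by (simp add: linear_sum[OF lin] linear_scale[OF lin] partial_deriv_def)
      finally have "norm (?D h) \<le> (\<Sum>i\<in>UNIV. \<bar>h $ i * partial_deriv i v x\<bar>)" by simp
      also have "\<dots> \<le> (\<Sum>i\<in>UNIV. B i * norm h)"
        unfolding abs_mult using component_le_norm_cart[of h] B B0
        by (intro sum_mono) (subst mult.commute, intro mult_mono, auto)
      finally show "norm (?D h) \<le> (\<Sum>i\<in>UNIV. B i) * norm h" by (simp add: sum_distrib_right)
    qed
  qed auto
  then show thesis using that[of "\<Sum>i\<in>UNIV. B i"] B0 by (simp add: sum_nonneg)
qed

lemma lborel_scale: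
  fixes c :: real and t :: "'a::euclidean_space"
  assumes c: "c > 0"
  shows "(lborel :: 'a measure) = density (distr lborel borel (\<lambda>x. t + c *\<^sub>R x)) (\<lambda>_. ennreal (c ^ DIM('a)))"
  using lborel_affine_euclidean[where c = "\<lambda>_. c" and t = t] c
proof -
  have "t + (\<Sum>j\<in>Basis. (c * (x \<bullet> j)) *\<^sub>R j) = t + c *\<^sub>R x" for x :: 'a
    by (subst (2) euclidean_representation[symmetric]) (simp add: scaleR_sum_right)
  then show ?thesis using lborel_affine_euclidean[where c = "\<lambda>_. c" and t = t] c by simp
qed

lemma integral_lborel_scale:
  fixes f :: "'a::euclidean_space \<Rightarrow> real"
  assumes c: "c > 0" and [measurable]: "f \<in> borel_measurable borel"
  shows "(\<integral>x. f x \<partial>lborel) = c ^ DIM('a) * (\<integral>x. f (t + c *\<^sub>R x) \<partial>lborel)"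
    and "integrable lborel (\<lambda>x. f (t + c *\<^sub>R x)) \<longleftrightarrow> integrable lborel f"
proof -
  have cp: "c ^ DIM('a) > 0" using c by simp
  have "(\<integral>x. f x \<partial>lborel) = (\<integral>x. f x \<partial>density (distr lborel borel (\<lambda>x. t + c *\<^sub>R x)) (\<lambda>_. ennreal (c ^ DIM('a))))"
    by (simp flip: lborel_scale[OF c, of t])
  also have "\<dots> = c ^ DIM('a) * (\<integral>x. f (t + c *\<^sub>R x) \<partial>lborel)"
    using cp by (subst integral_real_density) (simp_all add: integral_distr)
  finally show "(\<integral>x. f x \<partial>lborel) = c ^ DIM('a) * (\<integral>x. f (t + c *\<^sub>R x) \<partial>lborel)" .
  have "integrable lborel f \<longleftrightarrow> integrable (density (distr lborel borel (\<lambda>x. t + c *\<^sub>R x)) (\<lambda>_. ennreal (c ^ DIM('a)))) f"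
    by (simp flip: lborel_scale[OF c, of t])
  also have "\<dots> \<longleftrightarrow> integrable lborel (\<lambda>x. f (t + c *\<^sub>R x))"
    using cp c by (subst integrable_real_density) (simp_all add: integrable_distr_eq)
  finally show "integrable lborel (\<lambda>x. f (t + c *\<^sub>R x)) \<longleftrightarrow> integrable lborel f" by simp
qed

lemma nn_integral_lborel_translate:
  fixes f :: "'a::euclidean_space \<Rightarrow> ennreal"
  assumes [measurable]: "f \<in> borel_measurable borel"
  shows "(\<integral>\<^sup>+x. f (x + z) \<partial>lborel) = (\<integral>\<^sup>+x. f x \<partial>lborel)"
proof -
  have "(\<integral>\<^sup>+x. f x \<partial>lborel) = (\<integral>\<^sup>+x. f x \<partial>distr lborel borel ((+) z))" by (simp add: lborel_distr_plus)
  also have "\<dots> = (\<integral>\<^sup>+x. f (z + x) \<partial>lborel)" by (subst nn_integral_distr) auto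
  finally show ?thesis by (simp add: add.commute)
qed

text \<open>Comparing \<open>w\<close> with a test function at \<open>y\<close> and at
  \<open>y + z\<close> costs the same distance twice, by translation invariance; the test function
  itself is Lipschitz, and for \<open>norm z \<le> 1\<close> its increment lives in the ball of
  radius 2.\<close>

lemma translation_modulus:
  fixes w v :: "real^'n::finite \<Rightarrow> real"
  assumes [measurable]: "w \<in> borel_measurable borel"
    and v: "v \<in> test_functions" and L: "L \<ge> 0" "\<And>x y. \<bar>v x - v y\<bar> \<le> L * norm (x - y)"
    and z: "norm z \<le> 1"
  shows "(\<integral>\<^sup>+y. ennreal \<bar>w y - w (y + z)\<bar> \<partial>lborel)
    \<le> 2 * (\<integral>\<^sup>+y. ennreal \<bar>w y - v y\<bar> \<partial>lborel) + ennreal (L * norm z) * emeasure lborel (cball (0::real^'n) 2)"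
proof -
  have [measurable]: "v \<in> borel_measurable borel" by (rule test_measurable[OF v])
  have [measurable]: "cball (0::real^'n) 2 \<in> sets borel" by simp
  have vz: "\<bar>v y - v (y + z)\<bar> \<le> L * norm z * indicator (cball 0 2) y" for y
  proof (cases "y \<in> cball 0 2")
    case True
    then show ?thesis using L(2)[of y "y + z"] by simp
  next
    case False
    then have "norm (y + z) \<ge> 1" using norm_triangle_ineq2[of y "- z"] z by simp
    then show ?thesis using False test_outside[OF v] by simp
  qed
  have "(\<integral>\<^sup>+y. ennreal \<bar>w y - w (y + z)\<bar> \<partial>lborel)
    \<le> (\<integral>\<^sup>+y. ennreal \<bar>w y - v y\<bar> + ennreal \<bar>w (y + z) - v (y + z)\<bar> + ennreal (L * norm z) * indicator (cball 0 2) y \<partial>lborel)"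
  proof (rule nn_integral_mono)
    fix y
    have "\<bar>w y - w (y + z)\<bar> \<le> \<bar>w y - v y\<bar> + \<bar>w (y + z) - v (y + z)\<bar> + L * norm z * indicator (cball 0 2) y"
      using vz[of y] by linarith
    then have "ennreal \<bar>w y - w (y + z)\<bar> \<le> ennreal (\<bar>w y - v y\<bar> + \<bar>w (y + z) - v (y + z)\<bar> + L * norm z * indicator (cball 0 2) y)"
      by (rule ennreal_leI)
    also have "\<dots> = ennreal \<bar>w y - v y\<bar> + ennreal \<bar>w (y + z) - v (y + z)\<bar> + ennreal (L * norm z) * indicator (cball 0 2) y"
      using L(1) by (simp add: ennreal_plus ennreal_mult'' ennreal_indicator)
    finally show "ennreal \<bar>w y - w (y + z)\<bar> \<le> \<dots>" .
  qed
  also have "\<dots> = (\<integral>\<^sup>+y. ennreal \<bar>w y - v y\<bar> + ennreal \<bar>w (y + z) - v (y + z)\<bar> \<partial>lborel)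
      + (\<integral>\<^sup>+y. ennreal (L * norm z) * indicator (cball (0::real^'n) 2) y \<partial>lborel)"
    by (rule nn_integral_add) measurable
  also have "(\<integral>\<^sup>+y. ennreal \<bar>w y - v y\<bar> + ennreal \<bar>w (y + z) - v (y + z)\<bar> \<partial>lborel)
      = (\<integral>\<^sup>+y. ennreal \<bar>w y - v y\<bar> \<partial>lborel) + (\<integral>\<^sup>+y. ennreal \<bar>w (y + z) - v (y + z)\<bar> \<partial>lborel)"
    by (rule nn_integral_add) measurable
  also have "(\<integral>\<^sup>+y. ennreal (L * norm z) * indicator (cball (0::real^'n) 2) y \<partial>lborel)
      = ennreal (L * norm z) * emeasure lborel (cball (0::real^'n) 2)"
    by (rule nn_integral_cmult_indicator) simp
  also have "(\<integral>\<^sup>+y. ennreal \<bar>w (y + z) - v (y + z)\<bar> \<partial>lborel) = (\<integral>\<^sup>+y. ennreal \<bar>w y - v y\<bar> \<partial>lborel)"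
    by (rule nn_integral_lborel_translate) measurable
  finally show ?thesis by (simp add: mult_2)
qed

text \<open>On \<open>Y\<close> the excess of \<open>\<bar>w y\<bar>\<close> over \<open>C\<close>
  is at most the average of \<open>\<bar>w y - w (y + z)\<bar>\<close>. After exchanging the
  integrals, the total excess is bounded by an average of translation moduli in \<open>L^1\<close>,
  and this tends to 0 as the kernels concentrate.\<close>

lemma AE_bound_approximate_identity:
  fixes w :: "real^'n::finite \<Rightarrow> real" and p :: "nat \<Rightarrow> real^'n \<Rightarrow> real"
  assumes [measurable]: "w \<in> borel_measurable borel" and w: "integrable lborel w"
    and [measurable]: "\<And>n. p n \<in> borel_measurable borel"
    and p0: "\<And>n z. p n z \<ge> 0" and p1: "\<And>n. integrable lborel (p n)" "\<And>n. (\<integral>z. p n z \<partial>lborel) = 1"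
    and pB: "\<And>n. \<exists>B. \<forall>z. p n z \<le> B" and psupp: "\<And>n z. norm z > 1 \<Longrightarrow> p n z = 0"
    and conc: "(\<lambda>n. \<integral>z. norm z * p n z \<partial>lborel) \<longlonglongrightarrow> 0"
    and approx: "\<And>\<eta>. \<eta> > 0 \<Longrightarrow> \<exists>v\<in>test_functions. (\<integral>\<^sup>+x. ennreal \<bar>w x - v x\<bar> \<partial>lborel) \<le> ennreal \<eta>"
    and [measurable]: "Y \<in> sets borel"
    and bound: "\<And>y n. y \<in> Y \<Longrightarrow> \<bar>\<integral>z. w (y + z) * p n z \<partial>lborel\<bar> \<le> C"
  shows "AE y in lborel. y \<in> Y \<longrightarrow> \<bar>w y\<bar> \<le> C"
proof -
  let ?T = "\<lambda>z. \<integral>\<^sup>+y. ennreal \<bar>w y - w (y + z)\<bar> \<partial>lborel"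
  have wz: "integrable lborel (\<lambda>z. w (y + z) * p n z)" for y n
  proof -
    obtain B where B: "\<And>z. p n z \<le> B" using pB by blast
    have "integrable lborel (\<lambda>z. w (y + z))"
      using integral_lborel_scale(2)[of 1 w y] w by simp
    then have "integrable lborel (\<lambda>z. B * w (y + z))" by simp
    then show ?thesis
    proof (rule Bochner_Integration.integrable_bound)
      show "AE z in lborel. norm (w (y + z) * p n z) \<le> norm (B * w (y + z))"
        using p0[of n] B order_trans[OF p0 B] by (simp add: abs_mult mult.commute mult_right_mono)
    qed measurable
  qed
  \<comment> \<open>\<open>ennreal\<close> sends negative reals to 0, so this is the positive part
    of the excess.\<close>
  let ?S = "\<lambda>y. ennreal ((\<bar>w y\<bar> - C) * indicator Y y)"
  have S: "?S y \<le> (\<integral>\<^sup>+z. ennreal (\<bar>w y - w (y + z)\<bar> * p n z) \<partial>lborel)" for y n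
  proof (cases "y \<in> Y")
    case True
    have i: "integrable lborel (\<lambda>z. (w y - w (y + z)) * p n z)"
      unfolding left_diff_distrib using wz p1 by simp
    have "w y = (\<integral>z. (w y - w (y + z)) * p n z \<partial>lborel) + (\<integral>z. w (y + z) * p n z \<partial>lborel)"
      unfolding left_diff_distrib using wz[of y n] p1 by simp
    then have "\<bar>w y\<bar> - C \<le> \<bar>\<integral>z. (w y - w (y + z)) * p n z \<partial>lborel\<bar>"
      using bound[OF True, of n] by linarith
    also have "\<dots> \<le> (\<integral>z. \<bar>(w y - w (y + z)) * p n z\<bar> \<partial>lborel)" by (rule integral_abs_bound)
    finally have "ennreal (\<bar>w y\<bar> - C) \<le> ennreal (\<integral>z. \<bar>(w y - w (y + z)) * p n z\<bar> \<partial>lborel)"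
      by (rule ennreal_leI)
    also have "\<dots> = (\<integral>\<^sup>+z. ennreal \<bar>(w y - w (y + z)) * p n z\<bar> \<partial>lborel)"
      using i by (intro nn_integral_eq_integral[symmetric]) auto
    finally show ?thesis using True p0 by (simp add: abs_mult)
  qed simp
  have small: "(\<integral>\<^sup>+y. ?S y \<partial>lborel) \<le> ennreal \<epsilon>" if \<epsilon>: "\<epsilon> > 0" for \<epsilon>
  proof -
    \<comment> \<open>A quarter, because \<open>translation_modulus\<close> doubles the distance;
      the other half of \<open>\<epsilon>\<close> is left for the concentration term.\<close>
    obtain v where v: "v \<in> test_functions" "(\<integral>\<^sup>+x. ennreal \<bar>w x - v x\<bar> \<partial>lborel) \<le> ennreal (\<epsilon> / 4)"
      using approx[of "\<epsilon> / 4"] \<epsilon> by auto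
    obtain L where L: "L \<ge> 0" "\<And>x y. \<bar>v x - v y\<bar> \<le> L * norm (x - y)" using test_Lipschitz[OF v(1)] by blast
    define V where "V = measure lborel (cball (0::real^'n) 2)"
    have V: "emeasure lborel (cball (0::real^'n) 2) = ennreal V" "V \<ge> 0"
      using emeasure_bounded_finite[of "cball (0::real^'n) 2"]
      unfolding V_def by (auto intro!: emeasure_eq_ennreal_measure)
    have "\<forall>\<^sub>F n in sequentially. L * V * (\<integral>z. norm z * p n z \<partial>lborel) < \<epsilon> / 2"
      using tendsto_mult_left[OF conc, of "L * V"] \<epsilon> by (intro order_tendstoD) auto
    from eventually_happens'[OF sequentially_bot this]
    obtain n where n: "L * V * (\<integral>z. norm z * p n z \<partial>lborel) < \<epsilon> / 2" by blast
    have ip: "integrable lborel (\<lambda>z. norm z * p n z)"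
    proof (rule Bochner_Integration.integrable_bound[OF p1(1)[of n]])
      have "norm (norm z * p n z) \<le> norm (p n z)" for z
        using p0[of n z] psupp[of z n] mult_left_le_one_le[of "p n z" "norm z"]
        by (cases "norm z > 1") (auto simp: abs_mult)
      then show "AE z in lborel. norm (norm z * p n z) \<le> norm (p n z)" by simp
    qed measurable
    have "(\<integral>\<^sup>+y. ?S y \<partial>lborel) \<le> (\<integral>\<^sup>+y. \<integral>\<^sup>+z. ennreal (\<bar>w y - w (y + z)\<bar> * p n z) \<partial>lborel \<partial>lborel)"
      by (intro nn_integral_mono S)
    also have "\<dots> = (\<integral>\<^sup>+z. \<integral>\<^sup>+y. ennreal (\<bar>w y - w (y + z)\<bar> * p n z) \<partial>lborel \<partial>lborel)"
      by (rule lborel_pair.Fubini') measurable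
    also have "\<dots> = (\<integral>\<^sup>+z. ennreal (p n z) * ?T z \<partial>lborel)"
      using p0 by (intro nn_integral_cong) (simp add: ennreal_mult'' mult.commute flip: nn_integral_cmult)
    also have "\<dots> \<le> (\<integral>\<^sup>+z. ennreal ((\<epsilon> / 2) * p n z + L * V * (norm z * p n z)) \<partial>lborel)"
    proof (rule nn_integral_mono)
      fix z
      show "ennreal (p n z) * ?T z \<le> ennreal ((\<epsilon> / 2) * p n z + L * V * (norm z * p n z))"
      proof (cases "norm z \<le> 1")
        case True
        have "?T z \<le> 2 * ennreal (\<epsilon> / 4) + ennreal (L * norm z) * ennreal V"
          using translation_modulus[OF _ v(1) L True, of w] v(2) unfolding V(1)
          by (meson add_right_mono mult_left_mono order_trans zero_le assms(1))
        also have "2 * ennreal (\<epsilon> / 4) = ennreal (\<epsilon> / 4 + \<epsilon> / 4)"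
          using \<epsilon> by (subst ennreal_plus) (auto simp: mult_2)
        also have "ennreal (L * norm z) * ennreal V = ennreal (L * norm z * V)"
          using L(1) V(2) by (intro ennreal_mult[symmetric]) auto
        also have "ennreal (\<epsilon> / 4 + \<epsilon> / 4) + ennreal (L * norm z * V) = ennreal (\<epsilon> / 2 + L * norm z * V)"
          using \<epsilon> L(1) V(2) by (subst ennreal_plus[symmetric]) auto
        finally have "ennreal (p n z) * ?T z \<le> ennreal (p n z) * ennreal (\<epsilon> / 2 + L * norm z * V)"
          by (rule mult_left_mono) simp
        also have "\<dots> = ennreal ((\<epsilon> / 2) * p n z + L * V * (norm z * p n z))"
          using p0[of n z] \<epsilon> L(1) V(2) by (subst ennreal_mult[symmetric]) (auto simp: algebra_simps)
        finally show ?thesis .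
      qed (use psupp in simp)
    qed
    also have "\<dots> = ennreal (\<integral>z. (\<epsilon> / 2) * p n z + L * V * (norm z * p n z) \<partial>lborel)"
      using p0 \<epsilon> L(1) V(2) p1 ip by (intro nn_integral_eq_integral) auto
    also have "(\<integral>z. (\<epsilon> / 2) * p n z + L * V * (norm z * p n z) \<partial>lborel)
        = \<epsilon> / 2 + L * V * (\<integral>z. norm z * p n z \<partial>lborel)"
      using p1 ip by simp
    also have "ennreal \<dots> \<le> ennreal \<epsilon>" using n by (intro ennreal_leI) simp
    finally show ?thesis .
  qed
  have "(\<integral>\<^sup>+y. ?S y \<partial>lborel) \<le> 0"
    by (rule ennreal_le_epsilon) (use small in simp)
  then have "(\<integral>\<^sup>+y. ?S y \<partial>lborel) = 0" by simp
  then have "AE y in lborel. ?S y = 0" by (subst (asm) nn_integral_0_iff_AE) measurable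
  then show ?thesis by eventually_elim (auto simp: ennreal_eq_0_iff indicator_def split: if_splits)
qed

section \<open>Local boundedness of energy solutions\<close>

lemma smooth_scaled:
  fixes f :: "real^'n::finite \<Rightarrow> real"
  assumes \<delta>: "\<delta> \<noteq> 0" and f: "smooth f"
  shows "smooth (\<lambda>x. f ((x - y) /\<^sub>R \<delta>))"
proof -
  have "Ck m (\<lambda>x. f ((x - y) /\<^sub>R \<delta>))" if "smooth f" for m and f :: "real^'n \<Rightarrow> real"
    using that
  proof (induction m arbitrary: f)
    case 0
    show ?case unfolding Ck.simps
      by (rule continuous_on_compose2[OF smooth_continuous[OF 0, of UNIV]]) (auto intro!: continuous_intros)
  next
    case (Suc m)
    have "(\<lambda>x. (x - y) /\<^sub>R \<delta>) differentiable at x" for x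
      by (intro differentiable_scaleR differentiable_diff differentiable_ident differentiable_const)
    then have "(\<lambda>x. f ((x - y) /\<^sub>R \<delta>)) differentiable at x" for x
      using differentiable_chain_at[of "\<lambda>x. (x - y) /\<^sub>R \<delta>" x f] smooth_differentiable[OF Suc.prems]
      by (simp add: o_def)
    moreover have "partial_deriv i (\<lambda>x. f ((x - y) /\<^sub>R \<delta>)) = (\<lambda>x. inverse \<delta> * partial_deriv i f ((x - y) /\<^sub>R \<delta>))" for i
      by (intro ext) (simp add: partial_deriv_scaled[OF \<delta>] smooth_differentiable[OF Suc.prems] divide_inverse)
    ultimately show ?case using Suc.IH[OF smooth_partial[OF Suc.prems]] by (auto intro!: Ck_mult Ck_const)
  qed
  then show ?thesis using f by (simp add: smooth_def)
qed

lemma lap_scaled: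
  fixes f :: "real^'n::finite \<Rightarrow> real"
  assumes \<delta>: "\<delta> \<noteq> 0" and f: "smooth f"
  shows "lap (\<lambda>x. f ((x - y) /\<^sub>R \<delta>)) = (\<lambda>x. inverse \<delta> ^ 2 * lap f ((x - y) /\<^sub>R \<delta>))"
proof -
  have p: "partial_deriv i (\<lambda>x. g ((x - y) /\<^sub>R \<delta>)) = (\<lambda>x. inverse \<delta> * partial_deriv i g ((x - y) /\<^sub>R \<delta>))"
    if "smooth g" for i and g :: "real^'n \<Rightarrow> real"
    by (intro ext) (simp add: partial_deriv_scaled[OF \<delta>] smooth_differentiable[OF that] divide_inverse)
  have "partial_deriv i (\<lambda>x. inverse \<delta> * partial_deriv i f ((x - y) /\<^sub>R \<delta>)) x
      = inverse \<delta> * (inverse \<delta> * partial_deriv i (partial_deriv i f) ((x - y) /\<^sub>R \<delta>))" for i x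
    by (subst partial_deriv_cmult)
       (simp_all add: p smooth_partial f smooth_differentiable[OF smooth_scaled[OF \<delta> smooth_partial[OF f]]])
  then show ?thesis
    by (intro ext) (simp add: lap_def p f sum_distrib_left power2_eq_square mult.assoc)
qed

text \<open>For \<open>j = k\<close> the power \<open>2 * j\<close> is the dimension, so the factor
  is the one that normalises an average at scale \<open>\<delta>\<close>.\<close>

lemma lap_funpow_scaled:
  fixes f :: "real^'n::finite \<Rightarrow> real"
  assumes \<delta>: "\<delta> \<noteq> 0" and f: "smooth f"
  shows "(lap ^^ j) (\<lambda>x. f ((x - y) /\<^sub>R \<delta>)) = (\<lambda>x. inverse \<delta> ^ (2 * j) * (lap ^^ j) f ((x - y) /\<^sub>R \<delta>))"
proof (induction j)
  case (Suc j)
  let ?g = "\<lambda>x. (lap ^^ j) f ((x - y) /\<^sub>R \<delta>)"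
  have g: "smooth ?g" by (rule smooth_scaled[OF \<delta> smooth_lap_funpow[OF f]])
  have "lap (\<lambda>x. inverse \<delta> ^ (2 * j) * ?g x) = (\<lambda>x. inverse \<delta> ^ (2 * j) * lap ?g x)"
    using lap_lincomb[OF g g, of "inverse \<delta> ^ (2 * j)" 0] by simp
  then show ?case
    by (simp add: Suc lap_scaled[OF \<delta> smooth_lap_funpow[OF f]] power_add[symmetric] mult.assoc[symmetric] flip: power_add)
qed simp

text \<open>The regularisation parameter. The bound \<open>1 / 4\<close> keeps the ball of radius
  \<open>sqrt (reg n)\<close> inside the support of \<open>kern\<close>, and it keeps
  \<open>(norm z)\<^sup>2 + reg n\<close> at most 1 for \<open>norm z < 1 / 2\<close>, where
  \<open>ln_sq_le\<close> is applied.\<close>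

definition reg :: "nat \<Rightarrow> real" where
  "reg n = 1 / (real n + 4)"

lemma reg: "0 < reg n" "reg n \<le> 1 / 4"
  by (auto simp: reg_def field_simps)

lemma reg_tendsto: "reg \<longlonglongrightarrow> 0"
proof -
  have "(\<lambda>n. 1 / real (n + 4)) \<longlonglongrightarrow> 0"
    by (rule LIMSEQ_ignore_initial_segment[OF lim_1_over_n])
  then show ?thesis by (simp add: reg_def[abs_def] add.commute)
qed

text \<open>Since \<open>pos_reg\<close> is positive on \<open>s \<ge> 0\<close> and the identity on \<open>s \<ge> 1/4\<close>, the second logarithm
  is smooth up to the singularity of the first one and cancels it outside the ball of radius \<open>1/2\<close>.\<close>

definition theta :: "nat \<Rightarrow> real^'n::finite \<Rightarrow> real" where
  "theta n z = ln ((norm z)\<^sup>2 + reg n) - ln (pos_reg ((norm z)\<^sup>2 + reg n))"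

lemma smooth_ln_reg: "smooth (\<lambda>z::real^'n::finite. ln ((norm z)\<^sup>2 + reg n))"
  using smooth_ln_radial[OF reg(1), of 0 n] by (simp add: ln_derivs_def)

lemma smooth_ln_pos_reg_reg: "smooth (\<lambda>z::real^'n::finite. ln (pos_reg ((norm z)\<^sup>2 + reg n)))"
  using smooth_ln_pos_reg[of "reg n"] reg(1)[of n] by simp

lemma smooth_theta: "smooth (theta n)"
  unfolding theta_def[abs_def] by (intro smooth_diff smooth_ln_reg smooth_ln_pos_reg_reg)

lemma theta_outside:
  assumes "norm z \<ge> 1 / 2" shows "theta n z = 0"
proof -
  have "(1 / 2)\<^sup>2 \<le> (norm z)\<^sup>2" using assms by (intro power_mono) auto
  then show ?thesis using reg(1)[of n] by (simp add: theta_def pos_reg_eq power2_eq_square)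
qed

lemma lap_funpow_theta_outside:
  assumes "norm (z :: real^'n::finite) > 1 / 2" shows "(lap ^^ j) (theta n) z = 0"
  using assms
proof (induction j arbitrary: z)
  case (Suc j)
  have o: "open (- cball (0::real^'n) (1/2))" by (simp add: open_Compl)
  have 1: "partial_deriv i ((lap ^^ j) (theta n)) x = 0" if "x \<in> - cball 0 (1/2)" for i and x :: "real^'n"
    using partial_deriv_cong[OF o that, of "(lap ^^ j) (theta n)" "\<lambda>_. 0" i] Suc.IH by auto
  have "partial_deriv i (partial_deriv i ((lap ^^ j) (theta n))) z = 0" for i
    using partial_deriv_cong[OF o, of z "partial_deriv i ((lap ^^ j) (theta n))" "\<lambda>_. 0" i] 1 Suc.prems by auto
  then have "lap ((lap ^^ j) (theta n)) z = 0" by (subst lap_def) simp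
  then show ?case by simp
qed (simp add: theta_outside)

context
  fixes k :: nat
  assumes N: "CARD('n::finite) = 2 * k" and k: "k \<ge> 1"
begin

text \<open>The logarithm gives the explicit kernel by \<open>polyharmonic_ln\<close>, its smooth
  substitute an error bounded uniformly in \<open>n\<close> by \<open>unif_Ck_ln_pos_reg\<close>.
  The bound on the substitute itself is recorded for the \<open>L^2\<close> estimate.\<close>

lemma lap_funpow_theta:
  "\<exists>c C. c \<noteq> 0 \<and> (\<forall>n. \<forall>z::real^'n. norm z \<le> 1 \<longrightarrow>
     \<bar>(lap ^^ k) (theta n) z - c * (reg n ^ k * inverse ((norm z)\<^sup>2 + reg n) ^ (2 * k))\<bar> \<le> C \<and>
     \<bar>ln (pos_reg ((norm z)\<^sup>2 + reg n))\<bar> \<le> C)"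
proof -
  let ?L = "\<lambda>n (z::real^'n). ln (pos_reg ((norm z)\<^sup>2 + reg n))"
  have e: "0 \<le> reg n \<and> reg n \<le> 1" for n using reg[of n] by simp
  have u: "unif_Ck m ?L" for m by (rule unif_Ck_ln_pos_reg[OF e])
  obtain C1 where C1: "\<And>n z. z \<in> cball 0 1 \<Longrightarrow> \<bar>(lap ^^ k) (?L n) z\<bar> \<le> C1"
    using unif_Ck_0_E[OF unif_Ck_lap_funpow[of k 0, OF u]] by blast
  obtain C2 where C2: "\<And>n z. z \<in> cball 0 1 \<Longrightarrow> \<bar>?L n z\<bar> \<le> C2"
    using unif_Ck_0_E[OF u] by blast
  obtain c where c: "c \<noteq> 0" "\<And>e. e > 0 \<Longrightarrow> (lap ^^ k) (\<lambda>x::real^'n. ln ((norm x)\<^sup>2 + e))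
    = (\<lambda>x. c * e ^ k * inverse ((norm x)\<^sup>2 + e) ^ (2 * k))"
    using polyharmonic_ln[OF N k] by blast
  have "(lap ^^ k) (theta n) z = c * (reg n ^ k * inverse ((norm z)\<^sup>2 + reg n) ^ (2 * k)) - (lap ^^ k) (?L n) z" for n z
    using fun_cong[OF lap_funpow_lincomb[OF smooth_ln_reg smooth_ln_pos_reg_reg, of k 1 n "-1" n], of z] c(2)[OF reg(1)[of n]]
    by (simp add: theta_def[abs_def])
  then have "norm z \<le> 1 \<longrightarrow> \<bar>(lap ^^ k) (theta n) z - c * (reg n ^ k * inverse ((norm z)\<^sup>2 + reg n) ^ (2 * k))\<bar> \<le> max C1 C2 \<and>
     \<bar>?L n z\<bar> \<le> max C1 C2" for n and z :: "real^'n"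
    using C1[of z n] C2[of z n] by auto
  then show ?thesis using c(1) by blast
qed

lemma integrable_bounded_support:
  fixes g :: "real^'n \<Rightarrow> real"
  assumes [measurable]: "g \<in> borel_measurable borel" and B: "\<And>z. \<bar>g z\<bar> \<le> B" and supp: "\<And>z. norm z > r \<Longrightarrow> g z = 0"
  shows "integrable lborel g"
proof (rule Bochner_Integration.integrable_bound)
  show "integrable lborel (\<lambda>z::real^'n. B * indicator (cball 0 r) z)"
    using emeasure_bounded_finite[of "cball (0::real^'n) r"] by (intro integrable_mult_right integrable_real_indicator) auto
  show "AE z in lborel. norm (g z) \<le> norm (B * indicator (cball 0 r) z)"
    using B supp by (auto simp: indicator_def intro!: AE_I2) (metis abs_ge_self order_trans abs_ge_zero)
qed simp

text \<open>A scaling argument: the dyadic shell \<open>1/2 \<le> |z| < 1\<close> controls the whole integral.\<close>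

lemma singular_integral_bound:
  assumes e: "e > 0"
  shows "integrable lborel (\<lambda>z::real^'n. indicator (ball 0 1) z * inverse (sqrt ((norm z)\<^sup>2 + e)))"
    and "(\<integral>z. indicator (ball 0 1) (z::real^'n) * inverse (sqrt ((norm z)\<^sup>2 + e)) \<partial>lborel) \<le> 4 * measure lborel (ball (0::real^'n) 1)"
proof -
  let ?g = "\<lambda>z::real^'n. indicator (ball 0 1) z * inverse (sqrt ((norm z)\<^sup>2 + e))"
  let ?V = "measure lborel (ball (0::real^'n) 1)"
  have s0: "(norm z)\<^sup>2 + e > 0" for z :: "real^'n" using e by (simp add: add_nonneg_pos)
  have [measurable]: "ball (0::real^'n) r \<in> sets borel" for r by simp
  show g: "integrable lborel ?g"
  proof (rule integrable_bounded_support[of _ "inverse (sqrt e)" 1])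
    show "\<bar>?g z\<bar> \<le> inverse (sqrt e)" for z
      using e s0[of z] by (auto simp: indicator_def intro!: le_imp_inverse_le)
  qed (auto simp: indicator_def)
  have I: "integrable lborel (\<lambda>z::real^'n. indicator (ball 0 1) z :: real)"
    using emeasure_bounded_finite[of "ball (0::real^'n) 1"] by (intro integrable_real_indicator) auto
  let ?h = "\<lambda>z::real^'n. indicator (ball 0 (1/2)) z * inverse (sqrt ((norm z)\<^sup>2 + e))"
  have h: "integrable lborel ?h"
  proof (rule integrable_bounded_support[of _ "inverse (sqrt e)" 1])
    show "\<bar>?h z\<bar> \<le> inverse (sqrt e)" for z
      using e s0[of z] by (auto simp: indicator_def intro!: le_imp_inverse_le)
  qed (auto simp: indicator_def)
  have "(\<integral>z. ?h z \<partial>lborel) = (1/2) ^ CARD('n) * (\<integral>z. ?h (0 + (1/2) *\<^sub>R z) \<partial>lborel)"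
    using integral_lborel_scale(1)[of "1/2" ?h 0] by simp
  also have "\<dots> \<le> (1/2) ^ CARD('n) * (\<integral>z. 2 * ?g z \<partial>lborel)"
  proof (intro mult_left_mono integral_mono)
    show "integrable lborel (\<lambda>z. ?h (0 + (1/2) *\<^sub>R z))"
      using integral_lborel_scale(2)[of "1/2" ?h 0] h by simp
    show "integrable lborel (\<lambda>z. 2 * ?g z)" using g by simp
    fix z :: "real^'n"
    have "inverse (sqrt ((norm ((1/2) *\<^sub>R z))\<^sup>2 + e)) \<le> 2 * inverse (sqrt ((norm z)\<^sup>2 + e))"
    proof -
      have "sqrt ((norm z)\<^sup>2 + e) \<le> sqrt (4 * ((norm ((1/2) *\<^sub>R z))\<^sup>2 + e))"
        using e by (simp add: power_mult_distrib power2_eq_square)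
      also have "\<dots> = 2 * sqrt ((norm ((1/2) *\<^sub>R z))\<^sup>2 + e)" by (subst real_sqrt_mult) simp
      finally show ?thesis using s0[of z] s0[of "(1/2) *\<^sub>R z"] by (simp add: field_simps)
    qed
    then show "?h (0 + (1/2) *\<^sub>R z) \<le> 2 * ?g z" by (auto simp: indicator_def)
  qed auto
  \<comment> \<open>The dimension is at least 2, so scaling gains \<open>1 / 4\<close> while the
    integrand at most doubles: the inner half ball carries at most half of the integral and is
    absorbed.\<close>
  also have "\<dots> \<le> (1/2) ^ 2 * (\<integral>z. 2 * ?g z \<partial>lborel)"
    using N k s0 by (intro mult_right_mono power_decreasing Bochner_Integration.integral_nonneg) (auto simp: less_imp_le)
  also have "\<dots> = (1/2) * (\<integral>z. ?g z \<partial>lborel)" by (simp add: power2_eq_square)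
  finally have h2: "(\<integral>z. ?h z \<partial>lborel) \<le> (1/2) * (\<integral>z. ?g z \<partial>lborel)" .
  have "(\<integral>z. ?g z \<partial>lborel) \<le> (\<integral>z. ?h z + 2 * indicator (ball (0::real^'n) 1) z \<partial>lborel)"
  proof (rule integral_mono)
    fix z :: "real^'n"
    show "?g z \<le> ?h z + 2 * indicator (ball 0 1) z"
    proof (cases "norm z < 1/2")
      case False
      then have "(1/2)\<^sup>2 \<le> (norm z)\<^sup>2" by (intro power_mono) auto
      then have "sqrt ((1/2)\<^sup>2) \<le> sqrt ((norm z)\<^sup>2 + e)" using e by (intro real_sqrt_le_mono) linarith
      then have "inverse (sqrt ((norm z)\<^sup>2 + e)) \<le> inverse (1/2)" by (intro le_imp_inverse_le) auto
      then show ?thesis by (auto simp: indicator_def)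
    qed (auto simp: indicator_def)
  qed (use g h I in auto)
  also have "\<dots> = (\<integral>z. ?h z \<partial>lborel) + 2 * ?V" using h I by simp
  finally show "(\<integral>z. ?g z \<partial>lborel) \<le> 4 * ?V" using h2 by linarith
qed

text \<open>Applying \<open>- ln t \<le> inverse t - 1\<close> to the fourth root \<open>t\<close>
  of \<open>s\<close> gives a bound by an inverse square root of \<open>s\<close>; for
  \<open>s = (norm z)\<^sup>2 + e\<close> this is the singularity treated in
  \<open>singular_integral_bound\<close>.\<close>

lemma ln_sq_le:
  assumes "0 < s" "s \<le> 1" shows "(ln s)\<^sup>2 \<le> 16 * inverse (sqrt s)"
proof -
  define t where "t = sqrt (sqrt s)"
  have t: "t > 0" "t \<le> 1" "t * t = sqrt s" using assms by (auto simp: t_def)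
  have "s = (t * t) * (t * t)" unfolding t(3) using assms by simp
  then have "s = t ^ 4" by (simp add: power4_eq_xxxx)
  then have "ln s = 4 * ln t" using t by (simp add: ln_realpow)
  moreover have "- ln t \<le> inverse t - 1" using ln_le_minus_one[of "inverse t"] t by (simp add: ln_inverse)
  moreover have "ln t \<le> 0" using t by simp
  ultimately have "\<bar>ln s\<bar> \<le> 4 * inverse t" by simp
  then have "(ln s)\<^sup>2 \<le> (4 * inverse t)\<^sup>2" by (metis abs_le_square_iff abs_of_nonneg abs_ge_zero order_trans)
  then show ?thesis by (simp add: power2_eq_square flip: t(3))
qed

text \<open>The logarithmic pole is dominated by an integrable singularity, and the other logarithm
  is bounded. Uniformity in \<open>n\<close> is the point: it lets \<open>f\<close> enter the main
  estimate only through its \<open>L^2\<close> norm while the regularisation is removed.\<close>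

lemma theta_L2_bound:
  "\<exists>C. \<forall>n. integrable lborel (\<lambda>z::real^'n. (theta n z)\<^sup>2) \<and> (\<integral>z. (theta n (z::real^'n))\<^sup>2 \<partial>lborel) \<le> C"
proof -
  obtain c C where cC: "\<forall>n. \<forall>z::real^'n. norm z \<le> 1 \<longrightarrow>
     \<bar>(lap ^^ k) (theta n) z - c * (reg n ^ k * inverse ((norm z)\<^sup>2 + reg n) ^ (2 * k))\<bar> \<le> C \<and>
     \<bar>ln (pos_reg ((norm z)\<^sup>2 + reg n))\<bar> \<le> C"
    using lap_funpow_theta by (elim exE conjE)
  then have C: "\<bar>ln (pos_reg ((norm z)\<^sup>2 + reg n))\<bar> \<le> C" if "norm z \<le> 1" for n and z :: "real^'n"
    using that by simp
  let ?V = "measure lborel (ball (0::real^'n) 1)"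
  have "integrable lborel (\<lambda>z::real^'n. (theta n z)\<^sup>2) \<and> (\<integral>z. (theta n (z::real^'n))\<^sup>2 \<partial>lborel) \<le> 128 * ?V + 2 * C\<^sup>2 * ?V" for n
  proof -
    let ?g = "\<lambda>z::real^'n. indicator (ball 0 1) z * inverse (sqrt ((norm z)\<^sup>2 + reg n))"
    have I: "integrable lborel (\<lambda>z::real^'n. indicator (ball 0 1) z :: real)"
      using emeasure_bounded_finite[of "ball (0::real^'n) 1"] by (intro integrable_real_indicator) auto
    note g = singular_integral_bound[OF reg(1)[of n]]
    have le: "(theta n z)\<^sup>2 \<le> 32 * ?g z + 2 * C\<^sup>2 * indicator (ball 0 1) z" for z :: "real^'n"
    proof (cases "norm z < 1 / 2")
      case True
      have "(norm z)\<^sup>2 \<le> (1/2)\<^sup>2" using True by (intro power_mono) auto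
      then have s: "0 < (norm z)\<^sup>2 + reg n" "(norm z)\<^sup>2 + reg n \<le> 1"
        using reg[of n] by (auto simp: power2_eq_square add_nonneg_pos)
      have "(a - b)\<^sup>2 \<le> 2 * a\<^sup>2 + 2 * b\<^sup>2" for a b :: real
        using zero_le_power2[of "a + b"] by (simp add: power2_eq_square algebra_simps)
      then have "(theta n z)\<^sup>2 \<le> 2 * (ln ((norm z)\<^sup>2 + reg n))\<^sup>2 + 2 * (ln (pos_reg ((norm z)\<^sup>2 + reg n)))\<^sup>2"
        unfolding theta_def .
      moreover have "(ln (pos_reg ((norm z)\<^sup>2 + reg n)))\<^sup>2 \<le> C\<^sup>2"
        using C[of z n] True by (intro abs_le_square_iff[THEN iffD1]) auto
      ultimately show ?thesis using ln_sq_le[OF s] True by (simp add: indicator_def)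
    next
      case False
      have "0 \<le> ?g z" using reg(1)[of n] by (auto simp: indicator_def)
      then show ?thesis using False theta_outside[of z n] by simp
    qed
    have bnd: "integrable lborel (\<lambda>z. 32 * ?g z + 2 * C\<^sup>2 * indicator (ball (0::real^'n) 1) z)"
      using g(1) I by simp
    have [measurable]: "theta n \<in> borel_measurable (borel :: (real^'n) measure)"
      by (intro borel_measurable_continuous_onI smooth_continuous smooth_theta)
    have i: "integrable lborel (\<lambda>z::real^'n. (theta n z)\<^sup>2)"
    proof (rule Bochner_Integration.integrable_bound[OF bnd])
      show "AE z in lborel. norm ((theta n z)\<^sup>2) \<le> norm (32 * ?g z + 2 * C\<^sup>2 * indicator (ball (0::real^'n) 1) z)"
        unfolding real_norm_def abs_power2 by (intro AE_I2 order_trans[OF le abs_ge_self])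
    qed simp
    have "(\<integral>z. (theta n (z::real^'n))\<^sup>2 \<partial>lborel) \<le> (\<integral>z. 32 * ?g z + 2 * C\<^sup>2 * indicator (ball (0::real^'n) 1) z \<partial>lborel)"
      by (intro integral_mono i bnd le)
    also have "\<dots> = 32 * (\<integral>z. ?g z \<partial>lborel) + 2 * C\<^sup>2 * ?V" using g(1) I by simp
    also have "\<dots> \<le> 128 * ?V + 2 * C\<^sup>2 * ?V" using g(2) by simp
    finally show ?thesis using i by blast
  qed
  then show ?thesis by blast
qed

end

text \<open>The approximate identity of \<open>polyharmonic_ln\<close> without its constant, cut off
  where \<open>theta\<close> vanishes. It is not normalised; \<open>kern_mass\<close> controls the
  total mass.\<close>

definition kern :: "nat \<Rightarrow> nat \<Rightarrow> real^'n::finite \<Rightarrow> real" where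
  "kern k n z = indicator (cball 0 (1/2)) z * (reg n ^ k * inverse ((norm z)\<^sup>2 + reg n) ^ (2 * k))"

lemma kern_nonneg: "kern k n z \<ge> 0"
  using reg(1)[of n] by (simp add: kern_def indicator_def)

lemma kern_le: "kern k n z \<le> reg n ^ k * inverse (reg n) ^ (2 * k)"
proof -
  have "inverse ((norm z)\<^sup>2 + reg n) \<le> inverse (reg n)"
    using reg(1)[of n] by (intro le_imp_inverse_le) auto
  then have "inverse ((norm z)\<^sup>2 + reg n) ^ (2 * k) \<le> inverse (reg n) ^ (2 * k)"
    using reg(1)[of n] by (intro power_mono) auto
  then have "reg n ^ k * inverse ((norm z)\<^sup>2 + reg n) ^ (2 * k) \<le> reg n ^ k * inverse (reg n) ^ (2 * k)"
    using reg(1)[of n] by (intro mult_left_mono) auto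
  then show ?thesis using reg(1)[of n] by (auto simp: kern_def indicator_def)
qed

lemma kern_outside: "norm z > 1/2 \<Longrightarrow> kern k n z = 0"
  by (simp add: kern_def)

lemma measurable_kern [measurable]: "kern k n \<in> borel_measurable borel"
proof -
  have "cball (0::real^'n) (1/2) \<in> sets borel" by simp
  then show ?thesis unfolding kern_def[abs_def] by measurable
qed

text \<open>On the ball of radius \<open>\<delta> / 2\<close> the distance to the boundary stays
  between \<open>\<delta> / 2\<close> and \<open>5 / 2 * \<delta>\<close>, so \<open>conf\<close> is
  comparable to \<open>inverse \<delta>\<close>. This makes the later constants independent of the
  position of \<open>y\<close>.\<close>

lemma conf_bounds:
  assumes "\<delta> > 0" "\<delta> \<le> 1 - norm y" "1 - norm y \<le> 2 * \<delta>" "dist y x \<le> \<delta> / 2"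
  shows "x \<in> ball 0 1" "inverse \<delta> \<le> (5 / 2) * conf x" "conf x \<le> 4 * inverse \<delta>"
proof -
  have n: "norm x \<le> norm y + \<delta> / 2" "norm y \<le> norm x + \<delta> / 2"
    using assms(4) norm_triangle_ineq2[of x y] norm_triangle_ineq2[of y x] by (auto simp: dist_norm norm_minus_commute)
  have 1: "1 - norm x \<ge> \<delta> / 2" "1 - norm x \<le> 5 / 2 * \<delta>" using n assms by linarith+
  then show x: "x \<in> ball 0 1" using assms(1) by simp
  have "(norm x)\<^sup>2 \<le> norm x" using x by (simp add: power2_eq_square mult_left_le)
  moreover have "2 * norm x - 1 \<le> (norm x)\<^sup>2"
    using zero_le_power2[of "norm x - 1"] by (simp add: power2_eq_square algebra_simps)
  ultimately have d: "\<delta> / 2 \<le> 1 - (norm x)\<^sup>2" "1 - (norm x)\<^sup>2 \<le> 5 * \<delta>" using 1 by linarith+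
  then have p: "0 < 1 - (norm x)\<^sup>2" using assms(1) by linarith
  have c: "conf x = 2 * inverse (1 - (norm x)\<^sup>2)" by (simp only: conf_def divide_inverse)
  have "inverse (5 * \<delta>) \<le> inverse (1 - (norm x)\<^sup>2)" by (rule le_imp_inverse_le[OF d(2) p])
  moreover have "inverse (5 * \<delta>) = inverse \<delta> / 5" using assms(1) by (simp add: field_simps)
  ultimately show "inverse \<delta> \<le> (5 / 2) * conf x" unfolding c by linarith
  have "inverse (1 - (norm x)\<^sup>2) \<le> inverse (\<delta> / 2)"
    by (rule le_imp_inverse_le[OF d(1)]) (use assms(1) in simp)
  moreover have "inverse (\<delta> / 2) = 2 * inverse \<delta>" using assms(1) by (simp add: field_simps)
  ultimately show "conf x \<le> 4 * inverse \<delta>" unfolding c by linarith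
qed

lemma conf_ge_1: "x \<in> ball 0 1 \<Longrightarrow> 1 \<le> conf x"
proof -
  assume x: "x \<in> ball 0 1"
  then have "0 < 1 - (norm x)\<^sup>2" by (simp add: power_less_one_iff abs_square_less_1)
  then show ?thesis by (simp add: conf_def field_simps)
qed

lemma abs_mult_le_squares: "\<bar>a * b\<bar> \<le> a\<^sup>2 + b\<^sup>2" for a b :: real
  using sum_squares_bound[of "\<bar>a\<bar>" "\<bar>b\<bar>"] mult_nonneg_nonneg[of "\<bar>a\<bar>" "\<bar>b\<bar>"]
  unfolding abs_mult power2_abs by linarith

text \<open>From \<open>\<bar>g\<bar> \<le> a + g\<^sup>2 / a\<close> and
  \<open>conf \<ge> 1\<close>. The first term is made small by the choice of \<open>a\<close>, the
  second afterwards, so approximation in the hyperbolic \<open>L^2\<close> norm gives approximation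
  in \<open>L^1\<close>.\<close>

lemma L1_bound_of_hyperbolic_L2:
  fixes g :: "real^'n::finite \<Rightarrow> real"
  assumes [measurable]: "g \<in> borel_measurable borel" and g0: "\<And>x. x \<notin> ball 0 1 \<Longrightarrow> g x = 0"
    and g: "integrable lborel (\<lambda>x. conf x ^ CARD('n) * (g x)\<^sup>2)" and a: "a > 0"
  shows "integrable lborel g"
    and "(\<integral>\<^sup>+x. ennreal \<bar>g x\<bar> \<partial>lborel) \<le>
      ennreal (a * measure lborel (ball (0::real^'n) 1) + inverse a * (\<integral>x. conf x ^ CARD('n) * (g x)\<^sup>2 \<partial>lborel))"
proof -
  let ?G = "\<lambda>x. a * indicator (ball 0 1) x + inverse a * (conf x ^ CARD('n) * (g x)\<^sup>2)"
  have I: "integrable lborel (\<lambda>z::real^'n. indicator (ball 0 1) z :: real)"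
    using emeasure_bounded_finite[of "ball (0::real^'n) 1"] by (intro integrable_real_indicator) auto
  have G: "integrable lborel ?G" using I g by simp
  have le: "\<bar>g x\<bar> \<le> ?G x" for x
  proof (cases "x \<in> ball 0 1")
    case True
    have "0 \<le> (a - \<bar>g x\<bar>)\<^sup>2 + a * \<bar>g x\<bar>" using a by simp
    then have "a * \<bar>g x\<bar> \<le> a * a + (g x)\<^sup>2" by (simp add: power2_eq_square algebra_simps)
    then have "\<bar>g x\<bar> \<le> a + inverse a * (1 * (g x)\<^sup>2)" using a by (simp add: field_simps)
    also have "\<dots> \<le> a + inverse a * (conf x ^ CARD('n) * (g x)\<^sup>2)"
      using a conf_ge_1[OF True] by (intro add_left_mono mult_left_mono mult_right_mono) auto
    finally show ?thesis using True by simp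
  qed (simp add: g0)
  show i: "integrable lborel g"
    by (rule Bochner_Integration.integrable_bound[OF G]) (simp, intro AE_I2, use le in \<open>metis abs_ge_self order_trans real_norm_def\<close>)
  have "(\<integral>\<^sup>+x. ennreal \<bar>g x\<bar> \<partial>lborel) = ennreal (\<integral>x. \<bar>g x\<bar> \<partial>lborel)"
    using i by (intro nn_integral_eq_integral) auto
  also have "\<dots> \<le> ennreal (\<integral>x. ?G x \<partial>lborel)"
    using i by (intro ennreal_leI integral_mono G le) auto
  also have "(\<integral>x. ?G x \<partial>lborel) = a * measure lborel (ball (0::real^'n) 1) + inverse a * (\<integral>x. conf x ^ CARD('n) * (g x)\<^sup>2 \<partial>lborel)"
    using I g by simp
  finally show "(\<integral>\<^sup>+x. ennreal \<bar>g x\<bar> \<partial>lborel) \<le>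
      ennreal (a * measure lborel (ball (0::real^'n) 1) + inverse a * (\<integral>x. conf x ^ CARD('n) * (g x)\<^sup>2 \<partial>lborel))" .
qed

text \<open>By conformal covariance \<open>gjms k w = f\<close> is the Euclidean equation \<open>(- \<Delta>)\<^sup>k w = conf\<^sup>N f\<close>.\<close>

definition euclidean_weak :: "nat \<Rightarrow> (real^'n::finite \<Rightarrow> real) \<Rightarrow> (real^'n \<Rightarrow> real) \<Rightarrow> bool" where
  "euclidean_weak k w f \<longleftrightarrow> w \<in> borel_measurable borel \<and> f \<in> borel_measurable borel \<and>
     (\<forall>x. x \<notin> ball 0 1 \<longrightarrow> w x = 0) \<and>
     integrable lborel (\<lambda>x. conf x ^ CARD('n) * (w x)\<^sup>2) \<and>
     integrable lborel (\<lambda>x. indicator (ball 0 1) x * (conf x ^ CARD('n) * (f x)\<^sup>2)) \<and>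
     (\<forall>v\<in>test_functions. (\<integral>x. w x * ((-1) ^ k * (lap ^^ k) v x) \<partial>lborel)
        = (\<integral>x. conf x ^ CARD('n) * (f x * v x) \<partial>lborel))"

context
  fixes k :: nat
  assumes N: "CARD('n::finite) = 2 * k" and k: "k \<ge> 1"
begin

lemma integrable_kern: "integrable lborel (kern k n :: real^'n \<Rightarrow> real)"
proof (rule integrable_bounded_support[OF N k, of _ "reg n ^ k * inverse (reg n) ^ (2 * k)" "1/2"])
  show "\<bar>kern k n z\<bar> \<le> reg n ^ k * inverse (reg n) ^ (2 * k)" for z :: "real^'n"
    using kern_nonneg[of k n z] kern_le[of k n z] by simp
qed (auto simp: kern_outside)

text \<open>On the ball of radius \<open>sqrt (reg n)\<close> the kernel is at least
  \<open>reg n ^ k * inverse (2 * reg n) ^ (2 * k)\<close>, and in dimension \<open>2 k\<close> the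
  volume of that ball scales like \<open>reg n ^ k\<close>: the powers cancel and leave
  \<open>inverse 4 ^ k\<close> times the volume of the unit ball.\<close>

lemma kern_mass: "\<exists>\<kappa>>0. \<forall>n. \<kappa> \<le> (\<integral>z. kern k n (z::real^'n) \<partial>lborel)"
proof -
  define \<kappa> where "\<kappa> = unit_ball_vol (real CARD('n)) * inverse 4 ^ k"
  have "\<kappa> \<le> (\<integral>z. kern k n (z::real^'n) \<partial>lborel)" for n
  proof -
    let ?e = "reg n" and ?B = "cball (0::real^'n) (sqrt (reg n))"
    have e: "?e > 0" by (rule reg)
    have r: "sqrt ?e \<le> 1/2" using reg(2)[of n] real_sqrt_le_mono[of ?e "1/4"] by (simp add: real_sqrt_divide)
    have I: "integrable lborel (\<lambda>z. indicator ?B z :: real)"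
      using emeasure_bounded_finite[of ?B] by (intro integrable_real_indicator) auto
    have le: "(?e ^ k * inverse (2 * ?e) ^ (2 * k)) * indicator ?B z \<le> kern k n z" for z :: "real^'n"
    proof (cases "z \<in> ?B")
      case True
      then have "norm z \<le> sqrt ?e" by simp
      then have "(norm z)\<^sup>2 \<le> (sqrt ?e)\<^sup>2" by (intro power_mono) auto
      then have "(norm z)\<^sup>2 + ?e \<le> 2 * ?e" using e by simp
      then have "inverse (2 * ?e) \<le> inverse ((norm z)\<^sup>2 + ?e)" using e by (intro le_imp_inverse_le add_nonneg_pos) auto
      then have "inverse (2 * ?e) ^ (2 * k) \<le> inverse ((norm z)\<^sup>2 + ?e) ^ (2 * k)" using e by (intro power_mono) auto
      then have "?e ^ k * inverse (2 * ?e) ^ (2 * k) \<le> ?e ^ k * inverse ((norm z)\<^sup>2 + ?e) ^ (2 * k)"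
        using e by (intro mult_left_mono) auto
      moreover have "z \<in> cball 0 (1/2)" using True r by simp
      ultimately show ?thesis using True by (simp add: kern_def)
    qed (simp add: kern_nonneg)
    have "measure lborel ?B = unit_ball_vol (real CARD('n)) * sqrt ?e ^ (2 * k)"
      using content_cball[of "sqrt ?e" "0::real^'n"] e N by simp
    also have "sqrt ?e ^ (2 * k) = ?e ^ k" using e by (simp add: power_mult)
    finally have m: "measure lborel ?B = unit_ball_vol (real CARD('n)) * ?e ^ k" .
    have "?e ^ k * inverse (2 * ?e) ^ (2 * k) * ?e ^ k = (?e * inverse (2 * ?e) * (?e * inverse (2 * ?e))) ^ k"
      unfolding mult_2[of k] power_add power_mult_distrib by (simp only: mult_ac)
    also have "?e * inverse (2 * ?e) * (?e * inverse (2 * ?e)) = inverse 4" using e by (simp add: field_simps)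
    finally have "\<kappa> = (?e ^ k * inverse (2 * ?e) ^ (2 * k)) * measure lborel ?B"
      unfolding m \<kappa>_def by (simp only: mult_ac)
    also have "\<dots> = (\<integral>z. (?e ^ k * inverse (2 * ?e) ^ (2 * k)) * indicator ?B z \<partial>lborel)"
      using I by simp
    also have "\<dots> \<le> (\<integral>z. kern k n (z::real^'n) \<partial>lborel)"
      using I by (intro integral_mono le integrable_kern integrable_mult_right)
    finally show ?thesis .
  qed
  moreover have "\<kappa> > 0" by (simp add: \<kappa>_def)
  ultimately show ?thesis by blast
qed

text \<open>The part with \<open>norm z \<le> r\<close> contributes at most \<open>r\<close> after
  normalisation; beyond \<open>r\<close> the kernel is bounded by \<open>reg n ^ k\<close> times a
  constant, which tends to 0.\<close>

lemma kern_moment: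
  "(\<lambda>n. inverse (\<integral>z. kern k n (z::real^'n) \<partial>lborel) * (\<integral>z. norm z * kern k n (z::real^'n) \<partial>lborel)) \<longlonglongrightarrow> 0"
proof (rule LIMSEQ_I)
  fix \<epsilon> :: real assume \<epsilon>: "\<epsilon> > 0"
  obtain \<kappa> where \<kappa>: "\<kappa> > 0" "\<And>n. \<kappa> \<le> (\<integral>z. kern k n (z::real^'n) \<partial>lborel)" using kern_mass by blast
  define r where "r = \<epsilon> / 2"
  have r: "r > 0" using \<epsilon> by (simp add: r_def)
  define D where "D = inverse (r\<^sup>2) ^ (2 * k) * measure lborel (cball (0::real^'n) (1/2))"
  have D0: "D \<ge> 0" by (simp add: D_def)
  have I: "integrable lborel (\<lambda>z. indicator (cball (0::real^'n) (1/2)) z :: real)"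
    using emeasure_bounded_finite[of "cball (0::real^'n) (1/2)"] by (intro integrable_real_indicator) auto
  have "(\<lambda>n. inverse \<kappa> * (reg n ^ k * D)) \<longlonglongrightarrow> inverse \<kappa> * (0 ^ k * D)"
    by (intro tendsto_intros reg_tendsto)
  then have "\<forall>\<^sub>F n in sequentially. inverse \<kappa> * (reg n ^ k * D) < \<epsilon> / 2"
    using \<epsilon> k by (intro order_tendstoD) (auto simp: power_0_left)
  then obtain n0 where n0: "\<And>n. n \<ge> n0 \<Longrightarrow> inverse \<kappa> * (reg n ^ k * D) < \<epsilon> / 2"
    by (auto simp: eventually_sequentially)
  have "norm (inverse (\<integral>z. kern k n (z::real^'n) \<partial>lborel) * (\<integral>z. norm z * kern k n (z::real^'n) \<partial>lborel) - 0) < \<epsilon>"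
    if n: "n \<ge> n0" for n
  proof -
    let ?m = "\<integral>z. kern k n (z::real^'n) \<partial>lborel" and ?M = "\<integral>z. norm z * kern k n (z::real^'n) \<partial>lborel"
    have m: "?m > 0" using \<kappa> by (meson less_le_trans)
    have le: "norm z * kern k n z \<le> r * kern k n z + (reg n ^ k * inverse (r\<^sup>2) ^ (2 * k)) * indicator (cball 0 (1/2)) z" for z :: "real^'n"
    proof (cases "norm z \<le> r \<or> norm z > 1/2")
      case True
      then show ?thesis
      proof
        assume "norm z \<le> r"
        then have "norm z * kern k n z \<le> r * kern k n z" by (intro mult_right_mono kern_nonneg)
        moreover have "0 \<le> (reg n ^ k * inverse (r\<^sup>2) ^ (2 * k)) * indicator (cball 0 (1/2)) z"
          using reg(1)[of n] by (simp add: indicator_def)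
        ultimately show ?thesis by linarith
      qed (simp add: kern_outside)
    next
      case False
      then have "r\<^sup>2 \<le> (norm z)\<^sup>2" using r by (intro power_mono) auto
      then have "r\<^sup>2 \<le> (norm z)\<^sup>2 + reg n" using reg(1)[of n] by linarith
      then have "inverse ((norm z)\<^sup>2 + reg n) \<le> inverse (r\<^sup>2)"
        using r by (intro le_imp_inverse_le) auto
      then have "inverse ((norm z)\<^sup>2 + reg n) ^ (2 * k) \<le> inverse (r\<^sup>2) ^ (2 * k)"
        using reg(1)[of n] by (intro power_mono) (auto intro: add_nonneg_nonneg less_imp_le)
      then have "kern k n z \<le> reg n ^ k * inverse (r\<^sup>2) ^ (2 * k)"
        using reg(1)[of n] False by (simp add: kern_def mult_left_mono)
      moreover have "norm z * kern k n z \<le> 1 * kern k n z" using False by (intro mult_right_mono kern_nonneg) auto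
      moreover have "0 \<le> r * kern k n z" using r by (simp add: kern_nonneg)
      ultimately show ?thesis using False by simp
    qed
    have i: "integrable lborel (\<lambda>z::real^'n. norm z * kern k n z)"
    proof (rule Bochner_Integration.integrable_bound[OF integrable_kern[of n]])
      have "norm (norm z * kern k n z) \<le> norm (kern k n z)" for z :: "real^'n"
        using kern_nonneg[of k n z] kern_outside[of z k n] mult_left_le_one_le[of "kern k n z" "norm z"]
        by (cases "norm z > 1/2") (auto simp: abs_mult)
      then show "AE z in lborel. norm (norm z * kern k n z) \<le> norm (kern k n (z::real^'n))" by simp
    qed measurable
    have "?M \<le> (\<integral>z. r * kern k n z + (reg n ^ k * inverse (r\<^sup>2) ^ (2 * k)) * indicator (cball (0::real^'n) (1/2)) z \<partial>lborel)"
      using I integrable_kern by (intro integral_mono i le Bochner_Integration.integrable_add integrable_mult_right) auto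
    also have "\<dots> = r * ?m + reg n ^ k * D"
      using I integrable_kern[of n] by (simp add: D_def)
    finally have "inverse ?m * ?M \<le> inverse ?m * (r * ?m + reg n ^ k * D)"
      using m by (intro mult_left_mono) auto
    also have "\<dots> = r + inverse ?m * (reg n ^ k * D)" using m by (simp add: field_simps)
    also have "\<dots> \<le> r + inverse \<kappa> * (reg n ^ k * D)"
      using \<kappa> D0 reg(1)[of n] by (intro add_left_mono mult_right_mono le_imp_inverse_le) auto
    also have "\<dots> < \<epsilon>" using n0[OF n] by (simp add: r_def)
    finally have "inverse ?m * ?M < \<epsilon>" .
    moreover have "0 \<le> inverse ?m * ?M"
      using m by (intro mult_nonneg_nonneg Bochner_Integration.integral_nonneg) (auto simp: kern_nonneg)
    ultimately show ?thesis by simp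
  qed
  then show "\<exists>no. \<forall>n\<ge>no. norm (inverse (\<integral>z. kern k n (z::real^'n) \<partial>lborel) * (\<integral>z. norm z * kern k n (z::real^'n) \<partial>lborel) - 0) < \<epsilon>"
    by blast
qed

text \<open>The equation is tested with \<open>theta n\<close> rescaled by \<open>\<delta>\<close>
  and centred at \<open>y\<close>. On the left appear a multiple of the kernel average and a bounded
  remainder supported where the volume density is comparable to
  \<open>inverse \<delta> ^ CARD('n)\<close>, so that 1 plus the squared norm of \<open>w\<close>
  controls it; on the right the same comparison lets the squared norms of \<open>f\<close> and
  \<open>theta n\<close> suffice. The bound is not homogeneous; \<open>euclidean_weak_scale\<close>
  repairs this.\<close>

lemma kern_average_bound:
  "\<exists>K>0. \<forall>w f :: real^'n \<Rightarrow> real. \<forall>\<delta> y n. euclidean_weak k w f \<longrightarrow> \<delta> > 0 \<longrightarrow> \<delta> \<le> 1 - norm y \<longrightarrow> 1 - norm y \<le> 2 * \<delta> \<longrightarrow>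
    \<bar>\<integral>x. w x * (inverse \<delta> ^ CARD('n) * kern k n ((x - y) /\<^sub>R \<delta>)) \<partial>lborel\<bar>
      \<le> K * (1 + (\<integral>x. conf x ^ CARD('n) * (w x)\<^sup>2 \<partial>lborel)
            + (\<integral>x. indicator (ball 0 1) x * (conf x ^ CARD('n) * (f x)\<^sup>2) \<partial>lborel))"
proof -
  obtain c C0 where cC: "c \<noteq> 0" "\<forall>n. \<forall>z::real^'n. norm z \<le> 1 \<longrightarrow>
     \<bar>(lap ^^ k) (theta n) z - c * (reg n ^ k * inverse ((norm z)\<^sup>2 + reg n) ^ (2 * k))\<bar> \<le> C0 \<and>
     \<bar>ln (pos_reg ((norm z)\<^sup>2 + reg n))\<bar> \<le> C0"
    using lap_funpow_theta[OF N k] by (elim exE conjE)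
  define C where "C = max C0 0"
  have C: "C \<ge> 0" "\<bar>(lap ^^ k) (theta n) z - c * (reg n ^ k * inverse ((norm z)\<^sup>2 + reg n) ^ (2 * k))\<bar> \<le> C"
    if "norm z \<le> 1" for n and z :: "real^'n"
    using cC(2) that by (auto simp: C_def le_max_iff_disj)
  obtain T0 where T0: "\<forall>n. integrable lborel (\<lambda>z::real^'n. (theta n z)\<^sup>2) \<and> (\<integral>z. (theta n (z::real^'n))\<^sup>2 \<partial>lborel) \<le> T0"
    using theta_L2_bound[OF N k] by (elim exE)
  define T where "T = max T0 0"
  have T: "T \<ge> 0" "integrable lborel (\<lambda>z::real^'n. (theta n z)\<^sup>2)" "(\<integral>z. (theta n (z::real^'n))\<^sup>2 \<partial>lborel) \<le> T" for n
    using T0 by (auto simp: T_def le_max_iff_disj)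
  define V where "V = measure lborel (cball (0::real^'n) (1/2))"
  have V: "V \<ge> 0" by (simp add: V_def)
  \<comment> \<open>\<open>C * V\<close> and \<open>C * (5/2) ^ CARD('n)\<close> come from the
    remainder, \<open>4 ^ CARD('n) * T\<close> from the logarithm on the right hand side, the
    summand 1 from \<open>f\<close>; the inverse removes the constant of the kernel.\<close>
  define K where "K = inverse \<bar>c\<bar> * (C * V + C * (5/2) ^ CARD('n) + 1 + 4 ^ CARD('n) * T)"
  have C0: "C \<ge> 0" using C(1)[of 0] by simp
  have "0 < C * V + C * (5/2) ^ CARD('n) + 1 + 4 ^ CARD('n) * T"
    using C0 V T(1) by (intro add_pos_nonneg add_nonneg_pos add_nonneg_nonneg mult_nonneg_nonneg) auto
  then have K: "K > 0" using cC(1) by (simp add: K_def)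
  have "\<bar>\<integral>x. w x * (inverse \<delta> ^ CARD('n) * kern k n ((x - y) /\<^sub>R \<delta>)) \<partial>lborel\<bar>
      \<le> K * (1 + (\<integral>x. conf x ^ CARD('n) * (w x)\<^sup>2 \<partial>lborel)
            + (\<integral>x. indicator (ball 0 1) x * (conf x ^ CARD('n) * (f x)\<^sup>2) \<partial>lborel))"
    if ew: "euclidean_weak k w f" and \<delta>: "\<delta> > 0" "\<delta> \<le> 1 - norm y" "1 - norm y \<le> 2 * \<delta>"
    for w f :: "real^'n \<Rightarrow> real" and \<delta> y n
  proof -
    let ?A = "\<integral>x. conf x ^ CARD('n) * (w x)\<^sup>2 \<partial>lborel"
    let ?B = "\<integral>x. indicator (ball 0 1) x * (conf x ^ CARD('n) * (f x)\<^sup>2) \<partial>lborel"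
    have [measurable]: "w \<in> borel_measurable borel" "f \<in> borel_measurable borel" using ew by (auto simp: euclidean_weak_def)
    have w0: "\<And>x. x \<notin> ball 0 1 \<Longrightarrow> w x = 0"
      and A: "integrable lborel (\<lambda>x. conf x ^ CARD('n) * (w x)\<^sup>2)"
      and B: "integrable lborel (\<lambda>x. indicator (ball 0 1) x * (conf x ^ CARD('n) * (f x)\<^sup>2))"
      and eq: "\<And>v. v \<in> test_functions \<Longrightarrow> (\<integral>x. w x * ((-1) ^ k * (lap ^^ k) v x) \<partial>lborel)
        = (\<integral>x. conf x ^ CARD('n) * (f x * v x) \<partial>lborel)"
      using ew by (auto simp: euclidean_weak_def simp del: mem_ball)
    have wi: "integrable lborel w" by (rule L1_bound_of_hyperbolic_L2(1)[OF _ w0 A, of 1]) auto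
    have \<delta>0: "\<delta> \<noteq> 0" using \<delta> by simp
    let ?h = "\<lambda>x. (x - y) /\<^sub>R \<delta>" and ?b = "cball y (\<delta> / 2)"
    have hb: "norm (?h x) \<le> 1/2 \<longleftrightarrow> x \<in> ?b" for x
    proof -
      have hn: "norm (?h x) = dist y x / \<delta>"
        using \<delta>(1) by (simp only: norm_scaleR dist_norm norm_minus_commute[of y]) (simp add: divide_inverse mult.commute)
      show ?thesis unfolding hn mem_cball using \<delta>(1) by (simp add: field_simps)
    qed
    have bconf: "x \<in> ball 0 1" "inverse \<delta> \<le> (5 / 2) * conf x" "conf x \<le> 4 * inverse \<delta>" if "x \<in> ?b" for x
      using conf_bounds[OF \<delta>, of x] that by auto
    define v where "v x = theta n (?h x)" for x
    have v0: "v x = 0" if "x \<notin> ?b" for x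
      using theta_outside[of "?h x" n] hb[of x] that unfolding v_def by linarith
    have v: "v \<in> test_functions"
    proof (rule test_functionsI[of v ?b])
      show "smooth v" unfolding v_def[abs_def] by (rule smooth_scaled[OF \<delta>0 smooth_theta])
      show "?b \<subseteq> ball 0 1" using bconf(1) by blast
    qed (auto intro: v0)
    have [measurable]: "v \<in> borel_measurable borel" by (rule test_measurable[OF v])
    have [measurable]: "(lap ^^ k) (theta n) \<in> borel_measurable (borel :: (real^'n) measure)"
      by (intro borel_measurable_continuous_onI smooth_continuous smooth_lap_funpow smooth_theta)
    have b[measurable]: "?b \<in> sets borel" by simp
    \<comment> \<open>The cut-off in \<open>kern\<close> matches the radius beyond which
      \<open>theta n\<close> vanishes, so the remainder is supported in \<open>?b\<close> as
      well.\<close>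
    define R where "R x = (lap ^^ k) (theta n) (?h x) - c * kern k n (?h x)" for x
    have [measurable]: "R \<in> borel_measurable borel" unfolding R_def[abs_def] by measurable
    have R: "\<bar>R x\<bar> \<le> C * indicator ?b x" for x
    proof (cases "x \<in> ?b")
      case True
      then have z: "norm (?h x) \<le> 1/2" using hb by blast
      then have "kern k n (?h x) = reg n ^ k * inverse ((norm (?h x))\<^sup>2 + reg n) ^ (2 * k)"
        by (simp add: kern_def)
      then show ?thesis using C(2)[of "?h x" n] z True by (simp add: R_def)
    next
      case False
      then have "norm (?h x) > 1/2" using hb[of x] by linarith
      then show ?thesis using False by (simp add: R_def kern_outside lap_funpow_theta_outside)
    qed
    let ?d = "inverse \<delta> ^ CARD('n)"
    have d0: "?d > 0" using \<delta> by simp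
    \<comment> \<open>The power \<open>2 * k\<close> from \<open>lap_funpow_scaled\<close> is the
      dimension.\<close>
    have lapv: "(lap ^^ k) v x = ?d * (c * kern k n (?h x) + R x)" for x
      using fun_cong[OF lap_funpow_scaled[OF \<delta>0 smooth_theta, of k n y], of x]
      by (simp add: v_def[abs_def] R_def N)
    have iR: "integrable lborel (\<lambda>x. w x * R x)"
    proof (rule Bochner_Integration.integrable_bound[OF integrable_mult_right[OF wi, of C]])
      have "norm (w x * R x) \<le> norm (C * w x)" for x
      proof -
        have "\<bar>R x\<bar> \<le> C" using R[of x] C0 by (cases "x \<in> ?b") auto
        then have "\<bar>w x\<bar> * \<bar>R x\<bar> \<le> \<bar>w x\<bar> * C" by (intro mult_left_mono) auto
        then show ?thesis using C0 by (simp add: abs_mult mult.commute)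
      qed
      then show "AE x in lborel. norm (w x * R x) \<le> norm (C * w x)" by simp
    qed measurable
    have iK: "integrable lborel (\<lambda>x. w x * kern k n (?h x))"
    proof (rule Bochner_Integration.integrable_bound[OF integrable_mult_right[OF wi, of "reg n ^ k * inverse (reg n) ^ (2 * k)"]])
      have "norm (w x * kern k n (?h x)) \<le> norm ((reg n ^ k * inverse (reg n) ^ (2 * k)) * w x)" for x
      proof -
        have "\<bar>w x\<bar> * kern k n (?h x) \<le> \<bar>w x\<bar> * \<bar>reg n ^ k * inverse (reg n) ^ (2 * k)\<bar>"
          using kern_le[of k n "?h x"] by (intro mult_left_mono) auto
        then show ?thesis unfolding real_norm_def abs_mult[of "w x"] abs_mult[of _ "w x"]
          using kern_nonneg[of k n "?h x"] by (simp add: mult.commute)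
      qed
      then show "AE x in lborel. norm (w x * kern k n (?h x)) \<le> norm ((reg n ^ k * inverse (reg n) ^ (2 * k)) * w x)" by simp
    qed measurable
    let ?I = "\<integral>x. w x * (?d * kern k n (?h x)) \<partial>lborel"
    have "(\<integral>x. w x * ((-1) ^ k * (lap ^^ k) v x) \<partial>lborel)
      = (\<integral>x. (-1) ^ k * (?d * c * (w x * kern k n (?h x)) + ?d * (w x * R x)) \<partial>lborel)"
      unfolding lapv by (simp add: algebra_simps)
    also have "\<dots> = (-1) ^ k * (?d * c * (\<integral>x. w x * kern k n (?h x) \<partial>lborel) + ?d * (\<integral>x. w x * R x \<partial>lborel))"
      by (simp only: integral_mult_right_zero Bochner_Integration.integral_add[OF integrable_mult_right[OF iK] integrable_mult_right[OF iR]])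
    also have "?d * c * (\<integral>x. w x * kern k n (?h x) \<partial>lborel) = c * ?I"
    proof -
      have "?I = (\<integral>x. ?d * (w x * kern k n (?h x)) \<partial>lborel)"
        by (rule Bochner_Integration.integral_cong[OF refl]) (simp only: mult.left_commute)
      also have "\<dots> = ?d * (\<integral>x. w x * kern k n (?h x) \<partial>lborel)" by (rule integral_mult_right_zero)
      finally have Ieq: "?I = \<dots>" .
      show ?thesis unfolding Ieq by (simp only: mult_ac)
    qed
    finally have "(\<integral>x. w x * ((-1) ^ k * (lap ^^ k) v x) \<partial>lborel) = (-1) ^ k * (c * ?I + ?d * (\<integral>x. w x * R x \<partial>lborel))" .
    from trans[OF this[symmetric] eq[OF v]]
    have "\<bar>(-1) ^ k * (c * ?I + ?d * (\<integral>x. w x * R x \<partial>lborel))\<bar> = \<bar>\<integral>x. conf x ^ CARD('n) * (f x * v x) \<partial>lborel\<bar>"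
      by (rule arg_cong)
    moreover have "\<bar>(-1) ^ k * X\<bar> = \<bar>X\<bar>" for X :: real by (simp add: abs_mult power_abs)
    ultimately have "\<bar>c * ?I + ?d * (\<integral>x. w x * R x \<partial>lborel)\<bar> = \<bar>\<integral>x. conf x ^ CARD('n) * (f x * v x) \<partial>lborel\<bar>" by metis
    then have main: "\<bar>c\<bar> * \<bar>?I\<bar> \<le> \<bar>\<integral>x. conf x ^ CARD('n) * (f x * v x) \<partial>lborel\<bar> + \<bar>?d * (\<integral>x. w x * R x \<partial>lborel)\<bar>"
      unfolding abs_mult[of c ?I, symmetric] by linarith
    have Ib: "integrable lborel (\<lambda>x. indicator ?b x :: real)"
      using emeasure_bounded_finite[of ?b] by (intro integrable_real_indicator) auto
    have volb: "(\<integral>x. indicator ?b x \<partial>lborel) = \<delta> ^ CARD('n) * V"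
    proof -
      have "(\<integral>x. (indicator ?b x :: real) \<partial>lborel) = \<delta> ^ CARD('n) * (\<integral>z. indicator ?b (y + \<delta> *\<^sub>R z) \<partial>lborel)"
        using integral_lborel_scale(1)[OF \<delta>(1), of "\<lambda>x. indicator ?b x" y] by simp
      also have "(\<lambda>z. indicator ?b (y + \<delta> *\<^sub>R z) :: real) = indicator (cball 0 (1/2))"
        using \<delta>(1) by (auto simp: indicator_def fun_eq_iff dist_norm)
      finally show ?thesis by (simp add: V_def)
    qed
    have dd: "?d * \<delta> ^ CARD('n) = 1" unfolding power_mult_distrib[symmetric] using \<delta> by simp
    have "\<bar>?d * (\<integral>x. w x * R x \<partial>lborel)\<bar> \<le> (\<integral>x. \<bar>?d * (w x * R x)\<bar> \<partial>lborel)"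
      using integral_abs_bound[of lborel "\<lambda>x. ?d * (w x * R x)"] by simp
    also have "\<dots> \<le> (\<integral>x. C * (?d * indicator ?b x + (5/2) ^ CARD('n) * (conf x ^ CARD('n) * (w x)\<^sup>2)) \<partial>lborel)"
    proof (rule integral_mono)
      show "integrable lborel (\<lambda>x. \<bar>?d * (w x * R x)\<bar>)" using iR by simp
      show "integrable lborel (\<lambda>x. C * (?d * indicator ?b x + (5/2) ^ CARD('n) * (conf x ^ CARD('n) * (w x)\<^sup>2)))"
        using Ib A by simp
      fix x
      have cw: "0 \<le> conf x ^ CARD('n) * (w x)\<^sup>2"
        using w0[of x] conf_pos[of x] by (cases "x \<in> ball 0 1") (auto simp: less_imp_le)
      show "\<bar>?d * (w x * R x)\<bar> \<le> C * (?d * indicator ?b x + (5/2) ^ CARD('n) * (conf x ^ CARD('n) * (w x)\<^sup>2))"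
      proof (cases "x \<in> ?b")
        case True
        \<comment> \<open>Only squares are integrable against the volume density, hence this
          replacement; the 1 integrates to \<open>V\<close> after rescaling.\<close>
        have "\<bar>w x\<bar> \<le> 1 + (w x)\<^sup>2" using abs_mult_le_squares[of 1 "w x"] by simp
        then have "?d * \<bar>w x\<bar> \<le> ?d * (1 + (w x)\<^sup>2)" using d0 by (intro mult_left_mono) auto
        moreover have "?d * (1 + (w x)\<^sup>2) = ?d * 1 + ?d * (w x)\<^sup>2" by (rule distrib_left)
        moreover have "?d \<le> ((5 / 2) * conf x) ^ CARD('n)"
          using bconf(2)[OF True] \<delta> by (intro power_mono) auto
        then have "?d * (w x)\<^sup>2 \<le> ((5 / 2) * conf x) ^ CARD('n) * (w x)\<^sup>2" by (intro mult_right_mono) auto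
        moreover have "((5 / 2) * conf x) ^ CARD('n) * (w x)\<^sup>2 = (5/2) ^ CARD('n) * (conf x ^ CARD('n) * (w x)\<^sup>2)"
          by (simp only: power_mult_distrib mult.assoc)
        ultimately have "?d * \<bar>w x\<bar> \<le> ?d * 1 + (5/2) ^ CARD('n) * (conf x ^ CARD('n) * (w x)\<^sup>2)" by linarith
        then have "C * (?d * \<bar>w x\<bar>) \<le> C * (?d * 1 + (5/2) ^ CARD('n) * (conf x ^ CARD('n) * (w x)\<^sup>2))"
          using C0 by (intro mult_left_mono)
        moreover have "\<bar>?d * (w x * R x)\<bar> \<le> C * (?d * \<bar>w x\<bar>)"
        proof -
          have "\<bar>R x\<bar> \<le> C" using R[of x] True by simp
          then have "(?d * \<bar>w x\<bar>) * \<bar>R x\<bar> \<le> (?d * \<bar>w x\<bar>) * C" using d0 by (intro mult_left_mono) auto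
          then show ?thesis using d0 by (simp add: abs_mult mult_ac)
        qed
        ultimately show ?thesis using True by simp
      next
        case False
        then have "R x = 0" using R[of x] by simp
        then show ?thesis using cw C0 False by simp
      qed
    qed
    also have "\<dots> = C * (?d * (\<delta> ^ CARD('n) * V) + (5/2) ^ CARD('n) * ?A)"
      using Ib A volb by simp
    also have "?d * (\<delta> ^ CARD('n) * V) = V" unfolding mult.assoc[symmetric] dd by simp
    finally have t1: "\<bar>?d * (\<integral>x. w x * R x \<partial>lborel)\<bar> \<le> C * (V + (5/2) ^ CARD('n) * ?A)" .
    have th: "integrable lborel (\<lambda>x. (theta n (?h x))\<^sup>2)" "(\<integral>x. (theta n (?h x))\<^sup>2 \<partial>lborel) = \<delta> ^ CARD('n) * (\<integral>z. (theta n (z::real^'n))\<^sup>2 \<partial>lborel)"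
    proof -
      have [measurable]: "theta n \<in> borel_measurable (borel :: (real^'n) measure)"
        by (intro borel_measurable_continuous_onI smooth_continuous smooth_theta)
      have m: "(\<lambda>x. (theta n (?h x))\<^sup>2) \<in> borel_measurable borel" by measurable
      have e: "(\<lambda>z. (theta n (?h (y + \<delta> *\<^sub>R z)))\<^sup>2) = (\<lambda>z. (theta n z)\<^sup>2)" using \<delta>0 by simp
      show "integrable lborel (\<lambda>x. (theta n (?h x))\<^sup>2)"
        using integral_lborel_scale(2)[OF \<delta>(1) m, of y] T(2)[of n] unfolding e by blast
      show "(\<integral>x. (theta n (?h x))\<^sup>2 \<partial>lborel) = \<delta> ^ CARD('n) * (\<integral>z. (theta n (z::real^'n))\<^sup>2 \<partial>lborel)"
        using integral_lborel_scale(1)[OF \<delta>(1) m, of y] unfolding e by simp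
    qed
    let ?G = "\<lambda>x. indicator (ball 0 1) x * (conf x ^ CARD('n) * (f x)\<^sup>2) + (4 * inverse \<delta>) ^ CARD('n) * (theta n (?h x))\<^sup>2"
    have G: "integrable lborel ?G" using B th(1) by simp
    have leG: "\<bar>conf x ^ CARD('n) * (f x * v x)\<bar> \<le> ?G x" for x
    proof (cases "x \<in> ?b")
      case True
      have c0: "0 < conf x ^ CARD('n)" using conf_pos[OF bconf(1)[OF True]] by simp
      have "\<bar>conf x ^ CARD('n) * (f x * v x)\<bar> = conf x ^ CARD('n) * \<bar>f x * v x\<bar>" using c0 by (simp add: abs_mult)
      also have "\<dots> \<le> conf x ^ CARD('n) * ((f x)\<^sup>2 + (v x)\<^sup>2)"
        using c0 by (intro mult_left_mono abs_mult_le_squares) auto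
      also have "\<dots> \<le> conf x ^ CARD('n) * (f x)\<^sup>2 + (4 * inverse \<delta>) ^ CARD('n) * (v x)\<^sup>2"
        using bconf(3)[OF True] conf_pos[OF bconf(1)[OF True]]
        unfolding distrib_left by (intro add_left_mono mult_right_mono power_mono) auto
      finally show ?thesis using bconf(1)[OF True] by (simp add: v_def)
    next
      case False
      have "0 \<le> indicator (ball 0 1) x * (conf x ^ CARD('n) * (f x)\<^sup>2)"
        using conf_pos[of x] by (auto simp: indicator_def less_imp_le)
      moreover have "0 \<le> (4 * inverse \<delta>) ^ CARD('n) * (theta n (?h x))\<^sup>2" using \<delta> by simp
      ultimately show ?thesis using v0[OF False] by simp
    qed
    have "\<bar>\<integral>x. conf x ^ CARD('n) * (f x * v x) \<partial>lborel\<bar> \<le> (\<integral>x. \<bar>conf x ^ CARD('n) * (f x * v x)\<bar> \<partial>lborel)"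
      by (rule integral_abs_bound)
    also have "\<dots> \<le> (\<integral>x. ?G x \<partial>lborel)"
    proof (rule integral_mono)
      have "integrable lborel (\<lambda>x. conf x ^ CARD('n) * (f x * v x))"
      proof (rule Bochner_Integration.integrable_bound[OF G])
        show "AE x in lborel. norm (conf x ^ CARD('n) * (f x * v x)) \<le> norm (?G x)"
          unfolding real_norm_def by (intro AE_I2 order_trans[OF leG abs_ge_self])
      qed measurable
      then show "integrable lborel (\<lambda>x. \<bar>conf x ^ CARD('n) * (f x * v x)\<bar>)" by simp
    qed (use G leG in auto)
    also have "\<dots> = ?B + (4 * inverse \<delta>) ^ CARD('n) * (\<delta> ^ CARD('n) * (\<integral>z. (theta n (z::real^'n))\<^sup>2 \<partial>lborel))"
      using B th by simp
    also have "\<dots> = ?B + 4 ^ CARD('n) * (?d * \<delta> ^ CARD('n)) * (\<integral>z. (theta n (z::real^'n))\<^sup>2 \<partial>lborel)"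
      by (simp add: power_mult_distrib mult_ac)
    also have "\<dots> \<le> ?B + 4 ^ CARD('n) * T" unfolding dd using T(3)[of n] by simp
    finally have t2: "\<bar>\<integral>x. conf x ^ CARD('n) * (f x * v x) \<partial>lborel\<bar> \<le> ?B + 4 ^ CARD('n) * T" .
    have A0: "?A \<ge> 0"
    proof (rule Bochner_Integration.integral_nonneg)
      show "0 \<le> conf x ^ CARD('n) * (w x)\<^sup>2" for x
        using w0[of x] conf_pos[of x] by (cases "x \<in> ball 0 1") (auto simp: less_imp_le)
    qed
    have B0: "?B \<ge> 0"
    proof (rule Bochner_Integration.integral_nonneg)
      show "0 \<le> indicator (ball 0 1) x * (conf x ^ CARD('n) * (f x)\<^sup>2)" for x
        using conf_pos[of x] by (auto simp: indicator_def less_imp_le)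
    qed
    define S where "S = C * V + C * (5/2) ^ CARD('n) + 1 + 4 ^ CARD('n) * T"
    have S: "C * V + 4 ^ CARD('n) * T \<le> S" "C * (5/2) ^ CARD('n) \<le> S" "1 \<le> S"
    proof -
      have "0 \<le> C * V" "0 \<le> C * (5/2) ^ CARD('n)" "0 \<le> 4 ^ CARD('n) * T" using C0 V T(1) by simp_all
      then show "C * V + 4 ^ CARD('n) * T \<le> S" "C * (5/2) ^ CARD('n) \<le> S" "1 \<le> S" unfolding S_def by linarith+
    qed
    have "\<bar>c\<bar> * \<bar>?I\<bar> \<le> (C * V + 4 ^ CARD('n) * T) + (C * (5/2) ^ CARD('n)) * ?A + 1 * ?B"
      using main t1 t2 by (simp add: algebra_simps)
    also have "\<dots> \<le> S + S * ?A + S * ?B"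
      using S A0 B0 by (intro add_mono mult_right_mono) auto
    finally have "\<bar>c\<bar> * \<bar>?I\<bar> \<le> S * (1 + ?A + ?B)" by (simp add: algebra_simps)
    then have "inverse \<bar>c\<bar> * (\<bar>c\<bar> * \<bar>?I\<bar>) \<le> inverse \<bar>c\<bar> * (S * (1 + ?A + ?B))" by (intro mult_left_mono) auto
    moreover have "inverse \<bar>c\<bar> * (\<bar>c\<bar> * \<bar>?I\<bar>) = \<bar>?I\<bar>" using cC(1) by simp
    moreover have "inverse \<bar>c\<bar> * (S * (1 + ?A + ?B)) = K * (1 + ?A + ?B)" by (simp only: K_def S_def mult.assoc)
    ultimately show ?thesis by linarith
  qed
  then show ?thesis using K by blast
qed

end

context
  fixes k :: nat
  assumes N: "CARD('n::finite) = 2 * k" and k: "k \<ge> 1"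
begin

text \<open>\<open>kern_average_bound\<close> controls the averages centred in the shell
  \<open>\<delta> \<le> 1 - norm y \<le> 2 * \<delta>\<close> with a constant independent of
  \<open>\<delta>\<close>. In each shell the approximate identity gives the pointwise bound, and
  countably many dyadic shells cover the ball. The approximation hypothesis supplies test functions
  close in \<open>L^1\<close>.\<close>

lemma euclidean_weak_bound:
  "\<exists>C>0. \<forall>w f :: real^'n \<Rightarrow> real. euclidean_weak k w f \<longrightarrow>
    (\<forall>\<eta>>0. \<exists>v\<in>test_functions. integrable lborel (\<lambda>x. conf x ^ CARD('n) * (w x - v x)\<^sup>2) \<and>
       (\<integral>x. conf x ^ CARD('n) * (w x - v x)\<^sup>2 \<partial>lborel) \<le> \<eta>) \<longrightarrow>
    (AE x in lborel. x \<in> ball 0 1 \<longrightarrow> \<bar>w x\<bar> \<le> C * (1 + (\<integral>x. conf x ^ CARD('n) * (w x)\<^sup>2 \<partial>lborel)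
            + (\<integral>x. indicator (ball 0 1) x * (conf x ^ CARD('n) * (f x)\<^sup>2) \<partial>lborel)))"
proof -
  obtain \<kappa> where \<kappa>: "\<kappa> > 0" "\<forall>n. \<kappa> \<le> (\<integral>z. kern k n (z::real^'n) \<partial>lborel)"
    using kern_mass[OF N k] by (elim exE conjE)
  obtain K where K: "K > 0" "\<forall>w f :: real^'n \<Rightarrow> real. \<forall>\<delta> y n. euclidean_weak k w f \<longrightarrow> \<delta> > 0 \<longrightarrow> \<delta> \<le> 1 - norm y \<longrightarrow> 1 - norm y \<le> 2 * \<delta> \<longrightarrow>
    \<bar>\<integral>x. w x * (inverse \<delta> ^ CARD('n) * kern k n ((x - y) /\<^sub>R \<delta>)) \<partial>lborel\<bar>
      \<le> K * (1 + (\<integral>x. conf x ^ CARD('n) * (w x)\<^sup>2 \<partial>lborel)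
            + (\<integral>x. indicator (ball 0 1) x * (conf x ^ CARD('n) * (f x)\<^sup>2) \<partial>lborel))"
    using kern_average_bound[OF N k] by (elim exE conjE)
  define mass where "mass n = (\<integral>z. kern k n (z::real^'n) \<partial>lborel)" for n
  have mass: "mass n > 0" "\<kappa> \<le> mass n" for n using \<kappa> unfolding mass_def by (auto intro: less_le_trans)
  have "AE x in lborel. x \<in> ball 0 1 \<longrightarrow> \<bar>w x\<bar> \<le> (inverse \<kappa> * K) * (1 + (\<integral>x. conf x ^ CARD('n) * (w x)\<^sup>2 \<partial>lborel)
            + (\<integral>x. indicator (ball 0 1) x * (conf x ^ CARD('n) * (f x)\<^sup>2) \<partial>lborel))"
    if ew: "euclidean_weak k w f"
      and ap: "\<And>\<eta>. \<eta> > 0 \<Longrightarrow> \<exists>v\<in>test_functions. integrable lborel (\<lambda>x. conf x ^ CARD('n) * (w x - v x)\<^sup>2) \<and>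
       (\<integral>x. conf x ^ CARD('n) * (w x - v x)\<^sup>2 \<partial>lborel) \<le> \<eta>" for w f :: "real^'n \<Rightarrow> real"
  proof -
    define D where "D = K * (1 + (\<integral>x. conf x ^ CARD('n) * (w x)\<^sup>2 \<partial>lborel)
            + (\<integral>x. indicator (ball 0 1) x * (conf x ^ CARD('n) * (f x)\<^sup>2) \<partial>lborel))"
    have [measurable]: "w \<in> borel_measurable borel" using ew by (simp add: euclidean_weak_def)
    have w0: "\<And>x. x \<notin> ball 0 1 \<Longrightarrow> w x = 0" and A: "integrable lborel (\<lambda>x. conf x ^ CARD('n) * (w x)\<^sup>2)"
      using ew by (auto simp: euclidean_weak_def simp del: mem_ball)
    have wi: "integrable lborel w" by (rule L1_bound_of_hyperbolic_L2(1)[OF _ w0 A, of 1]) auto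
    have D: "\<bar>\<integral>x. w x * (inverse \<delta> ^ CARD('n) * kern k n ((x - y) /\<^sub>R \<delta>)) \<partial>lborel\<bar> \<le> D"
      if "\<delta> > 0" "\<delta> \<le> 1 - norm y" "1 - norm y \<le> 2 * \<delta>" for \<delta> y n
      unfolding D_def using K(2) ew that by blast
    have shell: "AE y in lborel. y \<in> {y. \<delta> \<le> 1 - norm y \<and> 1 - norm y \<le> 2 * \<delta>} \<longrightarrow> \<bar>w y\<bar> \<le> inverse \<kappa> * D"
      if \<delta>: "0 < \<delta>" "\<delta> \<le> 1/2" for \<delta>
    proof (rule AE_bound_approximate_identity[where p = "\<lambda>n z. inverse (mass n) * (inverse \<delta> ^ CARD('n) * kern k n (z /\<^sub>R \<delta>))"])
      let ?p = "\<lambda>n (z::real^'n). inverse (mass n) * (inverse \<delta> ^ CARD('n) * kern k n (z /\<^sub>R \<delta>))"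
      have dim: "DIM(real^'n) = CARD('n)" by simp
      show pm[measurable]: "?p n \<in> borel_measurable borel" for n by measurable
      have psc: "?p n (0 + \<delta> *\<^sub>R z) = inverse (mass n) * inverse \<delta> ^ CARD('n) * kern k n z" for n z
        using \<delta> by simp
      have dd: "\<delta> ^ CARD('n) * inverse \<delta> ^ CARD('n) = 1" unfolding power_mult_distrib[symmetric] using \<delta> by simp
      show "0 \<le> ?p n z" for n z using mass(1)[of n] \<delta> by (simp add: kern_nonneg)
      have ik: "integrable lborel (kern k n :: real^'n \<Rightarrow> real)" for n by (rule integrable_kern[OF N k])
      show "integrable lborel (?p n)" for n
      proof -
        have "integrable lborel (\<lambda>z. ?p n (0 + \<delta> *\<^sub>R z))" unfolding psc by (intro integrable_mult_right ik)
        then show ?thesis using integral_lborel_scale(2)[OF \<delta>(1) pm[of n], of 0] by blast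
      qed
      show "(\<integral>z. ?p n z \<partial>lborel) = 1" for n
      proof -
        have "(\<integral>z. ?p n z \<partial>lborel) = \<delta> ^ CARD('n) * (\<integral>z. inverse (mass n) * inverse \<delta> ^ CARD('n) * kern k n (z::real^'n) \<partial>lborel)"
          using integral_lborel_scale(1)[OF \<delta>(1) pm[of n], of 0] unfolding psc dim .
        also have "\<dots> = \<delta> ^ CARD('n) * inverse \<delta> ^ CARD('n) * (inverse (mass n) * mass n)"
          unfolding integral_mult_right_zero mass_def by (simp only: mult_ac)
        also have "\<dots> = 1" unfolding dd using mass(1)[of n] by simp
        finally show ?thesis .
      qed
      show "\<exists>B. \<forall>z. ?p n z \<le> B" for n
      proof (intro exI allI)
        show "?p n z \<le> inverse (mass n) * (inverse \<delta> ^ CARD('n) * (reg n ^ k * inverse (reg n) ^ (2 * k)))" for z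
          using mass(1)[of n] \<delta> by (intro mult_left_mono kern_le) auto
      qed
      show "?p n z = 0" if "norm z > 1" for n z
      proof -
        have "\<delta> * (1/2) < norm z * 1" using that \<delta> by linarith
        then have "1 / 2 < norm (z /\<^sub>R \<delta>)" using \<delta> by (simp add: field_simps)
        then show ?thesis by (simp add: kern_outside)
      qed
      show "(\<lambda>n. \<integral>z. norm z * ?p n z \<partial>lborel) \<longlonglongrightarrow> 0"
      proof -
        have "(\<integral>z. norm z * ?p n z \<partial>lborel) = \<delta> * (inverse (mass n) * (\<integral>z. norm z * kern k n (z::real^'n) \<partial>lborel))" for n
        proof -
          have m: "(\<lambda>z. norm z * ?p n z) \<in> borel_measurable borel" by measurable
          have e: "norm (0 + \<delta> *\<^sub>R z) * ?p n (0 + \<delta> *\<^sub>R z) = (\<delta> * inverse (mass n) * inverse \<delta> ^ CARD('n)) * (norm z * kern k n z)" for z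
            unfolding psc using \<delta> by simp
          have "(\<integral>z. norm z * ?p n z \<partial>lborel) = \<delta> ^ CARD('n) * ((\<delta> * inverse (mass n) * inverse \<delta> ^ CARD('n)) * (\<integral>z. norm z * kern k n (z::real^'n) \<partial>lborel))"
            using integral_lborel_scale(1)[OF \<delta>(1) m, of 0] unfolding e integral_mult_right_zero dim .
          also have "\<dots> = (\<delta> ^ CARD('n) * inverse \<delta> ^ CARD('n)) * (\<delta> * (inverse (mass n) * (\<integral>z. norm z * kern k n (z::real^'n) \<partial>lborel)))"
            by (simp only: mult_ac)
          finally show ?thesis unfolding dd by simp
        qed
        then show ?thesis using tendsto_mult_left[OF kern_moment[OF N k], of \<delta>] unfolding mass_def by simp
      qed
      show "\<exists>v\<in>test_functions. (\<integral>\<^sup>+x. ennreal \<bar>w x - v x\<bar> \<partial>lborel) \<le> ennreal \<eta>" if \<eta>: "\<eta> > 0" for \<eta>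
      proof -
        let ?V = "measure lborel (ball (0::real^'n) 1)"
        define U where "U = ?V + 1"
        \<comment> \<open>The volume term then takes at most half of \<open>\<eta>\<close>, and a
          weighted norm of at most \<open>a * \<eta> / 2\<close> leaves the other half.\<close>
        define a where "a = \<eta> / (2 * U)"
        have U: "U > 0" "?V \<le> U" by (auto simp: U_def add_nonneg_pos)
        have a: "a > 0" using \<eta> U by (simp add: a_def)
        have "a * ?V \<le> a * U" using a U by (intro mult_left_mono) auto
        also have "a * U = \<eta> / 2" using U by (simp add: a_def)
        finally have aV: "a * ?V \<le> \<eta> / 2" .
        obtain v where v: "v \<in> test_functions" "integrable lborel (\<lambda>x. conf x ^ CARD('n) * (w x - v x)\<^sup>2)"
          "(\<integral>x. conf x ^ CARD('n) * (w x - v x)\<^sup>2 \<partial>lborel) \<le> a * \<eta> / 2"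
          using ap[of "a * \<eta> / 2"] a \<eta> by auto
        have [measurable]: "v \<in> borel_measurable borel" by (rule test_measurable[OF v(1)])
        have "(\<integral>\<^sup>+x. ennreal \<bar>w x - v x\<bar> \<partial>lborel) \<le> ennreal (a * ?V + inverse a * (\<integral>x. conf x ^ CARD('n) * (w x - v x)\<^sup>2 \<partial>lborel))"
          by (rule L1_bound_of_hyperbolic_L2(2)[OF _ _ v(2) a]) (use w0 test_outside[OF v(1)] in auto)
        also have "\<dots> \<le> ennreal \<eta>"
        proof (rule ennreal_leI)
          have "inverse a * (\<integral>x. conf x ^ CARD('n) * (w x - v x)\<^sup>2 \<partial>lborel) \<le> inverse a * (a * \<eta> / 2)"
            using v(3) a by (intro mult_left_mono) auto
          also have "\<dots> = \<eta> / 2" using a by simp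
          finally show "a * ?V + inverse a * (\<integral>x. conf x ^ CARD('n) * (w x - v x)\<^sup>2 \<partial>lborel) \<le> \<eta>" using aV by linarith
        qed
        finally show ?thesis using v(1) by blast
      qed
      show "{y::real^'n. \<delta> \<le> 1 - norm y \<and> 1 - norm y \<le> 2 * \<delta>} \<in> sets borel" by measurable
      show "\<bar>\<integral>z. w (y + z) * ?p n z \<partial>lborel\<bar> \<le> inverse \<kappa> * D" if "y \<in> {y. \<delta> \<le> 1 - norm y \<and> 1 - norm y \<le> 2 * \<delta>}" for y n
      proof -
        let ?q = "\<lambda>x. w x * (inverse \<delta> ^ CARD('n) * kern k n ((x - y) /\<^sub>R \<delta>))"
        have m: "?q \<in> borel_measurable borel" by measurable
        have "(\<integral>z. w (y + z) * ?p n z \<partial>lborel) = (\<integral>z. inverse (mass n) * ?q (y + 1 *\<^sub>R z) \<partial>lborel)"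
          by (rule Bochner_Integration.integral_cong[OF refl]) (simp add: mult_ac)
        also have "\<dots> = inverse (mass n) * (\<integral>x. ?q x \<partial>lborel)"
          unfolding integral_mult_right_zero using integral_lborel_scale(1)[OF zero_less_one m, of y] by simp
        finally have "\<bar>\<integral>z. w (y + z) * ?p n z \<partial>lborel\<bar> = inverse (mass n) * \<bar>\<integral>x. ?q x \<partial>lborel\<bar>"
          using mass(1)[of n] by (simp add: abs_mult)
        also have "\<dots> \<le> inverse \<kappa> * D"
          using mass[of n] \<kappa>(1) D[OF \<delta>(1), of y n] that by (intro mult_mono le_imp_inverse_le) auto
        finally show ?thesis .
      qed
    qed (use wi in measurable)
    have "AE y in lborel. \<forall>j. y \<in> {y. (1/2) ^ Suc j \<le> 1 - norm y \<and> 1 - norm y \<le> 2 * (1/2) ^ Suc j} \<longrightarrow> \<bar>w y\<bar> \<le> inverse \<kappa> * D"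
      unfolding AE_all_countable
    proof
      fix j
      have "(1/2::real) ^ j \<le> 1" by (intro power_le_one) auto
      then show "AE y in lborel. y \<in> {y. (1/2) ^ Suc j \<le> 1 - norm y \<and> 1 - norm y \<le> 2 * (1/2) ^ Suc j} \<longrightarrow> \<bar>w y\<bar> \<le> inverse \<kappa> * D"
        by (intro shell) auto
    qed
    then show ?thesis
    proof eventually_elim
      case (elim y)
      show ?case
      proof
        assume y: "y \<in> ball 0 1"
        then have t: "0 < 1 - norm y" by simp
        obtain m where m: "(1/2) ^ m < 1 - norm y" using real_arch_pow_inv[OF t, of "1/2"] by auto
        \<comment> \<open>The least exponent locates the dyadic shell of \<open>y\<close>. It is not
          0 because \<open>1 - norm y \<le> 1\<close>, so the preceding exponent exists and fails
          the inequality.\<close>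
        define l where "l = (LEAST m. (1/2) ^ m < 1 - norm y)"
        have l: "(1/2) ^ l < 1 - norm y" unfolding l_def using m by (rule LeastI)
        have "l \<noteq> 0" using l by (auto intro: ccontr)
        then obtain j where j: "l = Suc j" by (cases l) auto
        have "\<not> (1/2) ^ j < 1 - norm y" using not_less_Least[of j "\<lambda>m. (1/2) ^ m < 1 - norm y"] j by (simp add: l_def)
        then have "y \<in> {y. (1/2) ^ Suc j \<le> 1 - norm y \<and> 1 - norm y \<le> 2 * (1/2) ^ Suc j}"
          using l unfolding j by simp
        then have "\<bar>w y\<bar> \<le> inverse \<kappa> * D" using elim by blast
        then show "\<bar>w y\<bar> \<le> (inverse \<kappa> * K) * (1 + (\<integral>x. conf x ^ CARD('n) * (w x)\<^sup>2 \<partial>lborel)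
            + (\<integral>x. indicator (ball 0 1) x * (conf x ^ CARD('n) * (f x)\<^sup>2) \<partial>lborel))"
          by (simp only: D_def mult.assoc)
      qed
    qed
  qed
  moreover have "inverse \<kappa> * K > 0" using \<kappa>(1) K(1) by simp
  ultimately show ?thesis by blast
qed

text \<open>Used with the factor \<open>inverse M\<close>, it converts a bound by 1 plus squared
  norms into one linear in \<open>M\<close>.\<close>

lemma euclidean_weak_scale:
  fixes w f :: "real^'n \<Rightarrow> real"
  assumes "euclidean_weak k w f"
  shows "euclidean_weak k (\<lambda>x. c * w x) (\<lambda>x. c * f x)"
proof -
  have [measurable]: "w \<in> borel_measurable borel" "f \<in> borel_measurable borel"
    using assms by (auto simp: euclidean_weak_def)
  have e: "(\<lambda>x. conf x ^ CARD('n) * (c * w x)\<^sup>2) = (\<lambda>x. c\<^sup>2 * (conf x ^ CARD('n) * (w x)\<^sup>2))"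
    "(\<lambda>x. indicator (ball 0 1) x * (conf x ^ CARD('n) * (c * f x)\<^sup>2)) = (\<lambda>x. c\<^sup>2 * (indicator (ball 0 1) x * (conf x ^ CARD('n) * (f x)\<^sup>2)))"
    "(\<lambda>x. c * w x * ((-1) ^ k * (lap ^^ k) v x)) = (\<lambda>x. c * (w x * ((-1) ^ k * (lap ^^ k) v x)))"
    "(\<lambda>x. conf x ^ CARD('n) * (c * f x * v x)) = (\<lambda>x. c * (conf x ^ CARD('n) * (f x * v x)))" for v
    by (simp_all only: power_mult_distrib mult_ac)
  have "(\<lambda>x. c * w x) \<in> borel_measurable borel" "(\<lambda>x. c * f x) \<in> borel_measurable borel" by measurable
  then show ?thesis using assms unfolding euclidean_weak_def e integral_mult_right_zero by simp
qed

end

section \<open>Transfer between the hyperbolic and the Lebesgue measure\<close>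

lemma hyp_vol_AE:
  "(AE x in hyp_vol. P x) \<longleftrightarrow> (AE x::real^'n::finite in lebesgue. x \<in> ball 0 1 \<longrightarrow> P x)"
proof -
  have "(\<lambda>x::real^'n. conf x ^ CARD('n)) \<in> borel_measurable (lebesgue_on (ball 0 1))"
    by (rule borel_hyp_vol[unfolded measurable_hyp_vol]) measurable
  then have m: "(\<lambda>x::real^'n. ennreal (conf x ^ CARD('n))) \<in> borel_measurable (lebesgue_on (ball 0 1))" by measurable
  have "(AE x in hyp_vol. P x) \<longleftrightarrow> (AE x::real^'n in lebesgue. x \<in> ball 0 1 \<longrightarrow> 0 < ennreal (conf x ^ CARD('n)) \<longrightarrow> P x)"
    unfolding hyp_vol_def AE_density[OF m] by (rule AE_restrict_space_iff) simp
  also have "\<dots> \<longleftrightarrow> (AE x::real^'n in lebesgue. x \<in> ball 0 1 \<longrightarrow> P x)"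
    by (intro AE_cong) (auto simp: conf_pos)
  finally show ?thesis .
qed

lemma hyp_borel_integral:
  fixes g :: "real^'n::finite \<Rightarrow> real"
  assumes [measurable]: "g \<in> borel_measurable borel"
  shows "integrable hyp_vol g \<longleftrightarrow> integrable lborel (\<lambda>x. indicator (ball 0 1) x * (conf x ^ CARD('n) * g x))"
    and "(\<integral>x. g x \<partial>hyp_vol) = (\<integral>x. indicator (ball 0 1) x * (conf x ^ CARD('n) * g x) \<partial>lborel)"
proof -
  have [measurable]: "ball (0::real^'n) 1 \<in> sets borel" by simp
  have m: "(\<lambda>x. indicator (ball 0 1) x * (conf x ^ CARD('n) * g x)) \<in> borel_measurable lborel" by measurable
  have g: "g \<in> borel_measurable hyp_vol" by (rule borel_hyp_vol) measurable
  show "integrable hyp_vol g \<longleftrightarrow> integrable lborel (\<lambda>x. indicator (ball 0 1) x * (conf x ^ CARD('n) * g x))"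
    unfolding hyp_vol_integral(1)[OF g] integrable_completion[OF m] ..
  show "(\<integral>x. g x \<partial>hyp_vol) = (\<integral>x. indicator (ball 0 1) x * (conf x ^ CARD('n) * g x) \<partial>lborel)"
    unfolding hyp_vol_integral(2)[OF g] integral_completion[OF m] ..
qed

text \<open>Functions in \<open>L2 hyp_vol\<close> are Lebesgue measurable on the ball and arbitrary
  outside it, whereas \<open>euclidean_weak\<close> and the translation arguments work with Borel
  functions that vanish outside the ball.\<close>

lemma hyp_borel_representative:
  fixes w :: "real^'n::finite \<Rightarrow> real"
  assumes "w \<in> borel_measurable hyp_vol"
  obtains w' where "w' \<in> borel_measurable borel" "\<And>x. x \<notin> ball 0 1 \<Longrightarrow> w' x = 0" "AE x in hyp_vol. w' x = w x"
proof -
  have b: "ball (0::real^'n) 1 \<in> sets borel" by simp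
  have "(\<lambda>x. indicator (ball 0 1) x *\<^sub>R w x) \<in> borel_measurable lebesgue"
    using assms unfolding measurable_hyp_vol by (subst (asm) borel_measurable_restrict_space_iff) auto
  then obtain g where g: "g \<in> borel_measurable lborel" "AE x in lborel. indicator (ball 0 1) x *\<^sub>R w x = g x"
    using completion_ex_borel_measurable_real by blast
  show thesis
  proof (rule that[of "\<lambda>x. indicator (ball 0 1) x * g x"])
    have [measurable]: "g \<in> borel_measurable borel" "ball (0::real^'n) 1 \<in> sets borel" using g(1) b by auto
    show "(\<lambda>x. indicator (ball 0 1) x * g x) \<in> borel_measurable borel" by measurable
    show "AE x in hyp_vol. indicator (ball 0 1) x * g x = w x"
      unfolding hyp_vol_AE using AE_completion[OF g(2)] by eventually_elim auto
  qed simp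
qed

context
  fixes k :: nat
  assumes N: "CARD('n::finite) = 2 * k" and k: "k \<ge> 1"
begin

text \<open>After division by \<open>M\<close> the bound of \<open>euclidean_weak_bound\<close> is
  at most \<open>2 * C\<close>. A free \<open>M > 0\<close> dominating the norms, instead of the
  norm itself, includes the case that both norms vanish.\<close>

lemma energy_solution_sup_bound:
  "\<exists>C>0. \<forall>f w :: real^'n \<Rightarrow> real. f \<in> L2 hyp_vol \<longrightarrow> energy_solution k f w \<longrightarrow>
     (\<forall>M>0. (\<integral>x. (w x)\<^sup>2 \<partial>hyp_vol) + (\<integral>x. (f x)\<^sup>2 \<partial>hyp_vol) \<le> M\<^sup>2 \<longrightarrow> (AE x in hyp_vol. \<bar>w x\<bar> \<le> C * M))"
proof -
  obtain C where C: "C > 0" "\<forall>w f :: real^'n \<Rightarrow> real. euclidean_weak k w f \<longrightarrow>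
    (\<forall>\<eta>>0. \<exists>v\<in>test_functions. integrable lborel (\<lambda>x. conf x ^ CARD('n) * (w x - v x)\<^sup>2) \<and>
       (\<integral>x. conf x ^ CARD('n) * (w x - v x)\<^sup>2 \<partial>lborel) \<le> \<eta>) \<longrightarrow>
    (AE x in lborel. x \<in> ball 0 1 \<longrightarrow> \<bar>w x\<bar> \<le> C * (1 + (\<integral>x. conf x ^ CARD('n) * (w x)\<^sup>2 \<partial>lborel)
            + (\<integral>x. indicator (ball 0 1) x * (conf x ^ CARD('n) * (f x)\<^sup>2) \<partial>lborel)))"
    using euclidean_weak_bound[OF N k] by (elim exE conjE)
  have N2: "CARD('n) \<ge> 2" using N k by simp
  have "AE x in hyp_vol. \<bar>w x\<bar> \<le> (2 * C) * M"
    if f: "f \<in> L2 hyp_vol" and s: "energy_solution k f w" and M: "M > 0"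
      "(\<integral>x. (w x)\<^sup>2 \<partial>hyp_vol) + (\<integral>x. (f x)\<^sup>2 \<partial>hyp_vol) \<le> M\<^sup>2" for f w :: "real^'n \<Rightarrow> real" and M
  proof -
    have w: "w \<in> L2 hyp_vol" using s by (simp add: energy_solution_def)
    obtain \<phi> :: "nat \<Rightarrow> real^'n \<Rightarrow> real" where \<phi>: "\<And>n. \<phi> n \<in> test_functions"
      "(\<lambda>n. \<integral>x. (\<phi> n x - w x)\<^sup>2 \<partial>hyp_vol) \<longlonglongrightarrow> 0"
      using s unfolding energy_solution_def by blast
    have weak: "(\<integral>x. w x * gjms k v x \<partial>hyp_vol) = (\<integral>x. f x * v x \<partial>hyp_vol)" if "v \<in> test_functions" for v
      using s that by (simp add: energy_solution_def)
    obtain w' where w': "w' \<in> borel_measurable borel" "\<And>x. x \<notin> ball 0 1 \<Longrightarrow> w' x = 0" "AE x in hyp_vol. w' x = w x"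
      using hyp_borel_representative[OF L2_measurable[OF w]] by blast
    obtain f' where f': "f' \<in> borel_measurable borel" "\<And>x. x \<notin> ball 0 1 \<Longrightarrow> f' x = 0" "AE x in hyp_vol. f' x = f x"
      using hyp_borel_representative[OF L2_measurable[OF f]] by blast
    note [measurable] = w'(1) f'(1)
    have wm: "w' \<in> borel_measurable hyp_vol" "f' \<in> borel_measurable hyp_vol" by (rule borel_hyp_vol, measurable)+
    note wf = L2_measurable[OF w] L2_measurable[OF f]
    have drop: "(\<lambda>x. indicator (ball 0 1) x * (conf x ^ CARD('n) * g x)) = (\<lambda>x. conf x ^ CARD('n) * g x)"
      if "\<And>x. x \<notin> ball 0 1 \<Longrightarrow> g x = 0" for g :: "real^'n \<Rightarrow> real"
      using that by (auto simp: indicator_def fun_eq_iff simp del: mem_ball)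
    have sq: "integrable hyp_vol (\<lambda>x. (g x - v x)\<^sup>2)" "(\<integral>x. (g x - v x)\<^sup>2 \<partial>hyp_vol) = (\<integral>x. (h x - v x)\<^sup>2 \<partial>hyp_vol)"
      if "h \<in> L2 hyp_vol" "v \<in> L2 hyp_vol" "g \<in> borel_measurable hyp_vol" "AE x in hyp_vol. g x = h x" for g h v :: "real^'n \<Rightarrow> real"
    proof -
      have m: "h \<in> borel_measurable hyp_vol" "v \<in> borel_measurable hyp_vol" using that L2_measurable by auto
      have ae: "AE x in hyp_vol. (g x - v x)\<^sup>2 = (h x - v x)\<^sup>2" using that(4) by eventually_elim simp
      have "integrable hyp_vol (\<lambda>x. (h x - v x)\<^sup>2)" by (intro L2_integrable L2_diff that)
      then show "integrable hyp_vol (\<lambda>x. (g x - v x)\<^sup>2)"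
        using integrable_cong_AE[OF _ _ ae] m that(3) by simp
      show "(\<integral>x. (g x - v x)\<^sup>2 \<partial>hyp_vol) = (\<integral>x. (h x - v x)\<^sup>2 \<partial>hyp_vol)"
        by (rule integral_cong_AE[OF _ _ ae]) (use m that(3) in simp_all)
    qed
    have sqL: "integrable lborel (\<lambda>x. conf x ^ CARD('n) * (w' x - v x)\<^sup>2)"
        "(\<integral>x. conf x ^ CARD('n) * (w' x - v x)\<^sup>2 \<partial>lborel) = (\<integral>x. (w x - v x)\<^sup>2 \<partial>hyp_vol)"
      if v: "v \<in> test_functions" for v
    proof -
      have [measurable]: "v \<in> borel_measurable borel" by (rule test_measurable[OF v])
      have m: "(\<lambda>x. (w' x - v x)\<^sup>2) \<in> borel_measurable borel" by measurable
      have z: "(w' x - v x)\<^sup>2 = 0" if "x \<notin> ball 0 1" for x using w'(2)[OF that] test_outside[OF v that] by simp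
      have e: "(\<lambda>x. indicator (ball 0 1) x * (conf x ^ CARD('n) * (w' x - v x)\<^sup>2)) = (\<lambda>x. conf x ^ CARD('n) * (w' x - v x)\<^sup>2)"
        by (rule drop) (rule z)
      show "integrable lborel (\<lambda>x. conf x ^ CARD('n) * (w' x - v x)\<^sup>2)"
        using iffD1[OF hyp_borel_integral(1)[OF m] sq(1)[OF w test_L2[OF v] wm(1) w'(3)]]
        unfolding e .
      show "(\<integral>x. conf x ^ CARD('n) * (w' x - v x)\<^sup>2 \<partial>lborel) = (\<integral>x. (w x - v x)\<^sup>2 \<partial>hyp_vol)"
        using trans[OF hyp_borel_integral(2)[OF m, symmetric] sq(2)[OF w test_L2[OF v] wm(1) w'(3)]]
        unfolding e .
    qed
    have fm: "(\<lambda>x. (f' x)\<^sup>2) \<in> borel_measurable borel" by measurable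
    have fL: "integrable lborel (\<lambda>x. indicator (ball 0 1) x * (conf x ^ CARD('n) * (f' x)\<^sup>2))"
        "(\<integral>x. indicator (ball 0 1) x * (conf x ^ CARD('n) * (f' x)\<^sup>2) \<partial>lborel) = (\<integral>x. (f x)\<^sup>2 \<partial>hyp_vol)"
      using hyp_borel_integral[OF fm] sq[OF f test_L2[OF test_zero] wm(2) f'(3)] by simp_all
    have ew: "euclidean_weak k w' f'"
      unfolding euclidean_weak_def
    proof (intro conjI ballI)
      show "integrable lborel (\<lambda>x. conf x ^ CARD('n) * (w' x)\<^sup>2)" using sqL(1)[OF test_zero] by simp
      fix v :: "real^'n \<Rightarrow> real" assume v: "v \<in> test_functions"
      have g: "gjms k v \<in> test_functions" by (rule test_gjms[OF N2 v])
      have [measurable]: "gjms k v \<in> borel_measurable borel" "v \<in> borel_measurable borel" by (intro test_measurable g v)+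
      have "(\<integral>x. w' x * ((-1) ^ k * (lap ^^ k) v x) \<partial>lborel) = (\<integral>x. indicator (ball 0 1) x * (conf x ^ CARD('n) * (w' x * gjms k v x)) \<partial>lborel)"
      proof (rule Bochner_Integration.integral_cong[OF refl])
        fix x
        show "w' x * ((-1) ^ k * (lap ^^ k) v x) = indicator (ball 0 1) x * (conf x ^ CARD('n) * (w' x * gjms k v x))"
        proof (cases "x \<in> ball 0 1")
          case True
          \<comment> \<open>The volume density cancels the outer weight in
            \<open>gjms_conformal\<close> and leaves the Euclidean operator.\<close>
          have "conf x ^ CARD('n) * rho x ^ CARD('n) = 1"
            unfolding power_mult_distrib[symmetric] using rho_pos[OF True] by (simp add: conf_rho)
          then have "conf x ^ CARD('n) * (rho x ^ CARD('n) * t) = t" for t by (simp flip: mult.assoc)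
          then show ?thesis using True unfolding gjms_conformal[OF N k v] by (simp add: mult.left_commute)
        qed (simp add: w'(2))
      qed
      also have "\<dots> = (\<integral>x. w' x * gjms k v x \<partial>hyp_vol)"
        by (rule hyp_borel_integral(2)[symmetric]) measurable
      also have "\<dots> = (\<integral>x. w x * gjms k v x \<partial>hyp_vol)"
        by (rule integral_cong_AE) (use wm wf w'(3) test_measurable_hyp[OF g] in auto)
      also have "\<dots> = (\<integral>x. f x * v x \<partial>hyp_vol)" by (rule weak[OF v])
      also have "\<dots> = (\<integral>x. f' x * v x \<partial>hyp_vol)"
        by (rule integral_cong_AE) (use wm wf f'(3) test_measurable_hyp[OF v] in auto)
      also have "\<dots> = (\<integral>x. indicator (ball 0 1) x * (conf x ^ CARD('n) * (f' x * v x)) \<partial>lborel)"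
        by (rule hyp_borel_integral(2)) measurable
      also have "(\<lambda>x. indicator (ball 0 1) x * (conf x ^ CARD('n) * (f' x * v x))) = (\<lambda>x. conf x ^ CARD('n) * (f' x * v x))"
        by (rule drop) (simp add: f'(2))
      finally show "(\<integral>x. w' x * ((-1) ^ k * (lap ^^ k) v x) \<partial>lborel) = (\<integral>x. conf x ^ CARD('n) * (f' x * v x) \<partial>lborel)" .
    qed (use w' f' fL in \<open>auto simp del: mem_ball\<close>)
    let ?c = "inverse M"
    have c2: "conf x ^ CARD('n) * (?c * w' x - ?c * v x)\<^sup>2 = ?c\<^sup>2 * (conf x ^ CARD('n) * (w' x - v x)\<^sup>2)" for x and v :: "real^'n \<Rightarrow> real"
      unfolding right_diff_distrib[symmetric] by (simp only: power_mult_distrib mult_ac)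
    have "\<exists>v\<in>test_functions. integrable lborel (\<lambda>x. conf x ^ CARD('n) * (?c * w' x - v x)\<^sup>2) \<and>
       (\<integral>x. conf x ^ CARD('n) * (?c * w' x - v x)\<^sup>2 \<partial>lborel) \<le> \<eta>" if \<eta>: "\<eta> > 0" for \<eta>
    proof -
      have "\<forall>\<^sub>F n in sequentially. (\<integral>x. (\<phi> n x - w x)\<^sup>2 \<partial>hyp_vol) < M\<^sup>2 * \<eta>"
        using \<phi>(2) M(1) \<eta> by (intro order_tendstoD(2)) auto
      from eventually_happens'[OF sequentially_bot this]
      obtain n where n: "(\<integral>x. (\<phi> n x - w x)\<^sup>2 \<partial>hyp_vol) < M\<^sup>2 * \<eta>" by blast
      have "?c\<^sup>2 * (\<integral>x. (w x - \<phi> n x)\<^sup>2 \<partial>hyp_vol) \<le> ?c\<^sup>2 * (M\<^sup>2 * \<eta>)"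
        using n by (intro mult_left_mono) (auto simp: power2_commute[of "w _"])
      also have "\<dots> = \<eta>" using M(1) by (simp add: power_inverse)
      finally have "(\<integral>x. conf x ^ CARD('n) * (?c * w' x - ?c * \<phi> n x)\<^sup>2 \<partial>lborel) \<le> \<eta>"
        unfolding c2 integral_mult_right_zero sqL(2)[OF \<phi>(1)] .
      moreover have "integrable lborel (\<lambda>x. conf x ^ CARD('n) * (?c * w' x - ?c * \<phi> n x)\<^sup>2)"
        unfolding c2 by (intro integrable_mult_right sqL(1) \<phi>)
      ultimately show ?thesis
        by (intro bexI[of _ "\<lambda>x. ?c * \<phi> n x"] conjI test_cmult \<phi>(1))
    qed
    then have ae: "AE x in lborel. x \<in> ball 0 1 \<longrightarrow> \<bar>?c * w' x\<bar> \<le> C * (1 + (\<integral>x. conf x ^ CARD('n) * (?c * w' x)\<^sup>2 \<partial>lborel)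
            + (\<integral>x. indicator (ball 0 1) x * (conf x ^ CARD('n) * (?c * f' x)\<^sup>2) \<partial>lborel))"
      using C(2) euclidean_weak_scale[OF N k ew, of ?c] by blast
    have "(\<integral>x. conf x ^ CARD('n) * (?c * w' x)\<^sup>2 \<partial>lborel) = ?c\<^sup>2 * (\<integral>x. (w x)\<^sup>2 \<partial>hyp_vol)"
    proof -
      have "(\<lambda>x. conf x ^ CARD('n) * (?c * w' x)\<^sup>2) = (\<lambda>x. ?c\<^sup>2 * (conf x ^ CARD('n) * (w' x)\<^sup>2))"
        by (simp only: power_mult_distrib mult_ac)
      then show ?thesis using sqL(2)[OF test_zero] by simp
    qed
    moreover have "(\<integral>x. indicator (ball 0 1) x * (conf x ^ CARD('n) * (?c * f' x)\<^sup>2) \<partial>lborel) = ?c\<^sup>2 * (\<integral>x. (f x)\<^sup>2 \<partial>hyp_vol)"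
    proof -
      have "(\<lambda>x. indicator (ball 0 1) x * (conf x ^ CARD('n) * (?c * f' x)\<^sup>2)) = (\<lambda>x. ?c\<^sup>2 * (indicator (ball 0 1) x * (conf x ^ CARD('n) * (f' x)\<^sup>2)))"
        by (simp only: power_mult_distrib mult_ac)
      then show ?thesis using fL(2) by simp
    qed
    ultimately have S: "1 + (\<integral>x. conf x ^ CARD('n) * (?c * w' x)\<^sup>2 \<partial>lborel)
            + (\<integral>x. indicator (ball 0 1) x * (conf x ^ CARD('n) * (?c * f' x)\<^sup>2) \<partial>lborel)
        = 1 + ?c\<^sup>2 * ((\<integral>x. (w x)\<^sup>2 \<partial>hyp_vol) + (\<integral>x. (f x)\<^sup>2 \<partial>hyp_vol))" by (simp only: distrib_left add.assoc)
    have "?c\<^sup>2 * ((\<integral>x. (w x)\<^sup>2 \<partial>hyp_vol) + (\<integral>x. (f x)\<^sup>2 \<partial>hyp_vol)) \<le> ?c\<^sup>2 * M\<^sup>2"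
      by (intro mult_left_mono M(2)) simp
    also have "\<dots> = 1" using M(1) by (simp add: power_inverse)
    finally have S2: "C * (1 + ?c\<^sup>2 * ((\<integral>x. (w x)\<^sup>2 \<partial>hyp_vol) + (\<integral>x. (f x)\<^sup>2 \<partial>hyp_vol))) \<le> C * 2"
      using C(1) by (intro mult_left_mono) auto
    have "AE x in hyp_vol. \<bar>w' x\<bar> \<le> (2 * C) * M"
      unfolding hyp_vol_AE using AE_completion[OF ae[unfolded S]]
    proof eventually_elim
      case (elim x)
      show ?case
      proof
        assume "x \<in> ball 0 1"
        then have "?c * \<bar>w' x\<bar> \<le> C * 2" using elim S2 M(1) by (simp add: abs_mult)
        then show "\<bar>w' x\<bar> \<le> 2 * C * M" using M(1) by (simp add: field_simps)
      qed
    qed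
    with w'(3) show ?thesis by eventually_elim simp
  qed
  moreover have "2 * C > 0" using C(1) by simp
  ultimately show ?thesis by blast
qed

end

section \<open>The semilinear equation\<close>

lemma integral_lap_funpow:
  fixes v :: "real^'n::finite \<Rightarrow> real"
  assumes v: "v \<in> test_functions" and k: "k \<ge> 1"
  shows "(\<integral>x. (lap ^^ k) v x \<partial>lborel) = 0"
proof -
  obtain j where j: "k = Suc j" using k by (cases k) auto
  let ?u = "(lap ^^ j) v"
  have u: "partial_deriv i ?u \<in> test_functions" for i by (intro test_partial test_lap_funpow v)
  have "(\<integral>x. (lap ^^ k) v x \<partial>lborel) = (\<integral>x. (\<Sum>i\<in>UNIV. partial_deriv i (partial_deriv i ?u) x) \<partial>lborel)"
    by (simp add: j lap_def[of ?u])
  also have "\<dots> = (\<Sum>i\<in>UNIV. \<integral>x. partial_deriv i (partial_deriv i ?u) x \<partial>lborel)"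
    by (rule Bochner_Integration.integral_sum) (rule test_integrable_lborel[OF test_partial[OF u]])
  also have "\<dots> = 0" by (simp add: integral_partial_deriv[OF u])
  finally show ?thesis .
qed

text \<open>The operator annihilates constants, stated weakly because a constant is in general
  neither a test function nor square integrable: conformal covariance makes the integrand a
  Laplacian of a test function. This allows a constant to be added to a solution.\<close>

lemma integral_gjms:
  fixes v :: "real^'n::finite \<Rightarrow> real"
  assumes N: "CARD('n) = 2 * k" and k: "k \<ge> 1" and v: "v \<in> test_functions"
  shows "(\<integral>x. gjms k v x \<partial>hyp_vol) = 0"
proof -
  have N2: "CARD('n) \<ge> 2" using N k by simp
  have "(\<integral>x. gjms k v x \<partial>hyp_vol) = (\<integral>x. conf x ^ CARD('n) * gjms k v x \<partial>lborel)"
    by (rule test_integral[OF test_gjms[OF N2 v]])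
  also have "\<dots> = (\<integral>x. (-1) ^ k * (lap ^^ k) v x \<partial>lborel)"
  proof (rule Bochner_Integration.integral_cong[OF refl])
    fix x
    show "conf x ^ CARD('n) * gjms k v x = (-1) ^ k * (lap ^^ k) v x"
    proof (cases "x \<in> ball 0 1")
      case True
      have "conf x ^ CARD('n) * rho x ^ CARD('n) = 1"
        unfolding power_mult_distrib[symmetric] using rho_pos[OF True] by (simp add: conf_rho)
      then show ?thesis unfolding gjms_conformal[OF N k v] by (simp flip: mult.assoc)
    next
      case False
      then show ?thesis using test_outside[OF test_gjms[OF N2 v]] test_outside[OF test_lap_funpow[OF v]] by simp
    qed
  qed
  also have "\<dots> = 0" by (simp add: integral_lap_funpow[OF v k])
  finally show ?thesis .
qed

lemma hyp_vol_integrable_indicator: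
  assumes "compact K" "K \<subseteq> ball (0::real^'n::finite) 1"
  shows "integrable hyp_vol (\<lambda>x. indicator K x :: real)"
proof -
  have [measurable]: "K \<in> sets borel" using compact_imp_closed[OF assms(1)] by simp
  have m: "(\<lambda>x. indicator K x :: real) \<in> borel_measurable borel" by measurable
  have "continuous_on K (\<lambda>x. conf x ^ CARD('n))"
    unfolding conf_rho using rho_pos assms(2)
    by (intro continuous_on_power continuous_on_inverse smooth_continuous smooth_rho) fastforce
  then have "integrable lborel (\<lambda>x. indicator K x *\<^sub>R conf x ^ CARD('n))"
    by (rule borel_integrable_compact[OF assms(1)])
  moreover have "(\<lambda>x. indicator K x *\<^sub>R conf x ^ CARD('n)) = (\<lambda>x. indicator (ball 0 1) x * (conf x ^ CARD('n) * indicator K x))"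
    using assms(2) by (auto simp: indicator_def fun_eq_iff)
  ultimately show ?thesis unfolding hyp_borel_integral(1)[OF m] by simp
qed

text \<open>The total volume is infinite, so adding \<open>c \<noteq> 0\<close> leaves
  \<open>L2 hyp_vol\<close>; compact subsets of the ball have finite volume, which suffices
  locally.\<close>

lemma L2_locally_integrable:
  fixes g :: "real^'n::finite \<Rightarrow> real"
  assumes g: "g \<in> L2 hyp_vol"
  shows "hyp_locally_integrable (\<lambda>x. g x + c)"
  unfolding hyp_locally_integrable_def set_integrable_def
proof (intro allI impI, elim conjE)
  fix K :: "(real^'n) set" assume K: "compact K" "K \<subseteq> ball 0 1"
  have I: "integrable hyp_vol (\<lambda>x. indicator K x :: real)" by (rule hyp_vol_integrable_indicator[OF K])
  have [measurable]: "(\<lambda>x. indicator K x :: real) \<in> borel_measurable hyp_vol" "g \<in> borel_measurable hyp_vol"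
    using I L2_measurable[OF g] by auto
  have "integrable hyp_vol (\<lambda>x. indicator K x * g x)"
  proof (rule Bochner_Integration.integrable_bound)
    show "integrable hyp_vol (\<lambda>x. indicator K x + (g x)\<^sup>2)" using I L2_integrable[OF g] by simp
    have "norm (indicator K x * g x) \<le> norm (indicator K x + (g x)\<^sup>2)" for x
      using abs_mult_le_squares[of "indicator K x" "g x"] by (auto simp: indicator_def)
    then show "AE x in hyp_vol. norm (indicator K x * g x) \<le> norm (indicator K x + (g x)\<^sup>2)" by simp
  qed measurable
  then have "integrable hyp_vol (\<lambda>x. indicator K x * g x + c * indicator K x)" using I by simp
  then show "integrable hyp_vol (\<lambda>x. indicator K x *\<^sub>R (g x + c))" by (simp add: algebra_simps)
qed

section \<open>The fixed point argument\<close>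

lemma exp_diff_le:
  fixes a b :: real
  assumes "a \<le> L" "b \<le> L"
  shows "\<bar>exp a - exp b\<bar> \<le> exp L * \<bar>a - b\<bar>"
proof -
  have one: "exp a - exp b \<le> exp L * \<bar>a - b\<bar>" if "a \<le> L" for a b :: real
  proof -
    have "exp a * (1 + (b - a)) \<le> exp a * exp (b - a)" by (intro mult_left_mono exp_ge_add_one_self) simp
    also have "\<dots> = exp b" by (simp flip: exp_add)
    finally have "exp a - exp b \<le> exp a * (a - b)" by (simp add: algebra_simps)
    also have "\<dots> \<le> exp a * \<bar>a - b\<bar>" by (intro mult_left_mono) auto
    also have "\<dots> \<le> exp L * \<bar>a - b\<bar>" using that by (intro mult_right_mono) auto
    finally show ?thesis .
  qed
  show ?thesis using one[OF assms(1), of b] one[OF assms(2), of a] by (simp add: abs_minus_commute abs_le_iff)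
qed

lemma L2_diff_bound:
  assumes f: "f \<in> L2 M" and g: "g \<in> L2 M"
  shows "(\<integral>x. (f x - g x)\<^sup>2 \<partial>M) \<le> 2 * (\<integral>x. (f x)\<^sup>2 \<partial>M) + 2 * (\<integral>x. (g x)\<^sup>2 \<partial>M)"
proof -
  have "(\<integral>x. (f x - g x)\<^sup>2 \<partial>M) \<le> (\<integral>x. 2 * (f x)\<^sup>2 + 2 * (g x)\<^sup>2 \<partial>M)"
  proof (rule integral_mono)
    show "integrable M (\<lambda>x. (f x - g x)\<^sup>2)" by (intro L2_integrable L2_diff f g)
    show "integrable M (\<lambda>x. 2 * (f x)\<^sup>2 + 2 * (g x)\<^sup>2)" using L2_integrable[OF f] L2_integrable[OF g] by simp
    show "(f x - g x)\<^sup>2 \<le> 2 * (f x)\<^sup>2 + 2 * (g x)\<^sup>2" for x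
      using zero_le_power2[of "f x + g x"] by (simp add: power2_eq_square algebra_simps)
  qed
  then show ?thesis using L2_integrable[OF f] L2_integrable[OF g] by simp
qed

text \<open>The relation \<open>S\<close> plays the role of the solution operator, which is only determined up to null sets.\<close>

lemma L2_fixed_point:
  fixes S :: "('a \<Rightarrow> real) \<Rightarrow> ('a \<Rightarrow> real) \<Rightarrow> bool" and F :: "('a \<Rightarrow> real) \<Rightarrow> 'a \<Rightarrow> real"
  assumes ex: "\<And>f. f \<in> L2 M \<Longrightarrow> \<exists>w. S f w" and r: "r \<ge> 0"
    and self: "\<And>f w. f \<in> L2 M \<Longrightarrow> (\<integral>x. (f x)\<^sup>2 \<partial>M) \<le> r \<Longrightarrow> S f w \<Longrightarrow> F w \<in> L2 M \<and> (\<integral>x. (F w x)\<^sup>2 \<partial>M) \<le> r"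
    and contr: "\<And>f w f' w'. f \<in> L2 M \<Longrightarrow> (\<integral>x. (f x)\<^sup>2 \<partial>M) \<le> r \<Longrightarrow> S f w \<Longrightarrow>
      f' \<in> L2 M \<Longrightarrow> (\<integral>x. (f' x)\<^sup>2 \<partial>M) \<le> r \<Longrightarrow> S f' w' \<Longrightarrow>
      (\<integral>x. (F w x - F w' x)\<^sup>2 \<partial>M) \<le> 1/4 * (\<integral>x. (f x - f' x)\<^sup>2 \<partial>M)"
  obtains f w where "f \<in> L2 M" "(\<integral>x. (f x)\<^sup>2 \<partial>M) \<le> r" "S f w" "AE x in M. f x = F w x"
proof -
  \<comment> \<open>Fixes one solution for each right hand side; the assumed estimates hold for any
    choice.\<close>
  define G where "G f = (SOME w. S f w)" for f
  have G: "S f (G f)" if "f \<in> L2 M" for f unfolding G_def using ex[OF that] by (rule someI_ex)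
  define B where "B = {f \<in> L2 M. (\<integral>x. (f x)\<^sup>2 \<partial>M) \<le> r}"
  define \<Phi> where "\<Phi> f = F (G f)" for f
  have \<Phi>B: "\<Phi> f \<in> B" if "f \<in> B" for f using self[of f "G f"] G[of f] that by (simp add: B_def \<Phi>_def)
  have \<Phi>c: "(\<integral>x. (\<Phi> f x - \<Phi> f' x)\<^sup>2 \<partial>M) \<le> 1/4 * (\<integral>x. (f x - f' x)\<^sup>2 \<partial>M)" if "f \<in> B" "f' \<in> B" for f f'
    using contr[of f "G f" f' "G f'"] G[of f] G[of f'] that by (simp add: B_def \<Phi>_def)
  have B_L2: "f \<in> L2 M" if "f \<in> B" for f using that by (simp add: B_def)
  define f where "f n = (\<Phi> ^^ n) (\<lambda>_. 0)" for n
  have f0: "(\<lambda>_. 0) \<in> B" using r by (simp add: B_def L2_def)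
  have fB: "f n \<in> B" for n unfolding f_def by (induction n) (auto intro: f0 \<Phi>B)
  have fS: "f (Suc n) = \<Phi> (f n)" for n by (simp add: f_def)
  \<comment> \<open>The factor \<open>1/4\<close> acts on squared norms, a contraction by
    \<open>1/2\<close> in norm; \<open>4 * r\<close> bounds the squared distance of two members of
    \<open>B\<close>.\<close>
  have geo: "(\<integral>x. (f (n + p) x - f n x)\<^sup>2 \<partial>M) \<le> (1/4) ^ n * (4 * r)" for n p
  proof (induction n)
    case 0
    have "(\<integral>x. (f p x - f 0 x)\<^sup>2 \<partial>M) \<le> 2 * (\<integral>x. (f p x)\<^sup>2 \<partial>M) + 2 * (\<integral>x. (f 0 x)\<^sup>2 \<partial>M)"
      by (intro L2_diff_bound B_L2 fB)
    also have "\<dots> \<le> 4 * r" using fB[of p] fB[of 0] by (simp add: B_def)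
    finally show ?case by simp
  next
    case (Suc n)
    have "(\<integral>x. (f (Suc n + p) x - f (Suc n) x)\<^sup>2 \<partial>M) \<le> 1/4 * (\<integral>x. (f (n + p) x - f n x)\<^sup>2 \<partial>M)"
      using \<Phi>c[OF fB fB, of "n + p" n] by (simp add: fS)
    also have "\<dots> \<le> 1/4 * ((1/4) ^ n * (4 * r))" using Suc by (intro mult_left_mono) auto
    finally show ?case by simp
  qed
  have "\<exists>n0. \<forall>m\<ge>n0. \<forall>n\<ge>n0. (\<integral>x. (f m x - f n x)\<^sup>2 \<partial>M) < e" if e: "e > 0" for e
  proof -
    have "(\<lambda>n. (1/4) ^ n * (4 * r)) \<longlonglongrightarrow> 0"
      using tendsto_mult_left_zero[OF LIMSEQ_power_zero[of "1/4::real"]] by simp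
    then have "\<forall>\<^sub>F n in sequentially. (1/4) ^ n * (4 * r) < e" using e by (rule order_tendstoD(2))
    then obtain n0 where n0: "\<And>n. n \<ge> n0 \<Longrightarrow> (1/4) ^ n * (4 * r) < e" by (auto simp: eventually_sequentially)
    have lt: "(\<integral>x. (f m x - f n x)\<^sup>2 \<partial>M) < e" if "n \<ge> n0" "m \<ge> n" for m n
      using geo[of n "m - n"] n0[OF that(1)] that(2) by simp
    have "(\<integral>x. (f m x - f n x)\<^sup>2 \<partial>M) < e" if "m \<ge> n0" "n \<ge> n0" for m n
    proof (cases "m \<ge> n")
      case False
      then show ?thesis using lt[of m n] that by (simp add: power2_commute[of "f m _"])
    qed (use lt that in auto)
    then show ?thesis by blast
  qed
  then obtain g where g: "g \<in> L2 M" "(\<lambda>n. \<integral>x. (f n x - g x)\<^sup>2 \<partial>M) \<longlonglongrightarrow> 0"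
    by (rule L2_complete[of f M, OF B_L2[OF fB]]) blast
  have "(\<integral>x. (g x)\<^sup>2 \<partial>M) \<le> r"
    by (rule tendsto_upperbound[OF L2_tendsto_square[OF B_L2[OF fB] g]])
       (use fB in \<open>auto simp: B_def intro!: always_eventually\<close>)
  then have gB: "g \<in> B" using g(1) by (simp add: B_def)
  \<comment> \<open>The distance of \<open>g\<close> and \<open>\<Phi> g\<close> is estimated
    through the iterate \<open>f (Suc n)\<close>, which tends to both of them.\<close>
  have "(\<integral>x. (g x - \<Phi> g x)\<^sup>2 \<partial>M) \<le> 0"
  proof (rule tendsto_lowerbound)
    show "(\<lambda>n. 2 * (\<integral>x. (f (Suc n) x - g x)\<^sup>2 \<partial>M) + 2 * (1/4 * (\<integral>x. (f n x - g x)\<^sup>2 \<partial>M))) \<longlonglongrightarrow> 0"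
      using tendsto_add[OF tendsto_mult_left[OF LIMSEQ_Suc[OF g(2)], of 2] tendsto_mult_left[OF tendsto_mult_left[OF g(2), of "1/4"], of 2]]
      by simp
    have "(\<integral>x. (g x - \<Phi> g x)\<^sup>2 \<partial>M) \<le> 2 * (\<integral>x. (f (Suc n) x - g x)\<^sup>2 \<partial>M) + 2 * (1/4 * (\<integral>x. (f n x - g x)\<^sup>2 \<partial>M))" for n
    proof -
      have "(\<integral>x. (g x - \<Phi> g x)\<^sup>2 \<partial>M) = (\<integral>x. ((f (Suc n) x - \<Phi> g x) - (f (Suc n) x - g x))\<^sup>2 \<partial>M)" by simp
      also have "\<dots> \<le> 2 * (\<integral>x. (f (Suc n) x - \<Phi> g x)\<^sup>2 \<partial>M) + 2 * (\<integral>x. (f (Suc n) x - g x)\<^sup>2 \<partial>M)"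
        by (intro L2_diff_bound L2_diff B_L2 fB \<Phi>B gB)
      finally show ?thesis using \<Phi>c[OF fB gB, of n] by (simp add: fS)
    qed
    then show "\<forall>\<^sub>F n in sequentially. (\<integral>x. (g x - \<Phi> g x)\<^sup>2 \<partial>M)
        \<le> 2 * (\<integral>x. (f (Suc n) x - g x)\<^sup>2 \<partial>M) + 2 * (1/4 * (\<integral>x. (f n x - g x)\<^sup>2 \<partial>M))"
      by (intro always_eventually allI)
  qed simp
  moreover have "0 \<le> (\<integral>x. (g x - \<Phi> g x)\<^sup>2 \<partial>M)" by simp
  ultimately have z: "(\<integral>x. (g x - \<Phi> g x)\<^sup>2 \<partial>M) = 0" by linarith
  have "integrable M (\<lambda>x. (g x - \<Phi> g x)\<^sup>2)" by (intro L2_integrable L2_diff B_L2 \<Phi>B gB)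
  from integral_nonneg_eq_0_iff_AE[OF this] z have "AE x in M. (g x - \<Phi> g x)\<^sup>2 = 0" by simp
  then have "AE x in M. g x = F (G g) x" by eventually_elim (simp add: \<Phi>_def)
  then show thesis using that[OF g(1) _ G[OF g(1)]] gB by (simp add: B_def)
qed

theorem theorem5p2:
  fixes k :: nat and Q\<^sub>1 Q\<^sub>2 :: "real^'n::finite \<Rightarrow> real"
  assumes "k \<ge> 1" and "CARD('n) = 2 * k"
    and "Q\<^sub>1 \<in> L2 hyp_vol" and "Q\<^sub>2 \<in> L2 hyp_vol"
  shows "\<exists>w \<in> sobolev_space k. \<exists>c :: real. weak_solution k Q\<^sub>1 Q\<^sub>2 (\<lambda>x. w x + c)"
proof -
  note k = assms(1) and N = assms(2) and Q1 = assms(3) and Q2 = assms(4)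
  have N2: "CARD('n) \<ge> 2" using N k by simp
  obtain C1 where C1: "C1 > 0" "\<forall>f w :: real^'n \<Rightarrow> real. f \<in> L2 hyp_vol \<longrightarrow> energy_solution k f w \<longrightarrow>
    (\<integral>x. (w x)\<^sup>2 \<partial>hyp_vol) \<le> C1 * (\<integral>x. (f x)\<^sup>2 \<partial>hyp_vol)"
    using energy_solution_bound[OF N2, of k] by (elim exE conjE)
  obtain C2 where C2: "C2 > 0" "\<forall>f w :: real^'n \<Rightarrow> real. f \<in> L2 hyp_vol \<longrightarrow> energy_solution k f w \<longrightarrow>
     (\<forall>M>0. (\<integral>x. (w x)\<^sup>2 \<partial>hyp_vol) + (\<integral>x. (f x)\<^sup>2 \<partial>hyp_vol) \<le> M\<^sup>2 \<longrightarrow> (AE x in hyp_vol. \<bar>w x\<bar> \<le> C2 * M))"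
    using energy_solution_sup_bound[OF N k] by (elim exE conjE)
  have sup: "AE x in hyp_vol. \<bar>w x\<bar> \<le> C2 * M"
    if "f \<in> L2 hyp_vol" "energy_solution k f w" "M > 0" "(C1 + 1) * (\<integral>x. (f x)\<^sup>2 \<partial>hyp_vol) \<le> M\<^sup>2" for f w :: "real^'n \<Rightarrow> real" and M
  proof -
    have "(\<integral>x. (w x)\<^sup>2 \<partial>hyp_vol) \<le> C1 * (\<integral>x. (f x)\<^sup>2 \<partial>hyp_vol)" using C1(2) that(1,2) by blast
    then have "(\<integral>x. (w x)\<^sup>2 \<partial>hyp_vol) + (\<integral>x. (f x)\<^sup>2 \<partial>hyp_vol) \<le> M\<^sup>2" using that(4) by (simp add: distrib_right)
    then show ?thesis using C2(2) that(1-3) by blast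
  qed
  let ?q1 = "\<integral>x. (Q\<^sub>1 x)\<^sup>2 \<partial>hyp_vol" and ?q2 = "\<integral>x. (Q\<^sub>2 x)\<^sup>2 \<partial>hyp_vol"
  have q: "?q1 \<ge> 0" "?q2 \<ge> 0" by simp_all
  \<comment> \<open>The nonlinear part of \<open>F w\<close> will have squared norm at most 1, and
    \<open>2 * (1 + ?q1)\<close> is the bound that \<open>L2_diff_bound\<close> then gives for
    \<open>F w\<close>.\<close>
  define r where "r = 2 * ?q1 + 2"
  \<comment> \<open>\<open>M\<^sup>2\<close> dominates the sum of the squared norms of
    \<open>f\<close> and its solution for every \<open>f\<close> in the ball of squared radius
    \<open>r\<close>, so one bound holds for all solutions that occur.\<close>
  define M where "M = sqrt ((C1 + 1) * r)"
  have r: "r > 0" using q by (simp add: r_def add_nonneg_pos)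
  have M: "M > 0" "M\<^sup>2 = (C1 + 1) * r" using r C1(1) by (auto simp: M_def)
  define L where "L = C2 * M"
  \<comment> \<open>Collects the two constants to be beaten by \<open>\<epsilon>\<^sup>2\<close>:
    the size of the nonlinear term and its Lipschitz constant. Both use the bound \<open>L\<close>,
    which is fixed before \<open>\<epsilon>\<close> is chosen.\<close>
  define S where "S = exp (4 * L) * ?q2 * (1 + 4 * C2\<^sup>2 * (C1 + 1))"
  have S: "S \<ge> 0" "exp (4 * L) * ?q2 \<le> S" "4 * exp (4 * L) * ?q2 * C2\<^sup>2 * (C1 + 1) \<le> S"
  proof -
    have a: "0 \<le> exp (4 * L) * ?q2" "0 \<le> 4 * C2\<^sup>2 * (C1 + 1)" using q C1(1) by simp_all
    have e: "S = exp (4 * L) * ?q2 + exp (4 * L) * ?q2 * (4 * C2\<^sup>2 * (C1 + 1))"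
      unfolding S_def by (simp add: distrib_left)
    have "0 \<le> exp (4 * L) * ?q2 * (4 * C2\<^sup>2 * (C1 + 1))" by (rule mult_nonneg_nonneg[OF a])
    moreover have "4 * exp (4 * L) * ?q2 * C2\<^sup>2 * (C1 + 1) = exp (4 * L) * ?q2 * (4 * C2\<^sup>2 * (C1 + 1))" by (simp only: mult_ac)
    ultimately show "S \<ge> 0" "exp (4 * L) * ?q2 \<le> S" "4 * exp (4 * L) * ?q2 * C2\<^sup>2 * (C1 + 1) \<le> S"
      using a(1) unfolding e by linarith+
  qed
  \<comment> \<open>The denominator contains \<open>S + 1\<close> because \<open>S\<close> may be 0.
    The constant \<open>c\<close> below solves \<open>exp (2 * c) = \<epsilon>\<close>, so a small
    \<open>\<epsilon>\<close> is a very negative additive constant.\<close>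
  define \<epsilon> where "\<epsilon> = sqrt (1 / (4 * (S + 1)))"
  define c where "c = ln \<epsilon> / 2"
  have \<epsilon>: "\<epsilon> > 0" "\<epsilon>\<^sup>2 * S \<le> 1/4" "exp (2 * c) = \<epsilon>"
  proof -
    show e: "\<epsilon> > 0" using S(1) by (simp add: \<epsilon>_def)
    have "\<epsilon>\<^sup>2 * S = S / (4 * (S + 1))" using S(1) by (simp add: \<epsilon>_def)
    also have "\<dots> \<le> 1/4" using S(1) by (simp add: field_simps)
    finally show "\<epsilon>\<^sup>2 * S \<le> 1/4" .
    show "exp (2 * c) = \<epsilon>" using e by (simp add: c_def)
  qed
  define F where "F w x = Q\<^sub>2 x * (\<epsilon> * exp (2 * w x)) - Q\<^sub>1 x" for w :: "real^'n \<Rightarrow> real" and x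
  have wm: "w \<in> borel_measurable hyp_vol" if "energy_solution k f w" for f w :: "real^'n \<Rightarrow> real"
    using that L2_measurable unfolding energy_solution_def by blast
  have wL: "AE x in hyp_vol. \<bar>w x\<bar> \<le> L"
    if "f \<in> L2 hyp_vol" "(\<integral>x. (f x)\<^sup>2 \<partial>hyp_vol) \<le> r" "energy_solution k f w" for f w :: "real^'n \<Rightarrow> real"
    unfolding L_def using that M C1(1) by (intro sup[of f w M]) (auto intro: mult_left_mono)
  have expo: "(\<lambda>x. Q\<^sub>2 x * (\<epsilon> * exp (2 * w x))) \<in> L2 hyp_vol"
    "(\<integral>x. (Q\<^sub>2 x * (\<epsilon> * exp (2 * w x)))\<^sup>2 \<partial>hyp_vol) \<le> \<epsilon>\<^sup>2 * (exp (4 * L) * ?q2)"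
    if "f \<in> L2 hyp_vol" "(\<integral>x. (f x)\<^sup>2 \<partial>hyp_vol) \<le> r" "energy_solution k f w" for f w :: "real^'n \<Rightarrow> real"
  proof -
    note [measurable] = wm[OF that(3)]
    have m: "(\<lambda>x. \<epsilon> * exp (2 * w x)) \<in> borel_measurable hyp_vol" by measurable
    have b: "AE x in hyp_vol. \<bar>\<epsilon> * exp (2 * w x)\<bar> \<le> \<epsilon> * exp (2 * L)"
      using wL[OF that] by eventually_elim (use \<epsilon>(1) in \<open>auto simp: abs_mult\<close>)
    show "(\<lambda>x. Q\<^sub>2 x * (\<epsilon> * exp (2 * w x))) \<in> L2 hyp_vol" by (rule L2_bounded_mult(1)[OF Q2 m b])
    have "(\<epsilon> * exp (2 * L))\<^sup>2 = \<epsilon>\<^sup>2 * exp (4 * L)" by (simp add: power_mult_distrib flip: exp_double)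
    then show "(\<integral>x. (Q\<^sub>2 x * (\<epsilon> * exp (2 * w x)))\<^sup>2 \<partial>hyp_vol) \<le> \<epsilon>\<^sup>2 * (exp (4 * L) * ?q2)"
      using L2_bounded_mult(2)[OF Q2 m b] by (simp add: mult.assoc)
  qed
  obtain f w where fw: "f \<in> L2 hyp_vol" "(\<integral>x. (f x)\<^sup>2 \<partial>hyp_vol) \<le> r" "energy_solution k f w" "AE x in hyp_vol. f x = F w x"
  proof (rule L2_fixed_point[of hyp_vol "energy_solution k" r F])
    show "\<exists>w. energy_solution k f w" if "f \<in> L2 hyp_vol" for f :: "real^'n \<Rightarrow> real"
      by (rule energy_solution_exists[OF N2 that])
    show "0 \<le> r" using r by simp
    show "F w \<in> L2 hyp_vol \<and> (\<integral>x. (F w x)\<^sup>2 \<partial>hyp_vol) \<le> r"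
      if "f \<in> L2 hyp_vol" "(\<integral>x. (f x)\<^sup>2 \<partial>hyp_vol) \<le> r" "energy_solution k f w" for f w
    proof
      show "F w \<in> L2 hyp_vol" unfolding F_def[abs_def] by (rule L2_diff[OF expo(1)[OF that] Q1])
      have "(\<integral>x. (F w x)\<^sup>2 \<partial>hyp_vol) \<le> 2 * (\<integral>x. (Q\<^sub>2 x * (\<epsilon> * exp (2 * w x)))\<^sup>2 \<partial>hyp_vol) + 2 * ?q1"
        unfolding F_def by (rule L2_diff_bound[OF expo(1)[OF that] Q1])
      also have "\<epsilon>\<^sup>2 * (exp (4 * L) * ?q2) \<le> \<epsilon>\<^sup>2 * S" using S(2) by (intro mult_left_mono) auto
      then have "(\<integral>x. (Q\<^sub>2 x * (\<epsilon> * exp (2 * w x)))\<^sup>2 \<partial>hyp_vol) \<le> 1" using expo(2)[OF that] \<epsilon>(2) by linarith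
      then have "2 * (\<integral>x. (Q\<^sub>2 x * (\<epsilon> * exp (2 * w x)))\<^sup>2 \<partial>hyp_vol) + 2 * ?q1 \<le> r" by (simp add: r_def)
      finally show "(\<integral>x. (F w x)\<^sup>2 \<partial>hyp_vol) \<le> r" .
    qed
    show "(\<integral>x. (F w x - F w' x)\<^sup>2 \<partial>hyp_vol) \<le> 1/4 * (\<integral>x. (f x - f' x)\<^sup>2 \<partial>hyp_vol)"
      if f: "f \<in> L2 hyp_vol" "(\<integral>x. (f x)\<^sup>2 \<partial>hyp_vol) \<le> r" "energy_solution k f w"
        and f': "f' \<in> L2 hyp_vol" "(\<integral>x. (f' x)\<^sup>2 \<partial>hyp_vol) \<le> r" "energy_solution k f' w'" for f w f' w'
    proof (rule field_le_epsilon)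
      \<comment> \<open>The supremum bound requires a positive \<open>M'\<close>, but
        \<open>f\<close> and \<open>f'\<close> may coincide almost everywhere; the slack
        \<open>\<eta>\<close> covers this case.\<close>
      fix \<eta> :: real assume \<eta>: "\<eta> > 0"
      let ?d = "\<integral>x. (f x - f' x)\<^sup>2 \<partial>hyp_vol"
      have d0: "?d \<ge> 0" by simp
      define M' where "M' = sqrt ((C1 + 1) * (?d + \<eta>))"
      have "0 < (C1 + 1) * (?d + \<eta>)" using C1(1) d0 \<eta> by (intro mult_pos_pos add_nonneg_pos) auto
      then have M': "M' > 0" "M'\<^sup>2 = (C1 + 1) * (?d + \<eta>)" by (simp_all add: M'_def)
      have dw: "AE x in hyp_vol. \<bar>w x - w' x\<bar> \<le> C2 * M'"
        using C1(1) \<eta> M' by (intro sup[OF L2_diff[OF f(1) f'(1)] energy_solution_diff[OF N2 f(1) f'(1) f(3) f'(3)]] mult_left_mono) auto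
      note [measurable] = wm[OF f(3)] wm[OF f'(3)]
      have m: "(\<lambda>x. \<epsilon> * (exp (2 * w x) - exp (2 * w' x))) \<in> borel_measurable hyp_vol" by measurable
      have b: "AE x in hyp_vol. \<bar>\<epsilon> * (exp (2 * w x) - exp (2 * w' x))\<bar> \<le> \<epsilon> * (exp (2 * L) * (2 * (C2 * M')))"
        using dw wL[OF f] wL[OF f']
      proof eventually_elim
        case (elim x)
        have "\<bar>exp (2 * w x) - exp (2 * w' x)\<bar> \<le> exp (2 * L) * \<bar>2 * w x - 2 * w' x\<bar>"
          using elim by (intro exp_diff_le) auto
        also have "\<dots> \<le> exp (2 * L) * (2 * (C2 * M'))" using elim(1) by (intro mult_left_mono) auto
        finally show ?case using \<epsilon>(1) by (simp add: abs_mult)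
      qed
      have "(\<lambda>x. (F w x - F w' x)\<^sup>2) = (\<lambda>x. (Q\<^sub>2 x * (\<epsilon> * (exp (2 * w x) - exp (2 * w' x))))\<^sup>2)"
        by (simp add: F_def algebra_simps)
      then have "(\<integral>x. (F w x - F w' x)\<^sup>2 \<partial>hyp_vol) \<le> (\<epsilon> * (exp (2 * L) * (2 * (C2 * M'))))\<^sup>2 * ?q2"
        using L2_bounded_mult(2)[OF Q2 m b] by simp
      also have "(\<epsilon> * (exp (2 * L) * (2 * (C2 * M'))))\<^sup>2 = \<epsilon>\<^sup>2 * (exp (2 * L))\<^sup>2 * 4 * C2\<^sup>2 * M'\<^sup>2"
        by (simp add: power_mult_distrib)
      also have "(exp (2 * L))\<^sup>2 = exp (4 * L)" by (simp flip: exp_double)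
      also have "\<epsilon>\<^sup>2 * exp (4 * L) * 4 * C2\<^sup>2 * M'\<^sup>2 * ?q2 = \<epsilon>\<^sup>2 * (4 * exp (4 * L) * ?q2 * C2\<^sup>2 * (C1 + 1)) * (?d + \<eta>)"
        unfolding M'(2) by (simp only: mult_ac)
      also have "\<dots> \<le> \<epsilon>\<^sup>2 * S * (?d + \<eta>)"
        using S(3) d0 \<eta> by (intro mult_right_mono mult_left_mono) auto
      also have "\<dots> \<le> 1/4 * (?d + \<eta>)" using \<epsilon>(2) d0 \<eta> by (intro mult_right_mono) auto
      also have "\<dots> \<le> 1/4 * ?d + \<eta>" using \<eta> by simp
      finally show "(\<integral>x. (F w x - F w' x)\<^sup>2 \<partial>hyp_vol) \<le> 1/4 * ?d + \<eta>" .
    qed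
  qed
  have w: "w \<in> L2 hyp_vol" using fw(3) by (simp add: energy_solution_def)
  have nonlin: "(\<lambda>x. Q\<^sub>2 x * exp (2 * (w x + c))) = (\<lambda>x. Q\<^sub>2 x * (\<epsilon> * exp (2 * w x)))"
    by (simp only: distrib_left[of 2] exp_add \<epsilon>(3) mult.commute[of "exp _" \<epsilon>])
  note Q2w = expo(1)[OF fw(1-3)]
  have "weak_solution k Q\<^sub>1 Q\<^sub>2 (\<lambda>x. w x + c)"
    unfolding weak_solution_def
  proof (intro conjI ballI)
    show "hyp_locally_integrable (\<lambda>x. w x + c)" by (rule L2_locally_integrable[OF w])
    show "hyp_locally_integrable Q\<^sub>1" using L2_locally_integrable[OF Q1, of 0] by simp
    show "hyp_locally_integrable (\<lambda>x. Q\<^sub>2 x * exp (2 * (w x + c)))"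
      unfolding nonlin using L2_locally_integrable[OF Q2w, of 0] by simp
    fix v :: "real^'n \<Rightarrow> real" assume v: "v \<in> test_functions"
    have g: "gjms k v \<in> test_functions" by (rule test_gjms[OF N2 v])
    have "(\<integral>x. (w x + c) * gjms k v x \<partial>hyp_vol) = (\<integral>x. w x * gjms k v x \<partial>hyp_vol) + c * (\<integral>x. gjms k v x \<partial>hyp_vol)"
      using L2_mult_integrable[OF w test_L2[OF g]] test_integrable[OF g] by (simp add: distrib_right)
    \<comment> \<open>The constant contributes nothing, by \<open>integral_gjms\<close>.\<close>
    also have "\<dots> = (\<integral>x. f x * v x \<partial>hyp_vol)"
      using fw(3) v integral_gjms[OF N k v] by (simp add: energy_solution_def)
    also have "\<dots> = (\<integral>x. F w x * v x \<partial>hyp_vol)"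
    proof (rule integral_cong_AE)
      show "(\<lambda>x. f x * v x) \<in> borel_measurable hyp_vol" "(\<lambda>x. F w x * v x) \<in> borel_measurable hyp_vol"
        unfolding F_def using L2_measurable[OF fw(1)] L2_measurable[OF Q2w] L2_measurable[OF Q1] test_measurable_hyp[OF v]
        by simp_all
      show "AE x in hyp_vol. f x * v x = F w x * v x" using fw(4) by eventually_elim simp
    qed
    also have "\<dots> = (\<integral>x. Q\<^sub>2 x * (\<epsilon> * exp (2 * w x)) * v x \<partial>hyp_vol) - (\<integral>x. Q\<^sub>1 x * v x \<partial>hyp_vol)"
      unfolding F_def left_diff_distrib
      by (rule Bochner_Integration.integral_diff[OF L2_mult_integrable[OF Q2w test_L2[OF v]] L2_mult_integrable[OF Q1 test_L2[OF v]]])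
    finally show "(\<integral>x. (w x + c) * gjms k v x \<partial>hyp_vol) + (\<integral>x. Q\<^sub>1 x * v x \<partial>hyp_vol)
        = (\<integral>x. Q\<^sub>2 x * exp (2 * (w x + c)) * v x \<partial>hyp_vol)"
      unfolding fun_cong[OF nonlin] by simp
  qed
  then show ?thesis using energy_solution_sobolev[OF N2 fw(3)] by blast
qed

end
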